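(* The following Weihrauch reductions hold. (1) For $\mathcal{C}$ the set of (finitely generated) metabelian groups, $\mathrm{Res}_{\mathcal{C}}\ge_W\mathrm{Lim}_{\searrow\omega^{\omega}}$. (2) For any $p\ge1$ and $\mathcal{C}$ the set of (finitely generated) $p$-nilpotent groups (nilpotent of class at most $p$), $\mathrm{Res}_{\mathcal{C}}\equiv_W\mathrm{Lim}_{\searrow\omega^2}$. (3) For $\mathcal{C}$ a finite set of finite groups (up to isomorphism), at least one of which is non-trivial, $\mathrm{Res}_{\mathcal{C}}\equiv_W\mathrm{Lim}_{\searrow\omega}$.
   Context: Marked groups. For $k\in\mathbb{N}$, a $k$-marked group is a pair $(G,S)$ with $G$ a group and $S\in G^k$ a generating $k$-tuple, up to marked isomorphism (group isomorphisms sending the $i$-th generator to the $i$-th generator); $k$-marked groups correspond to normal subgroups of the free group $\mathbb{F}_k$. $\mathcal{G}_{\mathrm{WP}}$ is the set of all marked groups with the topological disjoint union over $k$ of the subspace topologies coming from $\{0,1\}^{\mathbb{F}_k}$. It is represented as follows: fixing bijections $\theta_k:\mathbb{N}\to\mathbb{F}_k$, a name of a $k$-marked group is a sequence $u\in\mathbb{N}^{\mathbb{N}}$ with $u_0=k$ and $(u_{n+1})_n\in\{0,1\}^{\mathbb{N}}$ the characteristic function of $\{n:\theta_k(n)=1\text{ in }G\}$. $\mathrm{Res}_{\mathcal{C}}:\mathcal{G}_{\mathrm{WP}}\to\mathcal{G}_{\mathrm{WP}}$ maps $(G,S)$ to the quotient of $G$ by $\bigcap_{f:G\twoheadrightarrow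 H,\,H\in\mathcal{C}}\ker(f)$, marked by the image of $S$ (the greatest residually-$\mathcal{C}$ quotient). Weihrauch reducibility. A represented space is a set $X$ with a partial surjection $\delta:\subseteq\mathbb{N}^{\mathbb{N}}\to X$; $p$ is a name of $\delta(p)$. $\mathbb{N}$ is represented by $p\mapsto p(0)$, $\mathbb{N}^{\mathbb{N}}$ by the identity, and products by interleaving names. A problem is a partial multi-function $f:\subseteq X\rightrightarrows Y$ between represented spaces, with $\mathrm{dom}(f)=\{x: f(x)\neq\emptyset\}$. A realizer of $f$ is a partial $F:\subseteq\mathbb{N}^{\mathbb{N}}\to\mathbb{N}^{\mathbb{N}}$ mapping each name of each $x\in\mathrm{dom}(f)$ to a name of some element of $f(x)$; $f$ is continuously realizable if it has a continuous realizer. Composition: $\mathrm{dom}(g\circ f)=\{x\in\mathrm{dom}(f): f(x)\subseteq\mathrm{dom}(g)\}$, $(g\circ f)(x)=\bigcup_{y\in f(x)}g(y)$. Write $P_1\sqsubseteq P_2$ if $\mathrm{dom}(P_2)\subseteq\mathrm{dom}(P_1)$ and $P_1(x)\subseteq P_2(x)$ for all $x\in\mathrm{dom}(P_2)$. For $Q:\subseteq X\rightrightarrows Y$ and $P:\subseteq Z\rightrightarrows W$, $Q\le_W P$ (equivalently $P\ge_W Q$) means that there are a represented space $V$ and continuously realizable $k:\subseteq X\rightrightarrows V\times Z$, $h:\subseteq V\times W\rightrightarrows Y$ with $h\circ(\mathrm{id}_V\times P)\circ k\sqsubseteq Q$. $P\equiv_W Q$ means $P\le_W Q$ and $Q\le_W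 P$. For a non-zero countable ordinal $\alpha$, fix a surjection $f:\mathbb{N}\to\alpha$. $\mathrm{Lim}_{\searrow\alpha}$ is the Weihrauch equivalence class (independent of $f$) of the problem $\subseteq\mathbb{N}^{\mathbb{N}}\rightrightarrows\mathbb{N}$ whose domain is the set of $(u_n)$ with $f(u_{n+1})\le f(u_n)$ for all $n$, and which maps such $(u_n)$ to $\{t\in\mathbb{N}: f(t)=\inf_n f(u_n)\}$. *)

theory Defs
  imports "HOL-Analysis.Function_Topology" "HOL-Algebra.Generated_Groups"
begin

section \<open>Represented spaces and Weihrauch reducibility\<close>

text \<open>A represented space is given by its representation alone: the underlying set is
  \<^term>\<open>ran \<delta>\<close>, so that surjectivity holds by construction.\<close>

type_synonym 'x repr = "(nat \<Rightarrow> nat) \<rightharpoonup> 'x"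

definition baire_repr :: "(nat \<Rightarrow> nat) repr" where
  "baire_repr p = Some p"

definition nat_repr :: "nat repr" where
  "nat_repr p = Some (p 0)"

definition prod_repr :: "'x repr \<Rightarrow> 'y repr \<Rightarrow> ('x \<times> 'y) repr" (infixr \<open>\<times>\<^sub>R\<close> 75) where
  "(\<delta> \<times>\<^sub>R \<epsilon>) p =
     (case (\<delta> (\<lambda>n. p (2 * n)), \<epsilon> (\<lambda>n. p (2 * n + 1))) of
        (Some x, Some y) \<Rightarrow> Some (x, y)
      | _ \<Rightarrow> None)"

datatype ('x, 'y) problem =
  Problem (inrep: "'x repr") (outrep: "'y repr") (app: "'x \<Rightarrow> 'y set")

definition pdom :: "('x, 'y) problem \<Rightarrow> 'x set" where
  "pdom P = {x. app P x \<noteq> {}}"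

definition is_problem :: "('x, 'y) problem \<Rightarrow> bool" where
  "is_problem P \<longleftrightarrow> pdom P \<subseteq> ran (inrep P) \<and> (\<forall>x. app P x \<subseteq> ran (outrep P))"

definition realizer :: "((nat \<Rightarrow> nat) \<rightharpoonup> (nat \<Rightarrow> nat)) \<Rightarrow> ('x, 'y) problem \<Rightarrow> bool" where
  "realizer F P \<longleftrightarrow>
     (\<forall>p x. inrep P p = Some x \<and> x \<in> pdom P \<longrightarrow>
        (\<exists>q y. F p = Some q \<and> outrep P q = Some y \<and> y \<in> app P x))"

text \<open>Continuity refers to the product topology on \<^typ>\<open>nat \<Rightarrow> nat\<close>, with
  \<^typ>\<open>nat\<close> discrete.\<close>

definition continuously_realizable :: "('x, 'y) problem \<Rightarrow> bool" where
  "continuously_realizable P \<longleftrightarrow>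
     (\<exists>F. realizer F P \<and> continuous_on (dom F) (\<lambda>p. the (F p)))"

definition id_problem :: "'x repr \<Rightarrow> ('x, 'x) problem" where
  "id_problem \<delta> = Problem \<delta> \<delta> (\<lambda>x. if x \<in> ran \<delta> then {x} else {})"

definition prod_problem ::
  "('x, 'y) problem \<Rightarrow> ('z, 'w) problem \<Rightarrow> ('x \<times> 'z, 'y \<times> 'w) problem" (infixr \<open>\<times>\<^sub>P\<close> 75) where
  "P \<times>\<^sub>P Q = Problem (inrep P \<times>\<^sub>R inrep Q) (outrep P \<times>\<^sub>R outrep Q)
     (\<lambda>(x, z). app P x \<times> app Q z)"

definition comp_problem ::
  "('y, 'z) problem \<Rightarrow> ('x, 'y) problem \<Rightarrow> ('x, 'z) problem" (infixr \<open>\<circ>\<^sub>P\<close> 70) where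
  "Q \<circ>\<^sub>P P = Problem (inrep P) (outrep Q)
     (\<lambda>x. if x \<in> pdom P \<and> app P x \<subseteq> pdom Q then \<Union>y\<in>app P x. app Q y else {})"

definition refines :: "('x, 'y) problem \<Rightarrow> ('x, 'y) problem \<Rightarrow> bool" (infix \<open>\<sqsubseteq>\<^sub>P\<close> 50) where
  "P \<sqsubseteq>\<^sub>P Q \<longleftrightarrow> pdom Q \<subseteq> pdom P \<and> (\<forall>x\<in>pdom Q. app P x \<subseteq> app Q x)"

text \<open>A represented space has at most the cardinality of the continuum, so it is no
  restriction to take the points of the auxiliary space \<open>\<delta>\<^sub>V\<close> in \<^typ>\<open>nat \<Rightarrow> nat\<close>;
  the representation on them remains arbitrary.\<close>

definition weihrauch_le :: "('x, 'y) problem \<Rightarrow> ('z, 'w) problem \<Rightarrow> bool" (infix \<open>\<le>\<^sub>W\<close> 50) where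
  "Q \<le>\<^sub>W P \<longleftrightarrow>
     (\<exists>(\<delta>\<^sub>V :: (nat \<Rightarrow> nat) repr)
       (k :: ('x, (nat \<Rightarrow> nat) \<times> 'z) problem)
       (h :: ((nat \<Rightarrow> nat) \<times> 'w, 'y) problem).
        is_problem k \<and> inrep k = inrep Q \<and> outrep k = \<delta>\<^sub>V \<times>\<^sub>R inrep P \<and>
        is_problem h \<and> inrep h = \<delta>\<^sub>V \<times>\<^sub>R outrep P \<and> outrep h = outrep Q \<and>
        continuously_realizable k \<and> continuously_realizable h \<and>
        h \<circ>\<^sub>P (id_problem \<delta>\<^sub>V \<times>\<^sub>P P) \<circ>\<^sub>P k \<sqsubseteq>\<^sub>P Q)"

definition weihrauch_equiv :: "('x, 'y) problem \<Rightarrow> ('z, 'w) problem \<Rightarrow> bool"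
    (infix \<open>\<equiv>\<^sub>W\<close> 50) where
  "P \<equiv>\<^sub>W Q \<longleftrightarrow> P \<le>\<^sub>W Q \<and> Q \<le>\<^sub>W P"


section \<open>Limits of decreasing sequences of ordinals\<close>

text \<open>Ordinals are given by well-order relations, as in \<^const>\<open>natLeq\<close> for \<open>\<omega>\<close>. The
  elements of the ordinal are the points of the field of the relation.\<close>

definition omega_square :: "(nat \<times> nat) rel" where
  "omega_square = {((a, b), (c, d)). a < c \<or> a = c \<and> b \<le> d}"

text \<open>Ordinal exponentiation: finitely supported functions, compared at the largest
  argument at which they differ. The function \<open>g\<close> stands for the Cantor normal form
  \<open>\<dots> + \<omega>\<^sup>2 \<cdot> g 2 + \<omega> \<cdot> g 1 + g 0\<close>.\<close>

definition omega_omega :: "(nat \<Rightarrow> nat) rel" where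
  "omega_omega = {(g, h). finite {i. g i \<noteq> 0} \<and> finite {i. h i \<noteq> 0} \<and>
     (g = h \<or> (\<exists>m. g m < h m \<and> (\<forall>i>m. g i = h i)))}"

definition Lim_desc :: "'a rel \<Rightarrow> (nat \<Rightarrow> 'a) \<Rightarrow> (nat \<Rightarrow> nat, nat) problem" where
  "Lim_desc r f = Problem baire_repr nat_repr
     (\<lambda>u. {t. (\<forall>n. (f (u (Suc n)), f (u n)) \<in> r) \<and>
               f t = wo_rel.minim r (range (\<lambda>n. f (u n)))})"


section \<open>Marked groups\<close>

text \<open>Elements of the free group on \<open>k\<close> generators are reduced words; the letter
  \<open>(i, True)\<close> is the \<open>i\<close>-th generator and \<open>(i, False)\<close> its inverse.\<close>

type_synonym word = "(nat \<times> bool) list"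

definition free_words :: "nat \<Rightarrow> word set" where
  "free_words k = {w. set w \<subseteq> {..<k} \<times> UNIV \<and>
     successively (\<lambda>a b. \<not> (fst a = fst b \<and> snd a \<noteq> snd b)) w}"

text \<open>The free group of rank \<open>0\<close> is trivial, so \<open>\<theta> 0\<close> cannot be injective. It is then the
  constant map.\<close>

definition word_enumeration :: "(nat \<Rightarrow> nat \<Rightarrow> word) \<Rightarrow> bool" where
  "word_enumeration \<theta> \<longleftrightarrow>
     (\<forall>k\<ge>1. bij_betw (\<theta> k) UNIV (free_words k)) \<and> range (\<theta> 0) = free_words 0"

definition eval_word :: "('g, 'm) monoid_scheme \<Rightarrow> 'g list \<Rightarrow> word \<Rightarrow> 'g" where
  "eval_word G S w =
     foldr (\<lambda>(i, b) x. (if b then S ! i else inv\<^bsub>G\<^esub> (S ! i)) \<otimes>\<^bsub>G\<^esub> x) w \<one>\<^bsub>G\<^esub>"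

definition marked_group :: "'g monoid \<Rightarrow> 'g list \<Rightarrow> bool" where
  "marked_group G S \<longleftrightarrow> group G \<and> set S \<subseteq> carrier G \<and> generate G (set S) = carrier G"

definition marked_iso :: "'g monoid \<Rightarrow> 'g list \<Rightarrow> 'h monoid \<Rightarrow> 'h list \<Rightarrow> bool" where
  "marked_iso G S H T \<longleftrightarrow> (\<exists>\<phi>\<in>iso G H. map \<phi> S = T)"

text \<open>Finitely generated groups are countable, so every isomorphism class has a
  representative with carrier in \<^typ>\<open>nat\<close>.\<close>

type_synonym marked_class = "(nat monoid \<times> nat list) set"

definition marked_class_of :: "'g monoid \<Rightarrow> 'g list \<Rightarrow> marked_class" where
  "marked_class_of G S = {(H, T). marked_group H T \<and> marked_iso G S H T}"

definition marked_groups :: "marked_class set" where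
  "marked_groups = {marked_class_of G S | (G :: nat monoid) S. marked_group G S}"

definition names :: "(nat \<Rightarrow> nat \<Rightarrow> word) \<Rightarrow> (nat \<Rightarrow> nat) \<Rightarrow> marked_class \<Rightarrow> bool" where
  "names \<theta> u M \<longleftrightarrow> M \<in> marked_groups \<and>
     (\<exists>(G, S)\<in>M. u 0 = length S \<and>
        (\<forall>n. u (Suc n) = (if eval_word G S (\<theta> (length S) n) = \<one>\<^bsub>G\<^esub> then 1 else 0)))"

definition marked_repr :: "(nat \<Rightarrow> nat \<Rightarrow> word) \<Rightarrow> marked_class repr" where
  "marked_repr \<theta> u = (if \<exists>M. names \<theta> u M then Some (THE M. names \<theta> u M) else None)"


section \<open>Residual quotients\<close>

text \<open>The intersection of the empty family is the whole group.\<close>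

definition res_kernel :: "'h monoid set \<Rightarrow> 'g monoid \<Rightarrow> 'g set" where
  "res_kernel \<C> G = carrier G \<inter> (\<Inter>H\<in>\<C>. \<Inter>f\<in>epi G H. kernel G H f)"

definition res_quotient :: "'h monoid set \<Rightarrow> 'g monoid \<Rightarrow> 'g list \<Rightarrow> marked_class" where
  "res_quotient \<C> G S =
     marked_class_of (G Mod res_kernel \<C> G) (map (\<lambda>s. res_kernel \<C> G #>\<^bsub>G\<^esub> s) S)"

definition Res :: "(nat \<Rightarrow> nat \<Rightarrow> word) \<Rightarrow> 'h monoid set \<Rightarrow> (marked_class, marked_class) problem"
  where
  "Res \<theta> \<C> = Problem (marked_repr \<theta>) (marked_repr \<theta>)
     (\<lambda>M. if M \<in> marked_groups then {res_quotient \<C> G S | G S. (G, S) \<in> M} else {})"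


section \<open>Classes of groups\<close>

definition fin_gen_group :: "'g monoid \<Rightarrow> bool" where
  "fin_gen_group G \<longleftrightarrow>
     group G \<and> (\<exists>A. finite A \<and> A \<subseteq> carrier G \<and> generate G A = carrier G)"

definition metabelian_groups :: "nat monoid set" where
  "metabelian_groups = {G. fin_gen_group G \<and> derived G (derived G (carrier G)) = {\<one>\<^bsub>G\<^esub>}}"

text \<open>The lower central series, with \<open>lower_central G 0\<close> the whole group.\<close>

primrec lower_central :: "'g monoid \<Rightarrow> nat \<Rightarrow> 'g set" where
  "lower_central G 0 = carrier G"
| "lower_central G (Suc n) = generate G
     {x \<otimes>\<^bsub>G\<^esub> y \<otimes>\<^bsub>G\<^esub> inv\<^bsub>G\<^esub> x \<otimes>\<^bsub>G\<^esub> inv\<^bsub>G\<^esub> y | x y. x \<in> lower_central G n \<and> y \<in> carrier G}"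

definition nilpotent_groups :: "nat \<Rightarrow> nat monoid set" where
  "nilpotent_groups p = {G. fin_gen_group G \<and> lower_central G p = {\<one>\<^bsub>G\<^esub>}}"

definition finite_up_to_iso :: "'h monoid set \<Rightarrow> bool" where
  "finite_up_to_iso \<C> \<longleftrightarrow> (\<exists>\<D>\<subseteq>\<C>. finite \<D> \<and> (\<forall>G\<in>\<C>. \<exists>H\<in>\<D>. G \<cong> H))"

end

theory Submission
  imports Defs "HOL-Algebra.Bij" "HOL-Algebra.Product_Groups" "HOL-Algebra.Multiplicative_Group"
    "HOL-Library.Function_Algebras"
begin

text \<open>
  Upper bounds: since no computability is required, it suffices to assign to every finite set \<open>R\<close> of
  relators an ordinal that decreases with \<open>R\<close> and, when it stays constant, determines the
  residual quotient. For finitely many finite groups this is the number of their markings that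
  satisfy \<open>R\<close>. For nilpotent groups one works in a relatively free nilpotent group, realised
  inside the product of all marked groups of the class; a polycyclic series assigns an ordinal
  below \<open>\<omega>\<^sup>2\<close> to each subgroup by counting the infinite cyclic factors met trivially and adding
  up the finite indices.

  Lower bounds: a descending sequence of ordinals is turned into a group whose word problem may
  only depend on a finite part of the sequence, so relators must be added without affecting short
  words. For finite groups, generators of infinite order of a free product of cyclic groups are
  given a late, large finite order that is prime to the orders of the groups in the class, so
  that they vanish in all quotients in the class. In the other two cases let
  \<open>K\<^sub>\<alpha>\<close> be submodules of a module \<open>M\<close> that grow as \<open>\<alpha>\<close> decreases. The group acts on
  \<open>\<int> \<times> {0, \<dots>, 4} \<times> M/K\<^sub>\<alpha>\<close>, for all terms \<open>\<alpha>\<close> of the sequence at once, by the shift of \<open>\<int>\<close>, by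
  the 3-cycles over \<open>0 \<in> \<int>\<close>, by operators of \<open>M\<close>, and by translations over the points
  \<open>(N, 0)\<close> and \<open>(N, 1)\<close> with opposite signs, where \<open>N\<close> grows along the sequence. Being
  commutators of each other, the 3-cycles are trivial in metabelian and in nilpotent quotients,
  and there every translation that is trivial modulo the final \<open>K\<^sub>\<alpha>\<close> becomes a product of
  commutators with 3-cycles. Conversely, the affine group of \<open>M/K\<^sub>\<alpha>\<close> is such a quotient.
  For nilpotent groups \<open>M = \<int>\<^sup>k\<close>; for metabelian groups \<open>M\<close> consists of power series, with
  \<open>K\<^sub>\<alpha>\<close> the series whose monomials have exponents above \<open>\<alpha>\<close> in the lexicographic order.
\<close>

section \<open>Words and marked groups\<close>

text \<open>Entries of a name are final: once a short word is declared non-trivial, no later relator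
  may kill it. New relators are therefore planted at a distance (an order, or a centre) exceeding
  the words already decided, and the class must be blind to that distance. For finite groups the
  late orders are congruent to 1 modulo a common multiple of the group orders. For the other classes
  five points are used because there every 3-cycle is a commutator of two 3-cycles. The opposite
  signs are forced: commutators of translations with 3-cycles produce only distributions of total
  weight zero, which a translation above a single point is not. The affine quotient reappears by
  adding up the translations along the row of points \<open>(z, 0)\<close>, which a word that is
  short compared with the centre does not leave. The limit is decoded by test words: for every index
  \<open>a\<close> some element lies in \<open>K b\<close> for all \<open>b\<close> below
  \<open>a\<close> but not in \<open>K a\<close>, so its word survives in the residual quotient
  exactly if the sequence never drops below \<open>a\<close>.\<close>

definition words :: "nat \<Rightarrow> word set" where
  "words k = lists ({..<k} \<times> UNIV)"

definition inv_word :: "word \<Rightarrow> word" where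
  "inv_word w = rev (map (\<lambda>(i, b). (i, \<not> b)) w)"

lemma Nil_words [simp]: "[] \<in> words k"
  and Cons_words [simp]: "a # w \<in> words k \<longleftrightarrow> fst a < k \<and> w \<in> words k"
  and append_words [simp]: "v @ w \<in> words k \<longleftrightarrow> v \<in> words k \<and> w \<in> words k"
  by (auto simp: words_def mem_Times_iff)

lemma inv_word_simps [simp]: "inv_word [] = []" "inv_word (a # w) = inv_word w @ [(fst a, \<not> snd a)]"
  "inv_word (v @ w) = inv_word w @ inv_word v"
  by (auto simp: inv_word_def split: prod.splits)

lemma inv_word_words [simp]: "inv_word w \<in> words k \<longleftrightarrow> w \<in> words k"
  by (induction w) auto

lemma eval_word_Nil [simp]: "eval_word G S [] = \<one>\<^bsub>G\<^esub>"
  and eval_word_Cons: "eval_word G S (a # w) =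
    (if snd a then S ! fst a else inv\<^bsub>G\<^esub> (S ! fst a)) \<otimes>\<^bsub>G\<^esub> eval_word G S w"
  by (auto simp: eval_word_def split: prod.splits)

context group
begin

lemma letter_closed:
  "set S \<subseteq> carrier G \<Longrightarrow> i < length S \<Longrightarrow> (if b then S ! i else inv (S ! i)) \<in> carrier G"
  by (auto simp: subset_iff)

lemma eval_word_closed [simp]:
  "set S \<subseteq> carrier G \<Longrightarrow> w \<in> words (length S) \<Longrightarrow> eval_word G S w \<in> carrier G"
  by (induction w) (auto simp: eval_word_Cons subset_iff)

lemma eval_word_append:
  assumes "set S \<subseteq> carrier G" "v \<in> words (length S)" "w \<in> words (length S)"
  shows "eval_word G S (v @ w) = eval_word G S v \<otimes> eval_word G S w"
  using assms(2)
proof (induction v)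
  case (Cons a v)
  then show ?case using assms letter_closed[OF assms(1), of "fst a" "snd a"]
    by (simp add: eval_word_Cons m_assoc del: if_splits)
qed (use assms in auto)

lemma eval_word_single:
  assumes "set S \<subseteq> carrier G" "i < length S"
  shows "eval_word G S [(i, b)] = (if b then S ! i else inv (S ! i))"
proof -
  have "S ! i \<in> carrier G" using assms by (auto simp: subset_iff)
  then show ?thesis by (cases b) (auto simp: eval_word_Cons)
qed

lemma eval_word_inv:
  assumes "set S \<subseteq> carrier G" "w \<in> words (length S)"
  shows "eval_word G S (inv_word w) = inv (eval_word G S w)"
  using assms(2)
proof (induction w)
  case (Cons a w)
  have c: "S ! fst a \<in> carrier G" using assms(1) Cons.prems by (auto simp: subset_iff)
  from Cons show ?case using assms(1) c
    by (auto simp: eval_word_append eval_word_single eval_word_Cons inv_mult_group)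
qed auto

lemma generate_eq_eval_word:
  assumes S: "set S \<subseteq> carrier G"
  shows "generate G (set S) = eval_word G S ` words (length S)"
proof (intro equalityI subsetI)
  fix x assume "x \<in> generate G (set S)"
  then show "x \<in> eval_word G S ` words (length S)"
  proof induction
    case one
    then show ?case by (intro image_eqI[of _ _ "[]"]) auto
  next
    case (incl h)
    then obtain i where "i < length S" "S ! i = h" by (auto simp: in_set_conv_nth)
    then show ?case using eval_word_single[OF S, of i True]
      by (intro image_eqI[of _ _ "[(i, True)]"]) auto
  next
    case (inv h)
    then obtain i where "i < length S" "S ! i = h" by (auto simp: in_set_conv_nth)
    then show ?case using eval_word_single[OF S, of i False]
      by (intro image_eqI[of _ _ "[(i, False)]"]) auto
  next
    case (eng h1 h2)
    then obtain v w where "v \<in> words (length S)" "w \<in> words (length S)"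
      "h1 = eval_word G S v" "h2 = eval_word G S w" by auto
    then show ?case using S by (intro image_eqI[of _ _ "v @ w"]) (auto simp: eval_word_append)
  qed
next
  fix x assume "x \<in> eval_word G S ` words (length S)"
  then obtain w where w: "w \<in> words (length S)" "x = eval_word G S w" by auto
  have "eval_word G S w \<in> generate G (set S)" using w(1)
  proof (induction w)
    case (Cons a w)
    then have "S ! fst a \<in> set S" by auto
    then have "(if snd a then S ! fst a else inv (S ! fst a)) \<in> generate G (set S)"
      by (auto intro: generate.intros)
    with Cons show ?case by (auto simp: eval_word_Cons intro: generate.eng)
  qed (auto intro: generate.one)
  with w show "x \<in> generate G (set S)" by simp
qed

end

section \<open>Free reduction\<close>

fun cancel_cons :: "nat \<times> bool \<Rightarrow> word \<Rightarrow> word" where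
  "cancel_cons a [] = [a]"
| "cancel_cons a (b # w) = (if fst a = fst b \<and> snd a \<noteq> snd b then w else a # b # w)"

text \<open>Calculations are done with unreduced words, which are closed under concatenation and
  formal inversion; \<open>reduce\<close> leads back to the words enumerated by \<theta>.\<close>

definition reduce :: "word \<Rightarrow> word" where
  "reduce w = foldr cancel_cons w []"

lemma free_words_subset: "free_words k \<subseteq> words k"
  by (auto simp: free_words_def words_def)

lemma reduce_free_words: "w \<in> words k \<Longrightarrow> reduce w \<in> free_words k"
proof (induction w)
  case (Cons a w)
  have red: "reduce (a # w) = cancel_cons a (reduce w)" by (simp add: reduce_def)
  have "reduce w \<in> free_words k" using Cons by simp
  then show ?case unfolding red using Cons.prems
    by (cases "reduce w") (auto simp: free_words_def successively_Cons mem_Times_iff)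
qed (auto simp: reduce_def free_words_def)

lemma (in group) eval_word_reduce:
  assumes S: "set S \<subseteq> carrier G" and w: "w \<in> words (length S)"
  shows "eval_word G S (reduce w) = eval_word G S w"
  using w
proof (induction w)
  case (Cons a w)
  have red: "reduce (a # w) = cancel_cons a (reduce w)" by (simp add: reduce_def)
  have rw: "reduce w \<in> words (length S)"
    using Cons reduce_free_words free_words_subset by fastforce
  have c: "S ! fst a \<in> carrier G" using S Cons.prems by (auto simp: subset_iff)
  have IH: "eval_word G S (reduce w) = eval_word G S w" using Cons by simp
  have "eval_word G S (cancel_cons a (reduce w)) = eval_word G S (a # reduce w)"
  proof (cases "reduce w")
    case (Cons b v)
    have cl: "eval_word G S v \<in> carrier G" using rw Cons S by simp
    show ?thesis unfolding Cons using c cl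
      by (auto simp: eval_word_Cons simp flip: m_assoc)
  qed simp
  then show ?case unfolding red by (simp add: eval_word_Cons IH)
qed (auto simp: reduce_def)

lemma eval_word_hom:
  assumes "group G" "group H" and f: "f \<in> hom G H" and S: "set S \<subseteq> carrier G"
    and w: "w \<in> words (length S)"
  shows "f (eval_word G S w) = eval_word H (map f S) w"
  using w
proof (induction w)
  case Nil
  interpret group_hom G H f using assms by (simp add: group_hom_def group_hom_axioms_def)
  show ?case by simp
next
  case (Cons a w)
  interpret group_hom G H f using assms by (simp add: group_hom_def group_hom_axioms_def)
  have c: "S ! fst a \<in> carrier G" using S Cons.prems by (auto simp: subset_iff)
  show ?case using Cons c S by (auto simp: eval_word_Cons)
qed

section \<open>Kernels of marked groups\<close>

definition word_kernel :: "('g, 'm) monoid_scheme \<Rightarrow> 'g list \<Rightarrow> word set" where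
  "word_kernel G S = {w \<in> words (length S). eval_word G S w = \<one>\<^bsub>G\<^esub>}"

text \<open>Reduction preserves values, so the reduced words, the only ones a name speaks about,
  already control the whole kernel.\<close>

lemma word_kernel_free_words_mono:
  assumes "group G" "set S \<subseteq> carrier G" "group H" "set T \<subseteq> carrier H" "length T = length S"
    and "\<And>w. w \<in> free_words (length S) \<Longrightarrow> eval_word G S w = \<one>\<^bsub>G\<^esub> \<Longrightarrow> eval_word H T w = \<one>\<^bsub>H\<^esub>"
  shows "word_kernel G S \<subseteq> word_kernel H T"
proof
  fix w assume "w \<in> word_kernel G S"
  then have w: "w \<in> words (length S)" "eval_word G S w = \<one>\<^bsub>G\<^esub>" by (auto simp: word_kernel_def)
  have "eval_word H T (reduce w) = \<one>\<^bsub>H\<^esub>"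
    using assms(6) reduce_free_words w group.eval_word_reduce[OF assms(1,2)] by metis
  then show "w \<in> word_kernel H T"
    using w assms group.eval_word_reduce[OF assms(3,4)] by (simp add: word_kernel_def)
qed

text \<open>Von Dyck's theorem: the value on a word is forced, and the inclusion of kernels makes it
  independent of the word chosen for an element.\<close>

lemma marked_group_hom_extension:
  assumes mg: "marked_group G S" and H: "group H" "set T \<subseteq> carrier H"
    and len: "length T = length S" and ker: "word_kernel G S \<subseteq> word_kernel H T"
  obtains f where "f \<in> hom G H" "map f S = T"
    "\<And>w. w \<in> words (length S) \<Longrightarrow> f (eval_word G S w) = eval_word H T w"
proof -
  interpret G: group G using mg by (simp add: marked_group_def)
  interpret H: group H by fact
  have S: "set S \<subseteq> carrier G" and gen: "carrier G = eval_word G S ` words (length S)"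
    using mg G.generate_eq_eval_word by (auto simp: marked_group_def)
  define f where "f g = eval_word H T (SOME w. w \<in> words (length S) \<and> eval_word G S w = g)" for g
  have f: "f (eval_word G S w) = eval_word H T w" if w: "w \<in> words (length S)" for w
  proof -
    define v where "v = (SOME v. v \<in> words (length S) \<and> eval_word G S v = eval_word G S w)"
    have v: "v \<in> words (length S)" "eval_word G S v = eval_word G S w"
      using someI[of "\<lambda>v. v \<in> words (length S) \<and> eval_word G S v = eval_word G S w" w] w
      by (auto simp: v_def)
    have "v @ inv_word w \<in> word_kernel G S"
      using v w S by (simp add: word_kernel_def G.eval_word_append G.eval_word_inv)
    then have "v @ inv_word w \<in> word_kernel H T" using ker by blast
    then have "eval_word H T v \<otimes>\<^bsub>H\<^esub> inv\<^bsub>H\<^esub> eval_word H T w = \<one>\<^bsub>H\<^esub>"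
      using v w H len by (simp add: word_kernel_def H.eval_word_append H.eval_word_inv)
    then have "eval_word H T v = eval_word H T w"
      using v w H len by (metis H.eval_word_closed H.inv_equality H.inv_inv H.inv_closed)
    then show ?thesis by (simp add: f_def v_def)
  qed
  have "f \<in> hom G H"
  proof (rule homI)
    fix x assume "x \<in> carrier G"
    then show "f x \<in> carrier H" using f gen H len by auto
  next
    fix x y assume "x \<in> carrier G" "y \<in> carrier G"
    then obtain v w where vw: "v \<in> words (length S)" "x = eval_word G S v"
      "w \<in> words (length S)" "y = eval_word G S w" using gen by auto
    have "x \<otimes>\<^bsub>G\<^esub> y = eval_word G S (v @ w)" using vw S by (simp add: G.eval_word_append)
    then show "f (x \<otimes>\<^bsub>G\<^esub> y) = f x \<otimes>\<^bsub>H\<^esub> f y"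
      using vw f H len by (simp add: H.eval_word_append)
  qed
  moreover have "map f S = T"
  proof (rule nth_equalityI)
    fix i assume "i < length (map f S)"
    then show "map f S ! i = T ! i"
      using f[of "[(i, True)]"] G.eval_word_single[OF S, of i True] H.eval_word_single[OF H(2), of i True] len
      by simp
  qed (use len in simp)
  ultimately show ?thesis using f that by blast
qed

lemma marked_iso_if_kernel_eq:
  assumes mG: "marked_group G S" and mH: "marked_group H T"
    and len: "length T = length S" and ker: "word_kernel G S = word_kernel H T"
  shows "marked_iso G S H T"
proof -
  interpret G: group G using mG by (simp add: marked_group_def)
  interpret H: group H using mH by (simp add: marked_group_def)
  have S: "set S \<subseteq> carrier G" and gen: "carrier G = eval_word G S ` words (length S)"
    using mG G.generate_eq_eval_word by (auto simp: marked_group_def)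
  have T: "set T \<subseteq> carrier H" and genT: "carrier H = eval_word H T ` words (length S)"
    using mH H.generate_eq_eval_word len by (auto simp: marked_group_def)
  obtain f where f: "f \<in> hom G H" "map f S = T"
    "\<And>w. w \<in> words (length S) \<Longrightarrow> f (eval_word G S w) = eval_word H T w"
    using marked_group_hom_extension[OF mG _ T len] ker H.is_group by blast
  interpret group_hom G H f using f by unfold_locales auto
  have "inj_on f (carrier G)"
    unfolding inj_on_one_iff
  proof (intro allI impI)
    fix x assume "x \<in> carrier G" "f x = \<one>\<^bsub>H\<^esub>"
    then show "x = \<one>\<^bsub>G\<^esub>" using gen f(3) ker len by (auto simp: word_kernel_def)
  qed
  moreover have "f ` carrier G = carrier H"
    unfolding gen genT image_image by (rule image_cong) (simp_all add: f(3))
  ultimately have "f \<in> iso G H" using f(1) by (auto simp: iso_def bij_betw_def)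
  then show ?thesis using f(2) by (auto simp: marked_iso_def)
qed

lemma marked_iso_kernel:
  assumes "group G" "set S \<subseteq> carrier G" "group H" "marked_iso G S H T"
  shows "word_kernel G S = word_kernel H T" "length S = length T"
proof -
  obtain f where f: "f \<in> iso G H" "map f S = T" using assms by (auto simp: marked_iso_def)
  then show len: "length S = length T" by auto
  have fh: "f \<in> hom G H" using f by (simp add: iso_def)
  interpret group_hom G H f using fh assms by (simp add: group_hom_def group_hom_axioms_def)
  have inj: "inj_on f (carrier G)" using f(1) by (simp add: iso_def bij_betw_def)
  have "eval_word G S w = \<one>\<^bsub>G\<^esub> \<longleftrightarrow> eval_word H T w = \<one>\<^bsub>H\<^esub>" if w: "w \<in> words (length S)" for w
  proof -
    have "eval_word H T w = f (eval_word G S w)"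
      using eval_word_hom[OF assms(1,3) fh assms(2) w] f(2) by simp
    moreover have "f (eval_word G S w) = f \<one>\<^bsub>G\<^esub> \<longleftrightarrow> eval_word G S w = \<one>\<^bsub>G\<^esub>"
      using inj_on_eq_iff[OF inj G.eval_word_closed[OF assms(2) w] G.one_closed] .
    ultimately show ?thesis by simp
  qed
  then show "word_kernel G S = word_kernel H T" by (auto simp: word_kernel_def len[symmetric])
qed

lemma marked_group_subgroup:
  assumes "group (G :: 'g monoid)" "set S \<subseteq> carrier G"
  shows "marked_group (G\<lparr>carrier := generate G (set S)\<rparr>) S"
    and "\<And>w. w \<in> words (length S) \<Longrightarrow>
      eval_word (G\<lparr>carrier := generate G (set S)\<rparr>) S w = eval_word G S w"
proof -
  interpret group G by fact
  let ?H = "generate G (set S)"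
  have sub: "subgroup ?H G" using generate_is_subgroup assms by simp
  have SH: "set S \<subseteq> ?H" by (auto intro: generate.incl)
  have "generate (G\<lparr>carrier := ?H\<rparr>) (set S) = ?H"
    using generate_consistent[OF SH sub] by simp
  then show "marked_group (G\<lparr>carrier := generate G (set S)\<rparr>) S"
    using subgroup_imp_group[OF sub] SH by (simp add: marked_group_def)
  show "eval_word (G\<lparr>carrier := ?H\<rparr>) S w = eval_word G S w" if "w \<in> words (length S)" for w
    using that
  proof (induction w)
    case (Cons a w)
    then have "S ! fst a \<in> ?H" using SH by auto
    with Cons show ?case using m_inv_consistent[OF sub] by (simp add: eval_word_Cons)
  qed simp
qed

text \<open>Each element is coded by the number of a chosen word representing it, and the group
  structure is transported along this code. Groups built on any type thereby become members of
  marked classes.\<close>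

lemma nat_copy_marked:
  assumes mE: "marked_group E S"
  obtains G' :: "nat monoid" and S' where "marked_group G' S'" "length S' = length S"
    "word_kernel G' S' = word_kernel E S"
proof -
  interpret E: group E using mE by (simp add: marked_group_def)
  have SE: "set S \<subseteq> carrier E" and gen: "carrier E = eval_word E S ` words (length S)"
    using mE E.generate_eq_eval_word[of S] by (auto simp: marked_group_def)
  define code where "code g = to_nat (SOME w. w \<in> words (length S) \<and> eval_word E S w = g)" for g
  have eval_some: "eval_word E S (SOME w. w \<in> words (length S) \<and> eval_word E S w = z) = z"
    if "z \<in> carrier E" for z
    using someI_ex[of "\<lambda>w. w \<in> words (length S) \<and> eval_word E S w = z"] that
    unfolding gen by fast
  have inj: "inj_on code (carrier E)"
  proof (rule inj_onI)
    fix x y assume xy: "x \<in> carrier E" "y \<in> carrier E" "code x = code y"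
    have "x = eval_word E S (SOME w. w \<in> words (length S) \<and> eval_word E S w = x)"
      by (rule eval_some[OF xy(1), symmetric])
    also have "(SOME w. w \<in> words (length S) \<and> eval_word E S w = x) =
      (SOME w. w \<in> words (length S) \<and> eval_word E S w = y)"
      using xy(3) unfolding code_def by (rule injD[OF inj_to_nat])
    also have "eval_word E S \<dots> = y" by (rule eval_some[OF xy(2)])
    finally show "x = y" .
  qed
  define dec where "dec = inv_into (carrier E) code"
  have dec: "dec (code x) = x" if "x \<in> carrier E" for x
    using inj that by (simp add: dec_def)
  define G' where "G' = \<lparr>carrier = code ` carrier E,
     mult = \<lambda>a b. code (dec a \<otimes>\<^bsub>E\<^esub> dec b), one = code \<one>\<^bsub>E\<^esub>\<rparr>"
  have car: "carrier G' = code ` carrier E" and one: "\<one>\<^bsub>G'\<^esub> = code \<one>\<^bsub>E\<^esub>"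
    and mult: "\<And>x y. x \<in> carrier E \<Longrightarrow> y \<in> carrier E \<Longrightarrow> code x \<otimes>\<^bsub>G'\<^esub> code y = code (x \<otimes>\<^bsub>E\<^esub> y)"
    by (simp_all add: G'_def dec)
  have G': "group G'"
  proof (rule groupI)
    fix x assume "x \<in> carrier G'"
    then obtain g where g: "g \<in> carrier E" "x = code g" by (auto simp: car)
    then show "\<exists>y\<in>carrier G'. y \<otimes>\<^bsub>G'\<^esub> x = \<one>\<^bsub>G'\<^esub>"
      by (intro bexI[of _ "code (inv\<^bsub>E\<^esub> g)"]) (auto simp: car one mult)
  qed (auto simp: car one mult E.m_assoc)
  have ch: "code \<in> hom E G'" by (auto simp: hom_def car mult)
  have "code \<in> iso E G'" using ch inj by (auto simp: iso_def bij_betw_def car)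
  then have "marked_iso E S G' (map code S)" by (auto simp: marked_iso_def)
  then have ker: "word_kernel G' (map code S) = word_kernel E S"
    using marked_iso_kernel E.is_group SE G' by metis
  interpret gh: group_hom E G' code
    using ch G' E.is_group by (simp add: group_hom_def group_hom_axioms_def)
  have "carrier G' = code ` generate E (set S)"
    using mE by (simp add: marked_group_def car)
  also have "\<dots> = generate G' (code ` set S)" using gh.generate_img[OF SE] by simp
  finally have "generate G' (set (map code S)) = carrier G'" by simp
  then have "marked_group G' (map code S)"
    using G' SE by (auto simp: marked_group_def car)
  then show ?thesis using that[of G' "map code S"] ker by simp
qed

lemma nat_copy:
  assumes G: "group (G :: 'g monoid)" and S: "set S \<subseteq> carrier G"
  obtains G' :: "nat monoid" and S' where "marked_group G' S'" "length S' = length S"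
    "word_kernel G' S' = word_kernel G S"
proof -
  have "word_kernel (G\<lparr>carrier := generate G (set S)\<rparr>) S = word_kernel G S"
    using marked_group_subgroup(2)[OF G S] by (simp add: word_kernel_def cong: conj_cong)
  then show ?thesis
    using nat_copy_marked[OF marked_group_subgroup(1)[OF G S]] that by metis
qed

lemma marked_groupD:
  assumes "marked_group G S"
  shows "group G" "set S \<subseteq> carrier G" "carrier G = eval_word G S ` words (length S)"
  using assms group.generate_eq_eval_word[of G S] by (auto simp: marked_group_def)

lemma marked_class_of_eq:
  assumes "marked_group G S" "marked_group H T" "length S = length T"
    "word_kernel G S = word_kernel H T"
  shows "marked_class_of G S = marked_class_of H T"
proof -
  have "marked_iso G S K U \<longleftrightarrow> marked_iso H T K U" if K: "marked_group K U" for K :: "nat monoid" and U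
  proof -
    have "marked_iso G S K U \<longleftrightarrow> length S = length U \<and> word_kernel G S = word_kernel K U"
      using marked_iso_if_kernel_eq[OF assms(1) K]
        marked_iso_kernel[OF marked_groupD(1,2)[OF assms(1)] marked_groupD(1)[OF K]] by metis
    moreover have "marked_iso H T K U \<longleftrightarrow> length T = length U \<and> word_kernel H T = word_kernel K U"
      using marked_iso_if_kernel_eq[OF assms(2) K]
        marked_iso_kernel[OF marked_groupD(1,2)[OF assms(2)] marked_groupD(1)[OF K]] by metis
    ultimately show ?thesis using assms(3,4) by simp
  qed
  then show ?thesis by (auto simp: marked_class_of_def)
qed

lemma marked_class_of_in_marked_groups:
  assumes "marked_group G S" shows "marked_class_of G S \<in> marked_groups"
proof -
  obtain G' :: "nat monoid" and S' where "marked_group G' S'" "length S' = length S"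
    "word_kernel G' S' = word_kernel G S" by (rule nat_copy_marked[OF assms])
  then show ?thesis using marked_class_of_eq[OF assms, of G' S'] by (auto simp: marked_groups_def)
qed

lemma mem_marked_class_of_iff:
  assumes "marked_group G S"
  shows "(H, T) \<in> marked_class_of G S \<longleftrightarrow>
    marked_group H T \<and> length T = length S \<and> word_kernel H T = word_kernel G S"
  using marked_iso_if_kernel_eq[OF assms, of H T]
    marked_iso_kernel[OF marked_groupD(1,2)[OF assms], of H T] marked_groupD(1)[of H T]
  by (auto simp: marked_class_of_def)

section \<open>Names of marked groups\<close>

lemma range_enumeration: "word_enumeration \<theta> \<Longrightarrow> range (\<theta> k) = free_words k"
  by (cases k) (auto simp: word_enumeration_def bij_betw_def)

lemma enumeration_in_words: "word_enumeration \<theta> \<Longrightarrow> \<theta> k n \<in> words k"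
  using range_enumeration[of \<theta> k] free_words_subset[of k] by blast

lemma word_kernel_eq_if_free_words:
  assumes "marked_group G S" "marked_group H T" "length S = length T"
    and "\<And>w. w \<in> free_words (length S) \<Longrightarrow> w \<in> word_kernel G S \<longleftrightarrow> w \<in> word_kernel H T"
  shows "word_kernel G S = word_kernel H T"
proof -
  note G = marked_groupD(1,2)[OF assms(1)] and H = marked_groupD(1,2)[OF assms(2)]
  show ?thesis
    using word_kernel_free_words_mono[OF G H] word_kernel_free_words_mono[OF H G] assms(3,4)
      free_words_subset[of "length S"]
    by (intro equalityI) (auto simp: word_kernel_def subset_iff)
qed

lemma names_marked_class_of_iff:
  assumes \<theta>: "word_enumeration \<theta>" and mG: "marked_group G S"
  shows "names \<theta> u (marked_class_of G S) \<longleftrightarrow> u 0 = length S \<and>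
    (\<forall>n. u (Suc n) = (if \<theta> (length S) n \<in> word_kernel G S then 1 else 0))"
proof -
  obtain G' :: "nat monoid" and S' where G': "marked_group G' S'" "length S' = length S"
    "word_kernel G' S' = word_kernel G S" by (rule nat_copy_marked[OF mG])
  have e: "\<theta> (length S) n \<in> words (length S)" for n by (rule enumeration_in_words[OF \<theta>])
  have eq: "eval_word H T (\<theta> (length S) n) = \<one>\<^bsub>H\<^esub> \<longleftrightarrow> \<theta> (length S) n \<in> word_kernel G S"
    if "(H, T) \<in> marked_class_of G S" for H T n
    using that e mem_marked_class_of_iff[OF mG] by (auto simp: word_kernel_def set_eq_iff)
  have len: "length T = length S" if "(H, T) \<in> marked_class_of G S" for H T
    using that mem_marked_class_of_iff[OF mG] by auto
  have "(G', S') \<in> marked_class_of G S" using G' mem_marked_class_of_iff[OF mG] by blast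
  then show ?thesis unfolding names_def using marked_class_of_in_marked_groups[OF mG] eq len
    by (auto split: prod.splits) (metis (no_types, lifting))+
qed

lemma marked_groups_cases:
  assumes "M \<in> marked_groups"
  obtains G :: "nat monoid" and S where "marked_group G S" "M = marked_class_of G S"
  using assms by (auto simp: marked_groups_def)

text \<open>A name fixes the number of generators and the reduced words of the kernel, hence the
  kernel. This justifies the description operator in \<open>marked_repr\<close>.\<close>

lemma names_unique:
  assumes \<theta>: "word_enumeration \<theta>" and "names \<theta> u M" "names \<theta> u M'"
  shows "M = M'"
proof -
  obtain G :: "nat monoid" and S where G: "marked_group G S" "M = marked_class_of G S"
    using assms(2) marked_groups_cases by (metis names_def)
  obtain H :: "nat monoid" and T where H: "marked_group H T" "M' = marked_class_of H T"
    using assms(3) marked_groups_cases by (metis names_def)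
  have u: "u 0 = length S \<and> (\<forall>n. u (Suc n) = (if \<theta> (length S) n \<in> word_kernel G S then 1 else 0))"
    "u 0 = length T \<and> (\<forall>n. u (Suc n) = (if \<theta> (length T) n \<in> word_kernel H T then 1 else 0))"
    using assms(2,3) unfolding G(2) H(2) names_marked_class_of_iff[OF \<theta> G(1)]
      names_marked_class_of_iff[OF \<theta> H(1)] by blast+
  then have len: "length S = length T" by simp
  have "w \<in> word_kernel G S \<longleftrightarrow> w \<in> word_kernel H T" if fw: "w \<in> free_words (length S)" for w
  proof -
    obtain n where "w = \<theta> (length S) n" using fw range_enumeration[OF \<theta>, of "length S"] by auto
    moreover have "\<theta> (length S) n \<in> word_kernel G S \<longleftrightarrow> u (Suc n) = 1" using u(1) by simp
    moreover have "\<theta> (length S) n \<in> word_kernel H T \<longleftrightarrow> u (Suc n) = 1" using u(2) len by simp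
    ultimately show ?thesis by blast
  qed
  then have "word_kernel G S = word_kernel H T"
    by (rule word_kernel_eq_if_free_words[OF G(1) H(1) len])
  then show ?thesis using marked_class_of_eq[OF G(1) H(1) len] G H by simp
qed

lemma marked_repr_eq_Some_iff:
  assumes "word_enumeration \<theta>"
  shows "marked_repr \<theta> u = Some M \<longleftrightarrow> names \<theta> u M"
proof -
  have the: "(THE M. names \<theta> u M) = M" if "names \<theta> u M" for M
    by (rule the_equality[of "names \<theta> u", OF that]) (rule names_unique[OF assms _ that])
  show ?thesis
  proof
    assume "marked_repr \<theta> u = Some M"
    then obtain M' where "names \<theta> u M'" "M = (THE M. names \<theta> u M)"
      by (auto simp: marked_repr_def split: if_splits)
    then show "names \<theta> u M" using the by simp
  next
    assume "names \<theta> u M"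
    then show "marked_repr \<theta> u = Some M" using the by (auto simp: marked_repr_def)
  qed
qed

section \<open>Residual quotients in terms of words\<close>

definition char_name :: "(nat \<Rightarrow> nat \<Rightarrow> word) \<Rightarrow> nat \<Rightarrow> word set \<Rightarrow> nat \<Rightarrow> nat" where
  "char_name \<theta> k W = case_nat k (\<lambda>n. if \<theta> k n \<in> W then 1 else 0)"

lemma char_name_simps [simp]: "char_name \<theta> k W 0 = k"
  "char_name \<theta> k W (Suc n) = (if \<theta> k n \<in> W then 1 else 0)"
  by (simp_all add: char_name_def)

lemma names_marked_class_of:
  assumes "word_enumeration \<theta>" "marked_group G S"
  shows "names \<theta> u (marked_class_of G S) \<longleftrightarrow> u = char_name \<theta> (length S) (word_kernel G S)"
  unfolding names_marked_class_of_iff[OF assms]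
  by (auto simp: char_name_def fun_eq_iff split: nat.split)

text \<open>The consequences of the relators \<open>R\<close> in members of \<C>. Unlike
  \<open>res_kernel\<close> this makes sense without a group, in particular for the finitely many
  relators known at a finite stage.\<close>

definition res_words :: "'h monoid set \<Rightarrow> nat \<Rightarrow> word set \<Rightarrow> word set" where
  "res_words \<C> k R = {w \<in> words k. \<forall>H\<in>\<C>. \<forall>T. length T = k \<and> marked_group H T \<and>
     (\<forall>v\<in>R. eval_word H T v = \<one>\<^bsub>H\<^esub>) \<longrightarrow> eval_word H T w = \<one>\<^bsub>H\<^esub>}"

text \<open>Epimorphisms from \<open>G\<close> onto \<open>H\<close> correspond to the generating
  tuples of \<open>H\<close> that satisfy the relators of \<open>G\<close>.\<close>

lemma mem_res_kernel_iff:
  assumes mG: "marked_group G S" and \<C>: "\<And>H. H \<in> \<C> \<Longrightarrow> group H" and w: "w \<in> words (length S)"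
  shows "eval_word G S w \<in> res_kernel \<C> G \<longleftrightarrow>
    w \<in> res_words \<C> (length S) (word_kernel G S)"
proof -
  note G = marked_groupD[OF mG]
  interpret G: group G by fact
  have "(\<forall>f\<in>epi G H. f (eval_word G S w) = \<one>\<^bsub>H\<^esub>) \<longleftrightarrow>
    (\<forall>T. length T = length S \<and> marked_group H T \<and>
      (\<forall>v\<in>word_kernel G S. eval_word H T v = \<one>\<^bsub>H\<^esub>) \<longrightarrow> eval_word H T w = \<one>\<^bsub>H\<^esub>)"
    (is "?l \<longleftrightarrow> ?r") if H: "H \<in> \<C>" for H
  proof -
    interpret H: group H using H by (rule \<C>)
    show ?thesis
    proof
      assume l: ?l
      show ?r
      proof (intro allI impI, elim conjE)
        fix T assume T: "length T = length S" "marked_group H T"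
          "\<forall>v\<in>word_kernel G S. eval_word H T v = \<one>\<^bsub>H\<^esub>"
        have "word_kernel G S \<subseteq> word_kernel H T" using T by (auto simp: word_kernel_def)
        then obtain f where f: "f \<in> hom G H" "map f S = T"
          "\<And>w. w \<in> words (length S) \<Longrightarrow> f (eval_word G S w) = eval_word H T w"
          using marked_group_hom_extension[OF mG H.is_group marked_groupD(2)[OF T(2)] T(1)] by blast
        have "f ` carrier G = carrier H"
          unfolding G(3) marked_groupD(3)[OF T(2)] image_image T(1)
          by (rule image_cong) (simp_all add: f(3))
        then have "f \<in> epi G H" using f(1) by (simp add: epi_def)
        then show "eval_word H T w = \<one>\<^bsub>H\<^esub>" using l f(3)[OF w] by auto
      qed
    next
      assume r: ?r
      show ?l
      proof
        fix f assume "f \<in> epi G H"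
        then have f: "f \<in> hom G H" "f ` carrier G = carrier H" by (auto simp: epi_def)
        interpret f: group_hom G H f using f G.is_group H.is_group
          by (simp add: group_hom_def group_hom_axioms_def)
        have ev: "f (eval_word G S v) = eval_word H (map f S) v" if "v \<in> words (length S)" for v
          using eval_word_hom[OF G(1) H.is_group f(1) G(2) that] .
        have "generate H (set (map f S)) = carrier H"
          using f.generate_img[OF G(2)] mG f(2) by (simp add: marked_group_def)
        then have "marked_group H (map f S)"
          using G(2) by (auto simp: marked_group_def H.is_group)
        moreover have "eval_word H (map f S) v = \<one>\<^bsub>H\<^esub>" if "v \<in> word_kernel G S" for v
          using that ev[of v] by (simp add: word_kernel_def)
        ultimately show "f (eval_word G S w) = \<one>\<^bsub>H\<^esub>" using r ev[OF w] by simp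
      qed
    qed
  qed
  then show ?thesis using w G(2)
    by (auto simp: res_kernel_def res_words_def kernel_def)
qed

lemma normal_res_kernel:
  assumes G: "group G" and \<C>: "\<And>H. H \<in> \<C> \<Longrightarrow> group H"
  shows "res_kernel \<C> G \<lhd> G"
proof -
  interpret group G by fact
  have fh: "group_hom G H f" if "H \<in> \<C>" "f \<in> epi G H" for H f
    using that \<C> G by (simp add: group_hom_def group_hom_axioms_def epi_def)
  have mem: "x \<in> res_kernel \<C> G \<longleftrightarrow> x \<in> carrier G \<and> (\<forall>H\<in>\<C>. \<forall>f\<in>epi G H. f x = \<one>\<^bsub>H\<^esub>)" for x
    by (auto simp: res_kernel_def kernel_def)
  have img: "f (x \<otimes>\<^bsub>G\<^esub> y) = f x \<otimes>\<^bsub>H\<^esub> f y" "f \<one>\<^bsub>G\<^esub> = \<one>\<^bsub>H\<^esub>" "f (inv\<^bsub>G\<^esub> x) = inv\<^bsub>H\<^esub> f x" "f x \<in> carrier H"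
    if "H \<in> \<C>" "f \<in> epi G H" "x \<in> carrier G" "y \<in> carrier G" for H f x y
    using that group_hom.hom_mult[OF fh[OF that(1,2)]] group_hom.hom_inv[OF fh[OF that(1,2)]]
      group_hom.hom_one[OF fh[OF that(1,2)]] group_hom.hom_closed[OF fh[OF that(1,2)]] by auto
  have "subgroup (res_kernel \<C> G) G"
  proof (rule subgroup.intro)
    fix x y assume "x \<in> res_kernel \<C> G" "y \<in> res_kernel \<C> G"
    then show "x \<otimes>\<^bsub>G\<^esub> y \<in> res_kernel \<C> G"
      by (simp add: mem img) (metis \<C> group.is_monoid monoid.l_one monoid.one_closed)
  next
    show "\<one>\<^bsub>G\<^esub> \<in> res_kernel \<C> G" by (auto simp: mem intro: img(2)[OF _ _ one_closed one_closed])
  next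
    fix x assume "x \<in> res_kernel \<C> G"
    then show "inv\<^bsub>G\<^esub> x \<in> res_kernel \<C> G"
      by (clarsimp simp: mem img) (metis \<C> group.is_monoid monoid.inv_one)
  qed (auto simp: mem)
  moreover have "x \<otimes>\<^bsub>G\<^esub> h \<otimes>\<^bsub>G\<^esub> inv\<^bsub>G\<^esub> x \<in> res_kernel \<C> G"
    if "x \<in> carrier G" "h \<in> res_kernel \<C> G" for x h
    using that by (clarsimp simp: mem img) (metis \<C> group.r_inv group.is_monoid monoid.r_one img(4))
  ultimately show ?thesis by (simp add: normal_inv_iff)
qed

lemma res_quotient_spec:
  assumes \<theta>: "word_enumeration \<theta>" and mG: "marked_group (G :: 'g monoid) S"
    and \<C>: "\<And>H. H \<in> \<C> \<Longrightarrow> group H"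
  shows "names \<theta> q (res_quotient \<C> G S) \<longleftrightarrow>
    q = char_name \<theta> (length S) (res_words \<C> (length S) (word_kernel G S))"
proof -
  note G = marked_groupD[OF mG]
  define N where "N = res_kernel \<C> G"
  have N: "N \<lhd> G" unfolding N_def by (rule normal_res_kernel[OF G(1) \<C>])
  interpret N: normal N G by (rule N)
  define \<pi> where "\<pi> g = N #>\<^bsub>G\<^esub> g" for g
  have gQ: "group (G Mod N)" by (rule N.factorgroup_is_group)
  have \<pi>: "\<pi> \<in> hom G (G Mod N)" using N.r_coset_hom_Mod by (simp add: \<pi>_def[abs_def])
  interpret \<pi>: group_hom G "G Mod N" \<pi>
    using \<pi> gQ G(1) by (simp add: group_hom_def group_hom_axioms_def)
  have surj: "carrier (G Mod N) = \<pi> ` carrier G"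
    by (auto simp: FactGroup_def RCOSETS_def \<pi>_def)
  have "carrier (G Mod N) = generate (G Mod N) (set (map \<pi> S))"
    using \<pi>.generate_img[OF G(2)] mG surj by (simp add: marked_group_def)
  then have mQ: "marked_group (G Mod N) (map \<pi> S)"
    using G(2) gQ surj by (auto simp: marked_group_def)
  have "eval_word (G Mod N) (map \<pi> S) w = \<one>\<^bsub>G Mod N\<^esub> \<longleftrightarrow>
    w \<in> res_words \<C> (length S) (word_kernel G S)" if w: "w \<in> words (length S)" for w
  proof -
    have "eval_word (G Mod N) (map \<pi> S) w = \<pi> (eval_word G S w)"
      using eval_word_hom[OF G(1) gQ \<pi> G(2) w] by simp
    moreover have "\<pi> (eval_word G S w) = N \<longleftrightarrow> eval_word G S w \<in> N"
      unfolding \<pi>_def using N.coset_join1[OF _ _ N.subgroup_axioms] N.rcos_const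
        N.eval_word_closed[OF G(2) w] N.subset by blast
    ultimately show ?thesis using mem_res_kernel_iff[OF mG \<C> w]
      by (simp add: N_def)
  qed
  then have "word_kernel (G Mod N) (map \<pi> S) = res_words \<C> (length S) (word_kernel G S)"
    by (auto simp: word_kernel_def res_words_def)
  moreover have "res_quotient \<C> G S = marked_class_of (G Mod N) (map \<pi> S)"
    by (simp add: res_quotient_def N_def \<pi>_def[abs_def])
  ultimately show ?thesis using names_marked_class_of[OF \<theta> mQ] by simp
qed

lemma res_words_cong:
  assumes "\<And>H T. H \<in> \<C> \<Longrightarrow> marked_group H T \<Longrightarrow> length T = k \<Longrightarrow>
    (\<forall>v\<in>R. eval_word H T v = \<one>\<^bsub>H\<^esub>) \<longleftrightarrow> (\<forall>v\<in>R'. eval_word H T v = \<one>\<^bsub>H\<^esub>)"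
  shows "res_words \<C> k R = res_words \<C> k R'"
  using assms unfolding res_words_def by (intro Collect_cong) blast

text \<open>Members of one marked class have the same kernel and so the same residual words; hence
  the problem is single-valued.\<close>

lemma Res_spec:
  assumes \<theta>: "word_enumeration \<theta>" and mG: "marked_group (G :: nat monoid) S"
    and \<C>: "\<And>H. H \<in> \<C> \<Longrightarrow> group H"
  shows "app (Res \<theta> \<C>) (marked_class_of G S) = {res_quotient \<C> G S}"
proof -
  obtain n where n: "names \<theta> n (res_quotient \<C> G S)"
    using res_quotient_spec[OF \<theta> mG \<C>] by blast
  have "res_quotient \<C> H T = res_quotient \<C> G S" if "(H, T) \<in> marked_class_of G S" for H T
  proof -
    have HT: "marked_group H T" "length T = length S" "word_kernel H T = word_kernel G S"
      using that mem_marked_class_of_iff[OF mG] by auto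
    then have "names \<theta> n (res_quotient \<C> H T)"
      using n res_quotient_spec[OF \<theta> mG \<C>] res_quotient_spec[OF \<theta> HT(1) \<C>] by metis
    then show ?thesis using names_unique[OF \<theta> _ n] by blast
  qed
  moreover have "(G, S) \<in> marked_class_of G S" using mem_marked_class_of_iff[OF mG] mG by blast
  ultimately have "{res_quotient \<C> H T | H T. (H, T) \<in> marked_class_of G S} = {res_quotient \<C> G S}"
    by blast
  then show ?thesis using marked_class_of_in_marked_groups[OF mG] by (simp add: Res_def)
qed

lemma Res_problem:
  assumes \<theta>: "word_enumeration \<theta>" and \<C>: "\<And>H. H \<in> \<C> \<Longrightarrow> group (H :: 'h monoid)"
  shows "pdom (Res \<theta> \<C>) = marked_groups" "inrep (Res \<theta> \<C>) = marked_repr \<theta>"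
    "outrep (Res \<theta> \<C>) = marked_repr \<theta>" "is_problem (Res \<theta> \<C>)"
proof -
  show dom: "pdom (Res \<theta> \<C>) = marked_groups"
  proof -
    have "app (Res \<theta> \<C>) M \<noteq> {}" if "M \<in> marked_groups" for M
      using that by (rule marked_groups_cases) (use Res_spec[OF \<theta> _ \<C>] in auto)
    then show ?thesis by (auto simp: pdom_def Res_def split: if_splits)
  qed
  show "inrep (Res \<theta> \<C>) = marked_repr \<theta>" "outrep (Res \<theta> \<C>) = marked_repr \<theta>"
    by (auto simp: Res_def)
  have "marked_groups \<subseteq> ran (marked_repr \<theta>)"
  proof
    fix M assume "M \<in> marked_groups"
    then obtain G :: "nat monoid" and S where "marked_group G S" "M = marked_class_of G S"
      by (rule marked_groups_cases)
    then show "M \<in> ran (marked_repr \<theta>)"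
      using names_marked_class_of[OF \<theta>] marked_repr_eq_Some_iff[OF \<theta>] by (metis ranI)
  qed
  moreover have "app (Res \<theta> \<C>) M \<subseteq> ran (marked_repr \<theta>)" for M
  proof (cases "M \<in> marked_groups")
    case True
    then obtain G :: "nat monoid" and S where G: "marked_group G S" "M = marked_class_of G S"
      by (rule marked_groups_cases)
    then show ?thesis
      using Res_spec[OF \<theta> G(1) \<C>] res_quotient_spec[OF \<theta> G(1) \<C>] marked_repr_eq_Some_iff[OF \<theta>]
      by (auto intro: ranI)
  qed (simp add: Res_def)
  ultimately show "is_problem (Res \<theta> \<C>)" using dom by (auto simp: is_problem_def Res_def)
qed

text \<open>From here on only names matter. The relators listed by \<open>u\<close> are the reduced
  ones, but a marking that satisfies them satisfies the whole kernel.\<close>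

lemma Res_names:
  assumes \<theta>: "word_enumeration \<theta>" and \<C>: "\<And>H. H \<in> \<C> \<Longrightarrow> group (H :: 'h monoid)"
    and u: "marked_repr \<theta> u = Some M" and M': "M' \<in> app (Res \<theta> \<C>) M"
  shows "marked_repr \<theta> q = Some M' \<longleftrightarrow>
    q = char_name \<theta> (u 0) (res_words \<C> (u 0) {\<theta> (u 0) n | n. u (Suc n) = 1})"
proof -
  have n: "names \<theta> u M" using u marked_repr_eq_Some_iff[OF \<theta>] by blast
  then obtain G :: "nat monoid" and S where G: "marked_group G S" "M = marked_class_of G S"
    by (metis marked_groups_cases names_def)
  have u_eq: "u = char_name \<theta> (length S) (word_kernel G S)"
    using n G names_marked_class_of[OF \<theta> G(1)] by simp
  have k: "u 0 = length S" by (simp add: u_eq)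
  have R: "{\<theta> (length S) n | n. u (Suc n) = 1} = word_kernel G S \<inter> free_words (length S)"
    using range_enumeration[OF \<theta>, of "length S"] by (auto simp: u_eq split: if_splits)
  have "res_words \<C> (length S) (word_kernel G S) = 
    res_words \<C> (length S) (word_kernel G S \<inter> free_words (length S))"
  proof (rule res_words_cong, intro iffI)
    fix H T assume H: "H \<in> \<C>" "marked_group H T" "length T = length S"
      and *: "\<forall>v\<in>word_kernel G S \<inter> free_words (length S). eval_word H T v = \<one>\<^bsub>H\<^esub>"
    have "word_kernel G S \<subseteq> word_kernel H T"
      by (rule word_kernel_free_words_mono[OF marked_groupD(1,2)[OF G(1)] marked_groupD(1,2)[OF H(2)] H(3)])
        (use * free_words_subset in \<open>auto simp: word_kernel_def\<close>)
    then show "\<forall>v\<in>word_kernel G S. eval_word H T v = \<one>\<^bsub>H\<^esub>" by (auto simp: word_kernel_def)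
  qed auto
  then show ?thesis
    using M' res_quotient_spec[OF \<theta> G(1) \<C>] Res_spec[OF \<theta> G(1) \<C>] marked_repr_eq_Some_iff[OF \<theta>] G(2)
    unfolding k R by simp
qed

section \<open>A criterion for Weihrauch reducibility\<close>

lemma continuous_on_baire:
  fixes F :: "(nat \<Rightarrow> nat) \<Rightarrow> nat \<Rightarrow> nat"
  assumes "\<And>p n. p \<in> D \<Longrightarrow> \<exists>m. \<forall>p'\<in>D. (\<forall>i<m. p' i = p i) \<longrightarrow> F p' n = F p n"
  shows "continuous_on D F"
proof (rule continuous_on_coordinatewise_then_product)
  fix n
  show "continuous_on D (\<lambda>p. F p n)"
    unfolding continuous_on_def
  proof (intro ballI topological_tendstoI)
    fix p S assume p: "p \<in> D" and S: "F p n \<in> S"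
    obtain m where m: "\<forall>p'\<in>D. (\<forall>i<m. p' i = p i) \<longrightarrow> F p' n = F p n" using assms[OF p] by blast
    let ?U = "Pi\<^sub>E UNIV (\<lambda>i. if i < m then {p i} else UNIV)"
    have "open ?U"
      by (rule open_PiE) (auto intro: finite_subset[of _ "{..<m}"] open_discrete split: if_splits)
    moreover have "p \<in> ?U" by auto
    moreover have "F p' n \<in> S" if "p' \<in> ?U" "p' \<in> D" for p'
    proof -
      have "p' i = p i" if "i < m" for i using PiE_mem[OF \<open>p' \<in> ?U\<close>, of i] that by simp
      then show ?thesis using m S that by simp
    qed
    ultimately show "\<forall>\<^sub>F p' in at p within D. F p' n \<in> S"
      unfolding eventually_at_topological by blast
  qed
qed

definition interleave :: "(nat \<Rightarrow> nat) \<Rightarrow> (nat \<Rightarrow> nat) \<Rightarrow> nat \<Rightarrow> nat" where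
  "interleave p q n = (if even n then p (n div 2) else q (n div 2))"

lemma interleave_simps [simp]:
  "interleave p q (2 * n) = p n" "interleave p q (Suc (2 * n)) = q n"
  by (auto simp: interleave_def)

lemma prod_repr_eq_Some_iff:
  "(\<delta> \<times>\<^sub>R \<epsilon>) s = Some (x, y) \<longleftrightarrow> \<delta> (\<lambda>n. s (2 * n)) = Some x \<and> \<epsilon> (\<lambda>n. s (2 * n + 1)) = Some y"
  by (auto simp: prod_repr_def split: option.splits)

text \<open>The auxiliary space is Baire space and simply carries the name \<open>p\<close> along,
  so that \<open>H\<close> may use both the instance and the answer. Continuity becomes dependence
  on finite prefixes, demanded only on the pairs that can occur.\<close>

theorem weihrauch_leI:
  fixes K :: "(nat \<Rightarrow> nat) \<Rightarrow> (nat \<Rightarrow> nat)" and H :: "(nat \<Rightarrow> nat) \<Rightarrow> (nat \<Rightarrow> nat) \<Rightarrow> (nat \<Rightarrow> nat)"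
    and Q :: "('x, 'y) problem" and P :: "('z, 'w) problem"
  defines "D \<equiv> {p. \<exists>x\<in>pdom Q. inrep Q p = Some x}"
  assumes Q: "is_problem Q" and P: "is_problem P"
    and K: "\<And>p x. inrep Q p = Some x \<Longrightarrow> x \<in> pdom Q \<Longrightarrow> \<exists>z\<in>pdom P. inrep P (K p) = Some z"
    and H: "\<And>p x z q w. inrep Q p = Some x \<Longrightarrow> x \<in> pdom Q \<Longrightarrow> inrep P (K p) = Some z \<Longrightarrow>
      w \<in> app P z \<Longrightarrow> outrep P q = Some w \<Longrightarrow> \<exists>y\<in>app Q x. outrep Q (H p q) = Some y"
    and K_local: "\<And>p n. p \<in> D \<Longrightarrow> \<exists>m. \<forall>p'\<in>D. (\<forall>i<m. p' i = p i) \<longrightarrow> K p' n = K p n"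
    and H_local: "\<And>p q z w n. p \<in> D \<Longrightarrow> inrep P (K p) = Some z \<Longrightarrow> w \<in> app P z \<Longrightarrow>
      outrep P q = Some w \<Longrightarrow>
      \<exists>m. \<forall>p'\<in>D. \<forall>q'. (\<exists>z w. inrep P (K p') = Some z \<and> w \<in> app P z \<and> outrep P q' = Some w) \<longrightarrow>
        (\<forall>i<m. p' i = p i \<and> q' i = q i) \<longrightarrow> H p' q' n = H p q n"
  shows "Q \<le>\<^sub>W P"
proof -
  \<comment> \<open>The pairs arising from a reduction; both \<open>h\<close> and its realizer are
    defined only there, which is where \<open>H_local\<close> applies.\<close>
  define good where "good p q w \<longleftrightarrow> p \<in> D \<and>
    (\<exists>z. inrep P (K p) = Some z \<and> w \<in> app P z \<and> outrep P q = Some w)" for p q w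
  \<comment> \<open>Since \<open>K\<close> may send two names of one point to names of different
    points, \<open>k\<close> collects the results for all names of \<open>x\<close>.\<close>
  define k :: "('x, (nat \<Rightarrow> nat) \<times> 'z) problem" where
    "k = Problem (inrep Q) (baire_repr \<times>\<^sub>R inrep P)
       (\<lambda>x. {(p, z). x \<in> pdom Q \<and> inrep Q p = Some x \<and> inrep P (K p) = Some z})"
  define h :: "((nat \<Rightarrow> nat) \<times> 'w, 'y) problem" where
    "h = Problem (baire_repr \<times>\<^sub>R outrep P) (outrep Q)
       (\<lambda>(p, w). {y. \<exists>q. good p q w \<and> outrep Q (H p q) = Some y})"
  have k_simps: "inrep k = inrep Q" "outrep k = baire_repr \<times>\<^sub>R inrep P"
    "app k x = {(p, z). x \<in> pdom Q \<and> inrep Q p = Some x \<and> inrep P (K p) = Some z}" for x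
    by (auto simp: k_def)
  have h_simps: "inrep h = baire_repr \<times>\<^sub>R outrep P" "outrep h = outrep Q"
    "app h (p, w) = {y. \<exists>q. good p q w \<and> outrep Q (H p q) = Some y}" for p w
    by (auto simp: h_def)
  have HD: "\<exists>y. outrep Q (H p q) = Some y" if "good p q w" for p q w
    using that H unfolding good_def D_def by blast
  have ilv: "(baire_repr \<times>\<^sub>R \<epsilon>) (interleave p q) = Some (p, y) \<longleftrightarrow> \<epsilon> q = Some y"
    for \<epsilon> :: "'v repr" and p q y
    by (simp add: prod_repr_eq_Some_iff baire_repr_def)
  have ilv_ran: "(p, y) \<in> ran (baire_repr \<times>\<^sub>R \<epsilon>)" if "\<epsilon> q = Some y"
    for \<epsilon> :: "'v repr" and p q y
    using ilv[of \<epsilon> p q y] that by (auto simp: ran_def)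
  have pk: "pdom k \<subseteq> pdom Q" by (auto simp: pdom_def k_simps)
  have kp: "is_problem k"
    unfolding is_problem_def
  proof (intro conjI allI)
    show "pdom k \<subseteq> ran (inrep k)" using pk Q by (auto simp: is_problem_def k_simps)
    show "app k x \<subseteq> ran (outrep k)" for x
      unfolding k_simps by (auto intro: ilv_ran)
  qed
  have hp: "is_problem h"
    unfolding is_problem_def
  proof (intro conjI allI)
    show "pdom h \<subseteq> ran (inrep h)"
      unfolding k_simps h_simps(1)
      by (auto simp: pdom_def h_simps(3) good_def intro: ilv_ran)
    show "app h x \<subseteq> ran (outrep h)" for x
      by (cases x) (auto simp: h_simps intro: ranI)
  qed
  define Fk where "Fk p = (if p \<in> D then Some (interleave p (K p)) else None)" for p
  have "realizer Fk k"
    unfolding realizer_def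
  proof (intro allI impI, elim conjE)
    fix p x assume "inrep k p = Some x" "x \<in> pdom k"
    then have x: "inrep Q p = Some x" "x \<in> pdom Q" using pk by (auto simp: k_simps)
    then have "p \<in> D" by (auto simp: D_def)
    moreover obtain z where "inrep P (K p) = Some z" using K[OF x] by blast
    ultimately show "\<exists>q y. Fk p = Some q \<and> outrep k q = Some y \<and> y \<in> app k x"
      using x by (intro exI[of _ "interleave p (K p)"] exI[of _ "(p, z)"])
        (simp add: Fk_def k_simps ilv)
  qed
  moreover have "continuous_on (dom Fk) (\<lambda>p. the (Fk p))"
  proof (rule continuous_on_baire)
    fix p n assume "p \<in> dom Fk"
    then have p: "p \<in> D" by (auto simp: Fk_def split: if_splits)
    obtain m where m: "\<forall>p'\<in>D. (\<forall>i<m. p' i = p i) \<longrightarrow> K p' (n div 2) = K p (n div 2)"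
      using K_local[OF p] by blast
    show "\<exists>m. \<forall>p'\<in>dom Fk. (\<forall>i<m. p' i = p i) \<longrightarrow> the (Fk p') n = the (Fk p) n"
    proof (intro exI ballI impI)
      fix p' assume p': "p' \<in> dom Fk" "\<forall>i<Suc (max m n). p' i = p i"
      then have "p' \<in> D" by (auto simp: Fk_def split: if_splits)
      moreover have "p' (n div 2) = p (n div 2)" using p'(2)[rule_format, of "n div 2"] by simp
      moreover have "K p' (n div 2) = K p (n div 2)" using m \<open>p' \<in> D\<close> p'(2) by simp
      ultimately show "the (Fk p') n = the (Fk p) n"
        using p by (simp add: Fk_def interleave_def)
    qed
  qed
  ultimately have kc: "continuously_realizable k" by (auto simp: continuously_realizable_def)
  define good' where "good' p q \<longleftrightarrow> (\<exists>w. good p q w)" for p q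
  define ev od :: "(nat \<Rightarrow> nat) \<Rightarrow> nat \<Rightarrow> nat" where "ev s = (\<lambda>n. s (2 * n))" and "od s = (\<lambda>n. s (2 * n + 1))" for s
  define Fh where "Fh s = (if good' (ev s) (od s) then Some (H (ev s) (od s)) else None)" for s
  have "realizer Fh h"
    unfolding realizer_def
  proof (intro allI impI, elim conjE)
    fix s x assume s: "inrep h s = Some x" and x: "x \<in> pdom h"
    obtain p w where pw: "x = (p, w)" by force
    have s': "p = ev s" "outrep P (od s) = Some w"
      using s by (auto simp: pw h_simps prod_repr_eq_Some_iff baire_repr_def ev_def od_def)
    obtain q' where "good p q' w" using x by (auto simp: pw pdom_def h_simps)
    then have g: "good p (od s) w" using s' by (auto simp: good_def)
    then obtain y where "outrep Q (H p (od s)) = Some y" using HD by blast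
    then show "\<exists>q y. Fh s = Some q \<and> outrep h q = Some y \<and> y \<in> app h x"
      using g s' by (intro exI[of _ "H p (od s)"] exI[of _ y])
        (auto simp: Fh_def good'_def h_simps pw)
  qed
  moreover have "continuous_on (dom Fh) (\<lambda>s. the (Fh s))"
  proof (rule continuous_on_baire)
    fix s n assume "s \<in> dom Fh"
    then have g: "good' (ev s) (od s)" by (auto simp: Fh_def split: if_splits)
    obtain m where m: "\<And>p' q'. good' p' q' \<Longrightarrow> (\<forall>i<m. p' i = ev s i \<and> q' i = od s i) \<Longrightarrow>
        H p' q' n = H (ev s) (od s) n"
      using H_local[of "ev s" _ _ "od s" n] g unfolding good'_def good_def by metis
    show "\<exists>m. \<forall>s'\<in>dom Fh. (\<forall>i<m. s' i = s i) \<longrightarrow> the (Fh s') n = the (Fh s) n"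
    proof (intro exI ballI impI)
      fix s' assume s': "s' \<in> dom Fh" "\<forall>i<2 * m. s' i = s i"
      then have "good' (ev s') (od s')" by (auto simp: Fh_def split: if_splits)
      then show "the (Fh s') n = the (Fh s) n"
        using g s'(2) m[of "ev s'" "od s'"] by (simp add: Fh_def ev_def od_def)
    qed
  qed
  ultimately have hc: "continuously_realizable h" by (auto simp: continuously_realizable_def)
  define IP where "IP = id_problem baire_repr \<times>\<^sub>P P"
  have IP: "app IP (p, z) = {p} \<times> app P z" for p z
    by (auto simp: IP_def prod_problem_def id_problem_def baire_repr_def ran_def)
  have main: "app (h \<circ>\<^sub>P IP \<circ>\<^sub>P k) x \<noteq> {} \<and> app (h \<circ>\<^sub>P IP \<circ>\<^sub>P k) x \<subseteq> app Q x" if x: "x \<in> pdom Q" for x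
  proof -
    obtain p where p: "inrep Q p = Some x" using Q x by (auto simp: is_problem_def ran_def)
    have pD: "p' \<in> D" if "inrep Q p' = Some x" for p' using that x by (auto simp: D_def)
    have xk: "x \<in> pdom k" using K[OF p x] p x by (auto simp: pdom_def k_simps)
    have "app k x \<subseteq> pdom IP"
    proof
      fix y assume "y \<in> app k x"
      then obtain p' z where y: "y = (p', z)" "inrep Q p' = Some x" "inrep P (K p') = Some z"
        by (auto simp: k_simps)
      then have "z \<in> pdom P" using K[OF y(2) x] by auto
      then show "y \<in> pdom IP" by (simp add: pdom_def y IP)
    qed
    then have a: "app (IP \<circ>\<^sub>P k) x = (\<Union>y\<in>app k x. app IP y)" using xk by (simp add: comp_problem_def)
    have good: "good p' q w" if "(p', w) \<in> app (IP \<circ>\<^sub>P k) x" "outrep P q = Some w" for p' w q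
      using that pD unfolding a by (auto simp: k_simps IP good_def)
    have name: "\<exists>q. outrep P q = Some w" if "(p', w) \<in> app (IP \<circ>\<^sub>P k) x" for p' w
      using that P unfolding a by (fastforce simp: k_simps IP is_problem_def ran_def)
    have b: "app (IP \<circ>\<^sub>P k) x \<subseteq> pdom h"
    proof
      fix y assume y: "y \<in> app (IP \<circ>\<^sub>P k) x"
      obtain p' w where pw: "y = (p', w)" by force
      then obtain q where "good p' q w" using good name y by blast
      then show "y \<in> pdom h" using HD by (fastforce simp: pw pdom_def h_simps)
    qed
    have c: "app (IP \<circ>\<^sub>P k) x \<noteq> {}"
    proof -
      obtain z where z: "z \<in> pdom P" "inrep P (K p) = Some z" using K[OF p x] by blast
      then obtain w where "w \<in> app P z" by (auto simp: pdom_def)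
      then have "(p, w) \<in> app (IP \<circ>\<^sub>P k) x" unfolding a using z p x by (auto simp: k_simps IP)
      then show ?thesis by blast
    qed
    have d: "app (h \<circ>\<^sub>P IP \<circ>\<^sub>P k) x = (\<Union>y\<in>app (IP \<circ>\<^sub>P k) x. app h y)"
      using b c by (simp add: comp_problem_def pdom_def)
    have "app h y \<subseteq> app Q x" if y: "y \<in> app (IP \<circ>\<^sub>P k) x" for y
    proof -
      obtain p' w where pw: "y = (p', w)" by force
      have p': "inrep Q p' = Some x" using y unfolding a pw by (auto simp: k_simps IP)
      show ?thesis using H[OF p' x] by (fastforce simp: pw h_simps good_def)
    qed
    moreover have "app h y \<noteq> {}" if y: "y \<in> app (IP \<circ>\<^sub>P k) x" for y
      using b that by (auto simp: pdom_def)
    ultimately show ?thesis unfolding d using c by blast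
  qed
  then have "h \<circ>\<^sub>P IP \<circ>\<^sub>P k \<sqsubseteq>\<^sub>P Q" by (auto simp: refines_def pdom_def)
  then show ?thesis unfolding weihrauch_le_def using kp hp kc hc
    by (intro exI[of _ baire_repr] exI[of _ k] exI[of _ h]) (simp add: k_simps h_simps IP_def)
qed

section \<open>Upper bounds\<close>

lemma desc_stabilizes:
  assumes r: "Well_order r" and a: "\<And>n. (a (Suc n), a n) \<in> r"
  obtains N where "\<And>n. N \<le> n \<Longrightarrow> a n = a N"
    and "\<And>m n. m \<le> n \<Longrightarrow> (a n, a m) \<in> r" and "wo_rel.minim r (range a) = a N"
proof -
  interpret wo_rel r using r by (simp add: wo_rel_def)
  have field: "range a \<subseteq> Field r" using a by (auto simp: Field_def)
  have refl: "(a n, a n) \<in> r" for n using field REFL by (auto simp: refl_on_def)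
  have le: "(a n, a m) \<in> r" if "m \<le> n" for m n
    using that
  proof (induction n rule: dec_induct)
    case (step n)
    then show ?case using a[of n] TRANS by (meson transD)
  qed (rule refl)
  have "minim (range a) \<in> range a" using field by (intro minim_in) auto
  then obtain N where N: "minim (range a) = a N" by auto
  have "a n = a N" if "N \<le> n" for n
    using minim_least[OF field, of "a n"] le[OF that] ANTISYM N by (auto dest: antisymD)
  then show ?thesis using that le N by blast
qed

lemma Lim_desc_simps [simp]: "inrep (Lim_desc r f) = baire_repr" "outrep (Lim_desc r f) = nat_repr"
  by (simp_all add: Lim_desc_def)

lemma app_Lim_desc: "t \<in> app (Lim_desc r f) u \<longleftrightarrow> (\<forall>n. (f (u (Suc n)), f (u n)) \<in> r) \<and>
    f t = wo_rel.minim r (range (\<lambda>n. f (u n)))"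
  by (simp add: Lim_desc_def)

lemma pdom_Lim_desc:
  assumes "Well_order r"
  shows "u \<in> pdom (Lim_desc r f) \<longleftrightarrow> (\<forall>n. (f (u (Suc n)), f (u n)) \<in> r)"
proof
  assume desc: "\<forall>n. (f (u (Suc n)), f (u n)) \<in> r"
  obtain N where "wo_rel.minim r (range (\<lambda>n. f (u n))) = f (u N)"
    by (rule desc_stabilizes[OF assms, of "\<lambda>n. f (u n)"]) (use desc in blast)+
  then have "u N \<in> app (Lim_desc r f) u" using desc by (simp add: app_Lim_desc)
  then show "u \<in> pdom (Lim_desc r f)" by (auto simp: pdom_def)
qed (auto simp: pdom_def Lim_desc_def)

lemma is_problem_Lim_desc: "is_problem (Lim_desc r f)"
  by (auto simp: is_problem_def Lim_desc_def baire_repr_def nat_repr_def ran_def)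

text \<open>What is known about the kernel after reading \<open>u 0, ..., u n\<close>.\<close>

definition relators :: "(nat \<Rightarrow> nat \<Rightarrow> word) \<Rightarrow> (nat \<Rightarrow> nat) \<Rightarrow> nat \<Rightarrow> word set" where
  "relators \<theta> u n = {\<theta> (u 0) i | i. i < n \<and> u (Suc i) = 1}"

lemma relators_cong: "(\<And>i. i \<le> n \<Longrightarrow> u i = v i) \<Longrightarrow> relators \<theta> u n = relators \<theta> v n"
  by (auto simp: relators_def)

text \<open>The ranks of the relators seen so far descend. Once their limit is known, it suffices to
  wait for the first stage whose rank equals it: later relators keep the rank and so, by
  \<open>eq\<close>, the residual words.\<close>

theorem Res_le_Lim_desc:
  fixes \<rho> :: "nat \<Rightarrow> word set \<Rightarrow> 'o" and \<C> :: "'h monoid set"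
  assumes \<theta>: "word_enumeration \<theta>" and \<C>: "\<And>H. H \<in> \<C> \<Longrightarrow> group H"
    and r: "Well_order r" and f: "range f = Field r"
    and field: "\<And>k R. \<rho> k R \<in> Field r"
    and mono: "\<And>k R R'. R \<subseteq> R' \<Longrightarrow> R' \<subseteq> words k \<Longrightarrow> finite R' \<Longrightarrow> (\<rho> k R', \<rho> k R) \<in> r"
    and eq: "\<And>k R R'. R \<subseteq> R' \<Longrightarrow> R' \<subseteq> words k \<Longrightarrow> finite R' \<Longrightarrow> \<rho> k R' = \<rho> k R \<Longrightarrow>
      res_words \<C> k R' = res_words \<C> k R"
  shows "Res \<theta> \<C> \<le>\<^sub>W Lim_desc r f"
proof -
  let ?Q = "Res \<theta> \<C>" and ?P = "Lim_desc r f"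
  define \<alpha> where "\<alpha> u n = \<rho> (u 0) (relators \<theta> u n)" for u n
  define K where "K u n = (SOME t. f t = \<alpha> u n)" for u n
  have fK: "f (K u n) = \<alpha> u n" for u n
  proof -
    have "\<alpha> u n \<in> range f" using field f by (simp add: \<alpha>_def)
    then have "\<exists>t. f t = \<alpha> u n" by (metis rangeE)
    then show ?thesis unfolding K_def by (rule someI_ex)
  qed
  \<comment> \<open>The search inspects only finitely many entries of \<open>u\<close>, after which
    every entry of the output is determined.\<close>
  define H where "H u q = char_name \<theta> (u 0)
    (res_words \<C> (u 0) (relators \<theta> u (LEAST n. \<alpha> u n = f (q 0))))" for u q :: "nat \<Rightarrow> nat"
  have rel: "relators \<theta> u n \<subseteq> words (u 0)" "finite (relators \<theta> u n)" for u n
    using enumeration_in_words[OF \<theta>] by (auto simp: relators_def)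
  have rel_mono: "relators \<theta> u m \<subseteq> relators \<theta> u n" if "m \<le> n" for u m n
    using that by (auto simp: relators_def)
  have \<alpha>_desc: "(\<alpha> u n, \<alpha> u m) \<in> r" if "m \<le> n" for u m n
    unfolding \<alpha>_def by (rule mono[OF rel_mono[OF that] rel])
  have K_dom: "K u \<in> pdom ?P" for u
    unfolding pdom_Lim_desc[OF r] fK using \<alpha>_desc by auto
  have lim: "\<exists>N. f (q 0) = \<alpha> u N \<and> (\<forall>n\<ge>N. \<alpha> u n = \<alpha> u N)"
    if "w \<in> app ?P (K u)" "nat_repr q = Some w" for w q u
  proof -
    obtain N where N: "\<And>n. N \<le> n \<Longrightarrow> \<alpha> u n = \<alpha> u N" "wo_rel.minim r (range (\<alpha> u)) = \<alpha> u N"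
      by (rule desc_stabilizes[OF r, of "\<alpha> u"]) (use \<alpha>_desc in \<open>blast intro: le_SucI order_refl\<close>)+
    have "f (q 0) = wo_rel.minim r (range (\<alpha> u))"
      using that by (simp add: app_Lim_desc nat_repr_def fK[abs_def])
    then show ?thesis using N by metis
  qed
  show ?thesis
  proof (rule weihrauch_leI[where K = K and H = H])
    show "is_problem ?Q" "is_problem ?P"
      using Res_problem(4)[OF \<theta> \<C>] is_problem_Lim_desc by auto
  next
    show "\<exists>z\<in>pdom ?P. inrep ?P (K u) = Some z" for u
      using K_dom by (simp add: baire_repr_def)
  next
    fix u M z q w
    assume u: "inrep ?Q u = Some M" and M: "M \<in> pdom ?Q" and z: "inrep ?P (K u) = Some z"
      and w: "w \<in> app ?P z" "outrep ?P q = Some w"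
    have z': "z = K u" using z by (simp add: baire_repr_def)
    obtain N where N: "f (q 0) = \<alpha> u N" "\<And>n. n \<ge> N \<Longrightarrow> \<alpha> u n = \<alpha> u N"
      using lim[OF w(1)[unfolded z'] w(2)[unfolded Lim_desc_simps]] by blast
    define n where "n = (LEAST n. \<alpha> u n = f (q 0))"
    have n: "\<alpha> u n = \<alpha> u N" "n \<le> N"
      unfolding n_def N(1) by (rule LeastI Least_le, rule refl)+
    let ?k = "u 0" and ?R = "{\<theta> (u 0) n | n. u (Suc n) = 1}"
    have rw: "res_words \<C> ?k (relators \<theta> u m) = res_words \<C> ?k (relators \<theta> u n)" if "N \<le> m" for m
      using eq[OF rel_mono[of n m] rel] n N(2)[OF that] that by (simp add: \<alpha>_def)
    \<comment> \<open>Every relator of \<open>u\<close> is present at some stage beyond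
      \<open>N\<close>, where the residual words are still those of stage \<open>n\<close>; hence it
      follows in \<C> from the relators of stage \<open>n\<close>.\<close>
    have "res_words \<C> ?k ?R = res_words \<C> ?k (relators \<theta> u n)"
    proof (rule res_words_cong, intro iffI ballI)
      fix H T v assume H: "H \<in> \<C>" "marked_group H T" "length T = ?k"
        and *: "\<forall>v\<in>relators \<theta> u n. eval_word H T v = \<one>\<^bsub>H\<^esub>" and v: "v \<in> ?R"
      obtain i where i: "v = \<theta> ?k i" "u (Suc i) = 1" using v by auto
      have "v \<in> relators \<theta> u (max N (Suc i))" using i by (auto simp: relators_def)
      then have "v \<in> res_words \<C> ?k (relators \<theta> u (max N (Suc i)))"
        using rel(1) by (auto simp: res_words_def)
      then have "v \<in> res_words \<C> ?k (relators \<theta> u n)" using rw by simp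
      then show "eval_word H T v = \<one>\<^bsub>H\<^esub>" using H * by (simp add: res_words_def)
    qed (auto simp: relators_def)
    then have "H u q = char_name \<theta> ?k (res_words \<C> ?k ?R)" by (simp add: H_def n_def)
    moreover obtain M' where M': "M' \<in> app ?Q M" using M by (auto simp: pdom_def)
    ultimately have "marked_repr \<theta> (H u q) = Some M'"
      using Res_names[OF \<theta> \<C> _ M', of u "H u q"] u Res_problem(2)[OF \<theta> \<C>] by simp
    then show "\<exists>y\<in>app ?Q M. outrep ?Q (H u q) = Some y"
      using M' Res_problem(3)[OF \<theta> \<C>] by auto
  next
    fix u n
    show "\<exists>m. \<forall>u'\<in>{p. \<exists>x\<in>pdom ?Q. inrep ?Q p = Some x}. (\<forall>i<m. u' i = u i) \<longrightarrow> K u' n = K u n"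
    proof (intro exI ballI impI)
      fix u' assume "\<forall>i<Suc n. u' i = u i"
      then have "relators \<theta> u' n = relators \<theta> u n" "u' 0 = u 0"
        using relators_cong[of n u' u] by (auto simp: less_Suc_eq_le)
      then show "K u' n = K u n" by (simp add: K_def \<alpha>_def)
    qed
  next
    fix u q z w j
    assume z: "inrep ?P (K u) = Some z" "w \<in> app ?P z" "outrep ?P q = Some w"
    have "z = K u" using z(1) by (simp add: baire_repr_def)
    then obtain N where N: "\<alpha> u N = f (q 0)"
      using lim[of w u q] z(2,3) unfolding Lim_desc_simps by metis
    define n where "n = (LEAST n. \<alpha> u n = f (q 0))"
    show "\<exists>m. \<forall>u'\<in>{p. \<exists>x\<in>pdom ?Q. inrep ?Q p = Some x}.
      \<forall>q'. (\<exists>z w. inrep ?P (K u') = Some z \<and> w \<in> app ?P z \<and> outrep ?P q' = Some w) \<longrightarrow>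
        (\<forall>i<m. u' i = u i \<and> q' i = q i) \<longrightarrow> H u' q' j = H u q j"
    proof (intro exI ballI allI impI)
      fix u' q' assume *: "\<forall>i<Suc n. u' i = u i \<and> q' i = q i"
      have rel': "relators \<theta> u' i = relators \<theta> u i" "\<alpha> u' i = \<alpha> u i" if "i \<le> n" for i
        using relators_cong[of i u' u] * that by (auto simp: less_Suc_eq_le \<alpha>_def)
      have q: "q' 0 = q 0" "u' 0 = u 0" using * by auto
      have "(LEAST n. \<alpha> u' n = f (q' 0)) = n"
      proof (rule Least_equality)
        show "\<alpha> u' n = f (q' 0)"
          using rel'(2)[of n] q LeastI[of "\<lambda>n. \<alpha> u n = f (q 0)", OF N] by (simp add: n_def)
        fix i assume "\<alpha> u' i = f (q' 0)"
        then show "n \<le> i" using rel'(2)[of i] q Least_le[of "\<lambda>n. \<alpha> u n = f (q 0)" i]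
          by (cases "i \<le> n") (auto simp: n_def)
      qed
      then show "H u' q' j = H u q j" using rel'(1)[of n] q by (simp add: H_def n_def)
    qed
  qed
qed

section \<open>Finite groups: the upper bound\<close>

lemma marked_group_image:
  assumes "group G" and mG: "marked_group G S" and H: "group H" and f: "f \<in> iso G H"
  shows "marked_group H (map f S)"
proof -
  have fh: "f \<in> hom G H" and bij: "f ` carrier G = carrier H" using f by (auto simp: iso_def bij_betw_def)
  interpret group_hom G H f using assms fh by (simp add: group_hom_def group_hom_axioms_def)
  show ?thesis using generate_img[OF marked_groupD(2)[OF mG]] mG bij H
    by (auto simp: marked_group_def)
qed

text \<open>Triviality of a word under a marking is invariant under isomorphism, so a possibly
  infinite \<C> may be replaced by finitely many representatives before markings are
  counted.\<close>

lemma res_words_representatives: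
  assumes \<C>: "\<And>H. H \<in> \<C> \<Longrightarrow> group H" and "\<D> \<subseteq> \<C>" "\<And>G. G \<in> \<C> \<Longrightarrow> \<exists>H\<in>\<D>. G \<cong> H"
    and R: "R \<subseteq> words k"
  shows "res_words \<C> k R = res_words \<D> k R"
proof
  show "res_words \<C> k R \<subseteq> res_words \<D> k R" using assms(2) by (auto simp: res_words_def)
  show "res_words \<D> k R \<subseteq> res_words \<C> k R"
  proof
    fix w assume w: "w \<in> res_words \<D> k R"
    then have wk: "w \<in> words k" by (simp add: res_words_def)
    have "eval_word G S w = \<one>\<^bsub>G\<^esub>" if G: "G \<in> \<C>" "length S = k" "marked_group G S"
      "\<forall>v\<in>R. eval_word G S v = \<one>\<^bsub>G\<^esub>" for G S
    proof -
      obtain H f where H: "H \<in> \<D>" "f \<in> iso G H" using assms(3)[OF G(1)] by (auto simp: is_iso_def)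
      have gH: "group H" using H \<C> assms(2) by blast
      have mH: "marked_group H (map f S)" by (rule marked_group_image[OF \<C>[OF G(1)] G(3) gH H(2)])
      have "marked_iso G S H (map f S)" using H(2) by (auto simp: marked_iso_def)
      then have ker: "word_kernel G S = word_kernel H (map f S)"
        using marked_iso_kernel(1)[OF marked_groupD(1,2)[OF G(3)] gH] by blast
      have iff: "eval_word G S v = \<one>\<^bsub>G\<^esub> \<longleftrightarrow> eval_word H (map f S) v = \<one>\<^bsub>H\<^esub>" if "v \<in> words k" for v
        using ker that G(2) by (auto simp: word_kernel_def set_eq_iff)
      then show ?thesis using w H(1) mH G(2,4) R wk by (auto simp: res_words_def subset_iff)
    qed
    then show "w \<in> res_words \<C> k R" using wk by (auto simp: res_words_def)
  qed
qed

theorem Res_finite_le_Lim_desc: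
  fixes \<C> :: "'h monoid set"
  assumes \<theta>: "word_enumeration \<theta>" and \<C>: "\<And>H. H \<in> \<C> \<Longrightarrow> group H \<and> finite (carrier H)"
    and fin: "finite_up_to_iso \<C>" and f: "range f = Field natLeq"
  shows "Res \<theta> \<C> \<le>\<^sub>W Lim_desc natLeq f"
proof -
  obtain \<D> where \<D>: "\<D> \<subseteq> \<C>" "finite \<D>" "\<And>G. G \<in> \<C> \<Longrightarrow> \<exists>H\<in>\<D>. G \<cong> H"
    using fin by (auto simp: finite_up_to_iso_def)
  define E where "E k R = {(H, T). H \<in> \<D> \<and> length T = k \<and> marked_group H T \<and>
    (\<forall>v\<in>R. eval_word H T v = \<one>\<^bsub>H\<^esub>)}" for k R
  have "E k R \<subseteq> (SIGMA H:\<D>. {T. set T \<subseteq> carrier H \<and> length T = k})" for k R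
    by (auto simp: E_def marked_group_def)
  moreover have "finite (SIGMA H:\<D>. {T. set T \<subseteq> carrier H \<and> length T = k})" for k
    using \<D> \<C> by (intro finite_SigmaI finite_lists_length_eq) auto
  ultimately have finE: "finite (E k R)" for k R by (meson finite_subset)
  have anti: "E k R' \<subseteq> E k R" if "R \<subseteq> R'" for k R R' using that by (auto simp: E_def)
  show ?thesis
  proof (rule Res_le_Lim_desc[where \<rho> = "\<lambda>k R. card (E k R)"])
    show "group H" if "H \<in> \<C>" for H using \<C> that by blast
    fix k and R R' :: "word set" assume R: "R \<subseteq> R'" "R' \<subseteq> words k"
    show "(card (E k R'), card (E k R)) \<in> natLeq"
      using card_mono[OF finE anti[OF R(1)]] by (simp add: natLeq_def)
    assume "card (E k R') = card (E k R)"
    then have "E k R' = E k R" using card_subset_eq[OF finE anti[OF R(1)]] by blast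
    then have "res_words \<D> k R' = res_words \<D> k R"
      by (intro res_words_cong) (auto simp: E_def set_eq_iff)
    then show "res_words \<C> k R' = res_words \<C> k R"
      using res_words_representatives[of \<C> \<D> _ k, OF _ \<D>(1,3)] R \<C> by (metis subset_trans)
  next
    show "Well_order natLeq" by (rule natLeq_Well_order)
  qed (auto simp: \<theta> f Field_natLeq)
qed

section \<open>Nilpotent groups: the upper bound\<close>

lemma omega_square_iff:
  "(x, y) \<in> omega_square \<longleftrightarrow> fst x < fst y \<or> fst x = fst y \<and> snd x \<le> snd y"
  by (auto simp: omega_square_def)

lemma Field_omega_square [simp]: "Field omega_square = UNIV"
proof -
  have "(x, x) \<in> omega_square" for x by (simp add: omega_square_iff)
  then show ?thesis by (auto intro: FieldI1)
qed

lemma Well_order_omega_square: "Well_order omega_square"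
proof -
  have "omega_square - Id = less_than <*lex*> less_than" by (auto simp: omega_square_iff)
  then have "wf (omega_square - Id)" by (simp add: wf_lex_prod)
  moreover have "Linear_order omega_square"
    unfolding linear_order_on_def partial_order_on_def preorder_on_def
    by (auto simp: refl_on_def trans_def antisym_def total_on_def omega_square_iff)
  ultimately show ?thesis by (simp add: well_order_on_def)
qed

section \<open>The lower central series\<close>

context group
begin

lemma inv_cancel [simp]:
  assumes "x \<in> carrier G" "y \<in> carrier G"
  shows "inv x \<otimes> (x \<otimes> y) = y" "x \<otimes> (inv x \<otimes> y) = y"
  using assms by (simp_all flip: m_assoc)

definition commutator :: "'a \<Rightarrow> 'a \<Rightarrow> 'a" where
  "commutator x y = x \<otimes> y \<otimes> inv x \<otimes> inv y"

lemma commutator_closed [simp]: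
  "x \<in> carrier G \<Longrightarrow> y \<in> carrier G \<Longrightarrow> commutator x y \<in> carrier G"
  by (simp add: commutator_def)

end

text \<open>Fixes the record type without extension, the one for which \<open>lower_central\<close>
  is defined.\<close>

locale plain_group = group G for G :: "'a monoid" (structure)
begin

lemma lower_central_Suc: "lower_central G (Suc n) =
    generate G {commutator x y | x y. x \<in> lower_central G n \<and> y \<in> carrier G}"
  by (simp add: commutator_def)

declare lower_central.simps(2) [simp del]

lemma normal_lower_central: "lower_central G n \<lhd> G"
proof (induction n)
  case 0
  show ?case using normal_self by simp
next
  case (Suc n)
  interpret N: normal "lower_central G n" G by (rule Suc)
  show ?case
    unfolding lower_central_Suc
  proof (rule normal_generateI)
    show "{commutator x y |x y. x \<in> lower_central G n \<and> y \<in> carrier G} \<subseteq> carrier G"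
      using N.subset by auto
    fix h g assume h: "h \<in> {commutator x y |x y. x \<in> lower_central G n \<and> y \<in> carrier G}"
      and g: "g \<in> carrier G"
    then obtain x y where xy: "h = commutator x y" "x \<in> lower_central G n" "y \<in> carrier G" by auto
    then have "x \<in> carrier G" using N.subset by auto
    then have "g \<otimes> h \<otimes> inv g = commutator (g \<otimes> x \<otimes> inv g) (g \<otimes> y \<otimes> inv g)"
      using xy g by (simp add: commutator_def m_assoc inv_mult_group)
    then show "g \<otimes> h \<otimes> inv g \<in> {commutator x y |x y. x \<in> lower_central G n \<and> y \<in> carrier G}"
      using xy g N.inv_op_closed2[OF g xy(2)] by blast
  qed
qed

lemma lower_central_subset: "lower_central G n \<subseteq> carrier G"
  using normal_imp_subgroup[OF normal_lower_central] subgroup.subset by blast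

lemma subgroup_lower_central: "subgroup (lower_central G n) G"
  by (rule normal_imp_subgroup[OF normal_lower_central])

lemma commutator_in_lower_central:
  "x \<in> lower_central G n \<Longrightarrow> y \<in> carrier G \<Longrightarrow> commutator x y \<in> lower_central G (Suc n)"
  unfolding lower_central_Suc by (auto intro: generate.incl)

lemma lower_central_Suc_subset: "lower_central G (Suc n) \<subseteq> lower_central G n"
  unfolding lower_central_Suc
proof (rule generate_subgroup_incl[OF _ subgroup_lower_central], safe)
  fix x y assume x: "x \<in> lower_central G n" and y: "y \<in> carrier G"
  interpret N: normal "lower_central G n" G by (rule normal_lower_central)
  have "y \<otimes> inv x \<otimes> inv y \<in> lower_central G n" using x y N.inv_op_closed2 by simp
  then have "x \<otimes> (y \<otimes> inv x \<otimes> inv y) \<in> lower_central G n" using x by simp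
  then show "commutator x y \<in> lower_central G n"
    using x y lower_central_subset by (simp add: commutator_def m_assoc subset_iff)
qed

text \<open>Successive factors of the series are central: conjugating \<open>b\<close> by
  \<open>g\<close> changes it by a commutator, which lies in the next term and hence in
  \<open>B\<close>.\<close>

lemma normal_between_lower_central:
  assumes B: "subgroup B G" "lower_central G (Suc n) \<subseteq> B" "B \<subseteq> lower_central G n"
  shows "B \<lhd> G"
proof (rule normal_invI[OF B(1)])
  fix g b assume g: "g \<in> carrier G" and b: "b \<in> B"
  then have bc: "b \<in> carrier G" using B lower_central_subset by blast
  have "commutator b g \<in> B" using commutator_in_lower_central b g B by blast
  then have "inv (commutator b g) \<otimes> b \<in> B"
    using B(1) b by (simp add: subgroup.m_closed subgroup.m_inv_closed)
  then show "g \<otimes> b \<otimes> inv g \<in> B"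
    using g bc by (simp add: commutator_def m_assoc inv_mult_group)
qed

text \<open>Modulo the term that follows, the commutator is multiplicative in both arguments; so
  commutators of generators of one term with generators of \<open>G\<close> generate the next
  term.\<close>

lemma lower_central_finitely_generated_mod_Suc:
  assumes fin: "finite S" and S: "S \<subseteq> carrier G" and gen: "generate G S = carrier G"
  shows "\<exists>C. finite C \<and> C \<subseteq> lower_central G n \<and>
    generate G (C \<union> lower_central G (Suc n)) = lower_central G n"
proof (induction n)
  case 0
  have "generate G (S \<union> lower_central G (Suc 0)) = carrier G"
    using mono_generate[of S "S \<union> lower_central G (Suc 0)"] gen S lower_central_subset[of "Suc 0"]
      generate_incl[of "S \<union> lower_central G (Suc 0)"] by auto
  then show ?case using fin S by (intro exI[of _ S]) simp
next
  case (Suc n)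
  then obtain C where C: "finite C" "C \<subseteq> lower_central G n"
    "generate G (C \<union> lower_central G (Suc n)) = lower_central G n" by blast
  define C' where "C' = (\<lambda>(c, s). commutator c s) ` (C \<times> S)"
  have finC': "finite C'" using C fin by (simp add: C'_def)
  have subC': "C' \<subseteq> lower_central G (Suc n)"
    using C S by (auto simp: C'_def intro!: commutator_in_lower_central)
  let ?X = "C' \<union> lower_central G (Suc (Suc n))"
  define B where "B = generate G ?X"
  have X: "?X \<subseteq> lower_central G (Suc n)" using subC' lower_central_Suc_subset by blast
  have B1: "subgroup B G" unfolding B_def
    using X lower_central_subset by (intro generate_is_subgroup) blast
  have B2: "lower_central G (Suc (Suc n)) \<subseteq> B" and C'B: "C' \<subseteq> B"
    by (auto simp: B_def intro: generate.incl)
  have B3: "B \<subseteq> lower_central G (Suc n)" unfolding B_def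
    by (rule generate_subgroup_incl[OF X subgroup_lower_central])
  interpret B: normal B G by (rule normal_between_lower_central[OF B1 B2 B3])
  have L: "x \<in> carrier G" if "x \<in> lower_central G m" for x m using that lower_central_subset by blast
  \<comment> \<open>Uses \<open>[h1 h2, s] = (h1 [h2, s] h1^-1) [h1, s]\<close> and the normality of
    \<open>B\<close>.\<close>
  have cs: "commutator x s \<in> B" if s: "s \<in> S" and x: "x \<in> lower_central G n" for x s
  proof -
    have sc: "s \<in> carrier G" using s S by blast
    have "x \<in> generate G (C \<union> lower_central G (Suc n))" using x C(3) by simp
    then show ?thesis
    proof (induction x)
      case one
      then show ?case using sc by (simp add: commutator_def)
    next
      case (incl h)
      then show ?case
        using s C'B B2 commutator_in_lower_central[of h "Suc n" s] sc by (auto simp: C'_def)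
    next
      case (inv h)
      then have h: "h \<in> carrier G" using C(2) L by blast
      have "commutator h s \<in> B"
        using inv s C'B B2 commutator_in_lower_central[of h "Suc n" s] sc by (auto simp: C'_def)
      then have "inv h \<otimes> inv (commutator h s) \<otimes> inv (inv h) \<in> B"
        using h by (intro B.inv_op_closed2) auto
      then show ?case using h sc by (simp add: commutator_def m_assoc inv_mult_group)
    next
      case (eng h1 h2)
      have h: "h1 \<in> carrier G" "h2 \<in> carrier G" "h2 \<in> lower_central G n"
        using eng(1,2) C(3) L by auto
      have "h1 \<otimes> commutator h2 s \<otimes> inv h1 \<in> B" using eng h by (intro B.inv_op_closed2) auto
      then have "(h1 \<otimes> commutator h2 s \<otimes> inv h1) \<otimes> commutator h1 s \<in> B" using eng by auto
      then show ?case using h sc by (simp add: commutator_def m_assoc inv_mult_group)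
    qed
  qed
  \<comment> \<open>The same in the second argument, by
    \<open>[x, h1 h2] = [x, h1] (h1 [x, h2] h1^-1)\<close>.\<close>
  have "commutator x y \<in> B" if x: "x \<in> lower_central G n" and y: "y \<in> carrier G" for x y
  proof -
    have xc: "x \<in> carrier G" using x L by blast
    have "y \<in> generate G S" using y gen by simp
    then show ?thesis
    proof (induction y)
      case one
      then show ?case using xc by (simp add: commutator_def)
    next
      case (incl h)
      then show ?case using cs x by blast
    next
      case (inv h)
      then have h: "h \<in> carrier G" using S by blast
      have "inv h \<otimes> inv (commutator x h) \<otimes> inv (inv h) \<in> B"
        using h cs[OF inv x] by (intro B.inv_op_closed2) auto
      then show ?case using h xc by (simp add: commutator_def m_assoc inv_mult_group)
    next
      case (eng h1 h2)
      have h: "h1 \<in> carrier G" "h2 \<in> carrier G" using eng(1,2) gen by auto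
      have "h1 \<otimes> commutator x h2 \<otimes> inv h1 \<in> B" using eng h by (intro B.inv_op_closed2) auto
      then have "commutator x h1 \<otimes> (h1 \<otimes> commutator x h2 \<otimes> inv h1) \<in> B" using eng by auto
      then show ?case using h xc by (simp add: commutator_def m_assoc inv_mult_group)
    qed
  qed
  then have "lower_central G (Suc n) \<subseteq> B"
    unfolding lower_central_Suc using B1 by (intro generate_subgroup_incl) auto
  then show ?case using finC' subC' B3 by (intro exI[of _ C']) (auto simp: B_def)
qed

text \<open>A quantitative ascending chain condition: an ordinal below \<omega>^2 that decreases as
  a subgroup grows and, where it stays constant, pins down the trace of the subgroup on
  \<open>H\<close>.\<close>

definition ranked :: "'a set \<Rightarrow> bool" where
  "ranked H \<longleftrightarrow> (\<exists>\<rho> :: 'a set \<Rightarrow> nat \<times> nat. \<forall>K K'. subgroup K G \<longrightarrow> subgroup K' G \<longrightarrow> K \<subseteq> K' \<longrightarrow>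
     (\<rho> K', \<rho> K) \<in> omega_square \<and> (\<rho> K' = \<rho> K \<longrightarrow> K \<inter> H = K' \<inter> H))"

lemma ranked_one: "ranked {\<one>}"
  unfolding ranked_def
  by (intro exI[of _ "\<lambda>_. (0, 0)"]) (auto simp: omega_square_iff subgroup.one_closed)

end

text \<open>Componentwise addition is the natural sum of ordinals below \<omega>^2. Ordinary
  addition would absorb finite parts and lose the cancellation in the second claim.\<close>

lemma omega_square_add:
  assumes "((p1, p2), (q1, q2)) \<in> omega_square" "((p1', p2'), (q1', q2')) \<in> omega_square"
  shows "((p1 + p1', p2 + p2'), (q1 + q1', q2 + q2')) \<in> omega_square"
    and "p1 + p1' = q1 + q1' \<Longrightarrow> p2 + p2' = q2 + q2' \<Longrightarrow> p1 = q1 \<and> p2 = q2 \<and> p1' = q1' \<and> p2' = q2'"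
  using assms by (auto simp: omega_square_def)

context plain_group
begin

lemma generate_insert_normal:
  assumes N: "N \<lhd> G" and a: "a \<in> carrier G" and x: "x \<in> generate G (insert a N)"
  obtains n :: int and h where "h \<in> N" "x = a [^] n \<otimes> h"
proof -
  interpret normal N G by (rule N)
  have "\<exists>(n::int) h. h \<in> N \<and> x = a [^] n \<otimes> h" using x
  proof (induction x)
    case one
    then show ?case by (intro exI[of _ 0] exI[of _ \<one>]) auto
  next
    case (incl h)
    then show ?case
    proof
      assume "h = a"
      then show ?case using a by (intro exI[of _ 1] exI[of _ \<one>]) auto
    next
      assume "h \<in> N"
      then show ?case by (intro exI[of _ 0] exI[of _ h]) auto
    qed
  next
    case (inv h)
    then show ?case
    proof
      assume "h = a"
      then show ?case using a by (intro exI[of _ "-1"] exI[of _ \<one>]) (auto simp: int_pow_neg)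
    next
      assume "h \<in> N"
      then show ?case by (intro exI[of _ 0] exI[of _ "inv h"]) auto
    qed
  next
    case (eng h1 h2)
    then obtain n m :: int and u v where h: "u \<in> N" "h1 = a [^] n \<otimes> u" "v \<in> N" "h2 = a [^] m \<otimes> v"
      by blast
    have "inv (a [^] m) \<otimes> u \<otimes> a [^] m \<in> N" using h a by (intro inv_op_closed1) auto
    then have "inv (a [^] m) \<otimes> u \<otimes> a [^] m \<otimes> v \<in> N" using h by simp
    moreover have "h1 \<otimes> h2 = a [^] (n + m) \<otimes> (inv (a [^] m) \<otimes> u \<otimes> a [^] m \<otimes> v)"
      using h a by (simp add: int_pow_mult m_assoc)
    ultimately show ?case by blast
  qed
  then show ?thesis using that by blast
qed

text \<open>For nested subgroups, the traces on \<open>generate G (insert a N)\<close> agree once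
  the traces on \<open>N\<close> agree and the least positive exponents of \<open>a\<close>
  occurring modulo \<open>N\<close> agree. This exponent is added to the rank for
  \<open>N\<close>.\<close>

lemma ranked_cyclic_extension:
  assumes rk: "ranked N" and N: "N \<lhd> G" and a: "a \<in> carrier G"
  shows "ranked (generate G (insert a N))"
proof -
  interpret normal N G by (rule N)
  let ?H = "generate G (insert a N)"
  obtain \<rho> :: "'a set \<Rightarrow> nat \<times> nat" where \<rho>: "\<And>K K'. subgroup K G \<Longrightarrow> subgroup K' G \<Longrightarrow> K \<subseteq> K' \<Longrightarrow>
     (\<rho> K', \<rho> K) \<in> omega_square \<and> (\<rho> K' = \<rho> K \<longrightarrow> K \<inter> N = K' \<inter> N)"
    using rk unfolding ranked_def by blast
  define P where "P K d \<longleftrightarrow> 0 < d \<and> (\<exists>h\<in>N. a [^] d \<otimes> h \<in> K)" for K and d :: nat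
  \<comment> \<open>The value \<open>(1, 0)\<close> stands for \<omega>: no power of
    \<open>a\<close> is met yet. Meeting the first one trades \<omega> for a finite number, which
    can only decrease afterwards.\<close>
  define c :: "'a set \<Rightarrow> nat \<times> nat" where
    "c K = (if \<exists>d. P K d then (0, LEAST d. P K d) else (1, 0))" for K
  have P_mono: "P K' d" if "K \<subseteq> K'" "P K d" for K K' d using that by (auto simp: P_def)
  have c_mono: "(c K', c K) \<in> omega_square" if "K \<subseteq> K'" for K K'
    using P_mono[OF that] by (auto simp: c_def omega_square_iff intro: Least_le LeastI)
  have key: "K' \<inter> ?H \<subseteq> K"
    if K: "subgroup K G" "subgroup K' G" "K \<subseteq> K'" and c_eq: "c K' = c K" and KN: "K \<inter> N = K' \<inter> N"
    for K K'
  proof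
    fix x assume x: "x \<in> K' \<inter> ?H"
    interpret K: subgroup K G by (rule K(1))
    interpret K': subgroup K' G by (rule K(2))
    obtain n :: int and h where h: "h \<in> N" "x = a [^] n \<otimes> h"
      using generate_insert_normal[OF N a] x by blast
    have pos: "P K' (nat m)" if "0 < m" "a [^] m \<otimes> h \<in> K'" "h \<in> N" for m h
      unfolding P_def
    proof
      show "\<exists>h\<in>N. a [^] nat m \<otimes> h \<in> K'" using that by (intro bexI[of _ h]) simp_all
    qed (use that in simp)
    show "x \<in> K"
    proof (cases "\<exists>d. P K d")
      case False
      then have noK': "\<not> P K' d" for d using c_eq by (auto simp: c_def split: if_splits)
      have "n = 0"
      proof (rule ccontr)
        assume "n \<noteq> 0"
        then consider "0 < n" | "0 < - n" by linarith
        then show False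
        proof cases
          case 1
          then show False using pos[of n h] noK' h x by auto
        next
          case 2
          \<comment> \<open>A negative exponent becomes positive in the inverse of \<open>x\<close>;
            conjugation moves the element of \<open>N\<close> back behind the power of
            \<open>a\<close>.\<close>
          have "a [^] n \<otimes> inv h \<otimes> inv (a [^] n) \<in> N" using h a by (intro inv_op_closed2) auto
          moreover have "inv x = a [^] (- n) \<otimes> (a [^] n \<otimes> inv h \<otimes> inv (a [^] n))"
            using h a by (simp add: inv_mult_group int_pow_neg m_assoc)
          moreover have "inv x \<in> K'" using x by simp
          ultimately show False using pos[OF 2] noK' by metis
        qed
      qed
      then have "x \<in> K' \<inter> N" using h x by auto
      then show ?thesis using KN by blast
    next
      case True
      define d where "d = (LEAST d. P K d)"
      have Pd: "P K d" using True unfolding d_def by (rule LeastI_ex)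
      have "\<exists>d. P K' d" using True P_mono[OF K(3)] by blast
      then have "(LEAST d. P K' d) = d" using c_eq True by (simp add: c_def d_def)
      then have least: "d \<le> e" if "P K' e" for e using Least_le[of "P K'" e] that by simp
      obtain h0 where h0: "h0 \<in> N" "a [^] d \<otimes> h0 \<in> K" and d0: "0 < d" using Pd by (auto simp: P_def)
      \<comment> \<open>Division with remainder: removing a power of the element of \<open>K\<close>
        with exponent \<open>d\<close> leaves an element \<open>y\<close> of \<open>K'\<close> with
        exponent \<open>n mod d\<close>. As \<open>d\<close> is also least for \<open>K'\<close>,
        the remainder is 0, so \<open>y\<close> lies in \<open>N\<close>, where \<open>K\<close> and
        \<open>K'\<close> agree.\<close>
      define q where "q = n div int d"
      define z where "z = (a [^] d \<otimes> h0) [^] q"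
      define y where "y = x \<otimes> inv z"
      have zK: "z \<in> K" unfolding z_def using h0(2) K.subgroup_axioms
        by (simp add: subgroup_int_pow_closed)
      have zc: "z \<in> carrier G" and xc: "x \<in> carrier G" using zK x by auto
      have yK': "y \<in> K'" using x zK K(3) by (auto simp: y_def)
      define \<pi> where "\<pi> = (\<lambda>g. N #> g)"
      interpret \<pi>: group_hom G "G Mod N" \<pi>
        using r_coset_hom_Mod factorgroup_is_group is_group
        by (simp add: group_hom_def group_hom_axioms_def \<pi>_def)
      have \<pi>N: "\<pi> h = \<one>\<^bsub>G Mod N\<^esub>" if "h \<in> N" for h using that by (simp add: \<pi>_def rcos_const)
      have \<pi>z: "\<pi> z = \<pi> a [^]\<^bsub>G Mod N\<^esub> (int d * q)"
        using a h0 \<pi>N \<pi>.H.int_pow_pow[of "\<pi> a" "int d" q]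
        by (simp add: z_def \<pi>.hom_int_pow \<pi>.hom_nat_pow int_pow_int del: mult_FactGroup one_FactGroup)
      have \<pi>x: "\<pi> x = \<pi> a [^]\<^bsub>G Mod N\<^esub> n"
        using a h \<pi>N by (simp add: \<pi>.hom_int_pow del: mult_FactGroup one_FactGroup)
      have "\<pi> y = \<pi> a [^]\<^bsub>G Mod N\<^esub> (n - int d * q)"
        using a zc xc by (simp add: y_def \<pi>x \<pi>z \<pi>.H.int_pow_diff del: mult_FactGroup one_FactGroup)
      also have "n - int d * q = n mod int d" by (simp add: q_def minus_mult_div_eq_mod)
      finally have \<pi>y: "\<pi> y = \<pi> (a [^] (n mod int d))" using a by (simp add: \<pi>.hom_int_pow del: mult_FactGroup one_FactGroup)
      define h1 where "h1 = inv (a [^] (n mod int d)) \<otimes> y"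
      have yc: "y \<in> carrier G" using xc zc by (simp add: y_def)
      have "\<pi> h1 = \<one>\<^bsub>G Mod N\<^esub>" using \<pi>y a yc by (simp add: h1_def del: mult_FactGroup one_FactGroup)
      then have h1: "h1 \<in> N" using a yc coset_join1[OF _ _ subgroup_axioms, of h1]
        by (auto simp: \<pi>_def h1_def subset)
      have yh1: "y = a [^] (n mod int d) \<otimes> h1" using a yc by (simp add: h1_def)
      have "n mod int d = 0"
      proof (rule ccontr)
        assume "n mod int d \<noteq> 0"
        then have m0: "0 < n mod int d" using d0 pos_mod_sign[of "int d" n] by linarith
        then have "P K' (nat (n mod int d))" using pos[OF _ _ h1] yK'[unfolded yh1] by blast
        then have "d \<le> nat (n mod int d)" by (rule least)
        then have "int d \<le> n mod int d" using m0 by linarith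
        then show False using d0 pos_mod_bound[of "int d" n] by linarith
      qed
      then have "y \<in> N" using yh1 h1 by simp
      then have "y \<in> K" using yK' KN by blast
      then have "y \<otimes> z \<in> K" using zK by simp
      then show "x \<in> K" using xc zc by (simp add: y_def m_assoc)
    qed
  qed
  define \<rho>' where "\<rho>' K = (fst (\<rho> K) + fst (c K), snd (\<rho> K) + snd (c K))" for K
  show ?thesis
    unfolding ranked_def
  proof (intro exI[of _ \<rho>'] allI impI)
    fix K K' assume K: "subgroup K G" "subgroup K' G" "K \<subseteq> K'"
    have 1: "((fst (\<rho> K'), snd (\<rho> K')), (fst (\<rho> K), snd (\<rho> K))) \<in> omega_square"
      using \<rho>[OF K] by simp
    have 2: "((fst (c K'), snd (c K')), (fst (c K), snd (c K))) \<in> omega_square"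
      using c_mono[OF K(3)] by simp
    have "K \<inter> ?H = K' \<inter> ?H" if "\<rho>' K' = \<rho>' K"
    proof -
      have "\<rho> K' = \<rho> K" "c K' = c K"
        using omega_square_add(2)[OF 1 2] that by (auto simp: \<rho>'_def prod_eq_iff)
      then show ?thesis using key[OF K] \<rho>[OF K] K(3) by blast
    qed
    then show "(\<rho>' K', \<rho>' K) \<in> omega_square \<and> (\<rho>' K' = \<rho>' K \<longrightarrow> K \<inter> ?H = K' \<inter> ?H)"
      using omega_square_add(1)[OF 1 2] by (simp add: \<rho>'_def)
  qed
qed

text \<open>The polycyclic series is obtained by climbing the lower central series and adjoining the
  finitely many generators of each factor one at a time; all intermediate subgroups are normal
  because the factors are central.\<close>

lemma ranked_carrier_if_nilpotent:
  assumes S: "finite S" "S \<subseteq> carrier G" "generate G S = carrier G"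
    and nil: "lower_central G p = {\<one>}"
  shows "ranked (carrier G)"
proof -
  have "ranked (lower_central G (p - i))" if "i \<le> p" for i
    using that
  proof (induction i)
    case 0
    then show ?case using nil ranked_one by simp
  next
    case (Suc i)
    define n where "n = p - Suc i"
    have n: "Suc n = p - i" using Suc by (simp add: n_def)
    obtain C where C: "finite C" "C \<subseteq> lower_central G n"
      "generate G (C \<union> lower_central G (Suc n)) = lower_central G n"
      using lower_central_finitely_generated_mod_Suc[OF S] by blast
    have "ranked (generate G (F \<union> lower_central G (Suc n)))" if "finite F" "F \<subseteq> C" for F
      using that
    proof (induction F)
      case empty
      have "generate G (lower_central G (Suc n)) = lower_central G (Suc n)"
        using generate_subgroup_incl[OF order_refl subgroup_lower_central, of "Suc n"]
        by (auto intro: generate.incl)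
      then show ?case using Suc n by simp
    next
      case (insert a F)
      let ?X = "F \<union> lower_central G (Suc n)"
      define N where "N = generate G ?X"
      have X: "?X \<subseteq> lower_central G n" using insert C(2) lower_central_Suc_subset by blast
      have Xc: "?X \<subseteq> carrier G" using X lower_central_subset by blast
      have ac: "a \<in> carrier G" using insert C(2) lower_central_subset by blast
      have "N \<lhd> G"
        unfolding N_def
      proof (rule normal_between_lower_central)
        show "subgroup (generate G ?X) G" by (rule generate_is_subgroup[OF Xc])
        show "lower_central G (Suc n) \<subseteq> generate G ?X" by (auto intro: generate.incl)
        show "generate G ?X \<subseteq> lower_central G n"
          by (rule generate_subgroup_incl[OF X subgroup_lower_central])
      qed
      then have "ranked (generate G (insert a N))"
        using ranked_cyclic_extension insert ac by (auto simp: N_def)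
      moreover have "generate G (insert a N) = generate G (insert a F \<union> lower_central G (Suc n))"
      proof
        have sub: "subgroup (generate G (insert a F \<union> lower_central G (Suc n))) G"
          using Xc ac by (intro generate_is_subgroup) auto
        have "N \<subseteq> generate G (insert a F \<union> lower_central G (Suc n))"
          unfolding N_def using Xc ac by (intro mono_generate) auto
        then show "generate G (insert a N) \<subseteq> generate G (insert a F \<union> lower_central G (Suc n))"
          by (intro generate_subgroup_incl[OF _ sub]) (auto intro: generate.incl)
        have "N \<subseteq> carrier G" unfolding N_def using generate_incl[OF Xc] by blast
        moreover have "?X \<subseteq> N" by (auto simp: N_def intro: generate.incl)
        ultimately show "generate G (insert a F \<union> lower_central G (Suc n)) \<subseteq> generate G (insert a N)"
          using ac by (intro mono_generate) auto
      qed
      ultimately show ?case by simp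
    qed
    from this[OF C(1) order_refl] show ?case using C(3) by (simp add: n_def)
  qed
  from this[of p] show ?thesis by simp
qed

end

section \<open>Relatively free nilpotent groups\<close>

lemma hom_lower_central:
  assumes "group G" "group H" "f \<in> hom G H"
  shows "x \<in> lower_central G n \<Longrightarrow> f x \<in> lower_central H n"
proof (induction n arbitrary: x)
  case 0
  then show ?case using assms by (auto simp: hom_def)
next
  case (Suc n)
  interpret group_hom G H f using assms by (simp add: group_hom_def group_hom_axioms_def)
  interpret PG: plain_group G by (simp add: plain_group_def assms(1))
  interpret PH: plain_group H by (simp add: plain_group_def assms(2))
  have base: "f h \<in> lower_central H (Suc n)"
    if "h \<in> {G.commutator x y |x y. x \<in> lower_central G n \<and> y \<in> carrier G}" for h
  proof -
    obtain x y where xy: "h = G.commutator x y" "x \<in> lower_central G n" "y \<in> carrier G"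
      using \<open>h \<in> _\<close> by blast
    then have "x \<in> carrier G" using PG.lower_central_subset by blast
    then have "f h = H.commutator (f x) (f y)"
      using xy by (simp add: G.commutator_def H.commutator_def)
    then show ?thesis using PH.commutator_in_lower_central Suc.IH[OF xy(2)] xy by simp
  qed
  interpret L: subgroup "lower_central H (Suc n)" H by (rule PH.subgroup_lower_central)
  have sub: "{G.commutator x y |x y. x \<in> lower_central G n \<and> y \<in> carrier G} \<subseteq> carrier G"
    using PG.lower_central_subset by (auto simp: subset_iff)
  show ?case using Suc.prems unfolding PG.lower_central_Suc
  proof (induction x)
    case (inv h)
    then have "h \<in> carrier G" using sub by blast
    then show ?case using base[OF inv] by simp
  next
    case (eng h1 h2)
    then have "h1 \<in> carrier G" "h2 \<in> carrier G" using G.generate_in_carrier[OF sub] by auto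
    then show ?case using eng by simp
  qed (use base sub in auto)
qed

theorem Res_nilpotent_le_Lim_desc:
  assumes \<theta>: "word_enumeration \<theta>" and f: "range f = Field omega_square"
  shows "Res \<theta> (nilpotent_groups p) \<le>\<^sub>W Lim_desc omega_square f"
proof -
  let ?C = "nilpotent_groups p"
  have \<C>: "group H" if "H \<in> ?C" for H using that by (simp add: nilpotent_groups_def fin_gen_group_def)
  define I where "I k = {(H, T). H \<in> ?C \<and> length T = k \<and> marked_group H T}" for k
  have "\<exists>\<rho> :: word set \<Rightarrow> nat \<times> nat. \<forall>R R'. R \<subseteq> R' \<longrightarrow> R' \<subseteq> words k \<longrightarrow>
    (\<rho> R', \<rho> R) \<in> omega_square \<and> (\<rho> R' = \<rho> R \<longrightarrow> res_words ?C k R' = res_words ?C k R)" for k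
  proof -
    \<comment> \<open>One factor for each marking of a member of the class. The tuples
      \<open>S\<close> generate a group in which a word is trivial exactly if it is trivial under
      all markings.\<close>
    define \<Omega> where "\<Omega> = product_group (I k) fst"
    have g\<Omega>: "group \<Omega>" unfolding \<Omega>_def using \<C> by (intro product_group) (auto simp: I_def)
    define S where "S = map (\<lambda>j. \<lambda>i\<in>I k. snd i ! j) [0..<k]"
    have lenS: "length S = k" by (simp add: S_def)
    have S\<Omega>: "set S \<subseteq> carrier \<Omega>"
    proof -
      have "snd i ! j \<in> carrier (fst i)" if "i \<in> I k" "j < k" for i j
        using that marked_groupD(2)[of "fst i" "snd i"] by (auto simp: I_def subset_iff)
      then show ?thesis by (auto simp: S_def \<Omega>_def simp del: split_paired_All split_paired_Ex)
    qed
    define G where "G = \<Omega>\<lparr>carrier := generate \<Omega> (set S)\<rparr>"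
    have mG: "marked_group G S" unfolding G_def by (rule marked_group_subgroup(1)[OF g\<Omega> S\<Omega>])
    note G = marked_groupD[OF mG]
    interpret G: plain_group G by (simp add: plain_group_def G(1))
    have GP: "carrier G \<subseteq> carrier \<Omega>" "\<one>\<^bsub>G\<^esub> = \<one>\<^bsub>\<Omega>\<^esub>"
      using group.generate_incl[OF g\<Omega> S\<Omega>] by (auto simp: G_def)
    have proj: "(\<lambda>x. x i) \<in> hom G (fst i)" if "i \<in> I k" for i
      using that GP(1) by (auto simp: hom_def G_def \<Omega>_def)
    have gi: "group (fst i)" if "i \<in> I k" for i using that \<C> by (auto simp: I_def)
    have ev: "eval_word G S w (H, T) = eval_word H T w" if i: "(H, T) \<in> I k" and w: "w \<in> words k" for H T w
    proof -
      have "map (\<lambda>x. x (H, T)) S = T"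
        using i by (intro nth_equalityI) (auto simp: S_def I_def)
      then show ?thesis
        using eval_word_hom[OF G(1) gi[OF i] proj[OF i] G(2), of w] w lenS by simp
    qed
    \<comment> \<open>The class bound passes to \<open>G\<close> because the projections jointly
      separate its elements.\<close>
    have "lower_central G p \<subseteq> {\<one>\<^bsub>G\<^esub>}"
    proof
      fix x assume x: "x \<in> lower_central G p"
      have "x i = \<one>\<^bsub>fst i\<^esub>" if i: "i \<in> I k" for i
        using hom_lower_central[OF G(1) gi[OF i] proj[OF i] x] i
        by (auto simp: I_def nilpotent_groups_def)
      moreover have "x \<in> carrier \<Omega>" using x G.lower_central_subset GP(1) by blast
      ultimately have "x = \<one>\<^bsub>\<Omega>\<^esub>" by (auto simp: \<Omega>_def PiE_iff extensional_def fun_eq_iff)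
      then show "x \<in> {\<one>\<^bsub>G\<^esub>}" using GP(2) by simp
    qed
    then have "lower_central G p = {\<one>\<^bsub>G\<^esub>}"
      using subgroup.one_closed[OF G.subgroup_lower_central] by blast
    then have "G.ranked (carrier G)"
      using G.ranked_carrier_if_nilpotent[of "set S"] mG by (simp add: marked_group_def)
    then obtain \<rho> :: "_ set \<Rightarrow> nat \<times> nat" where \<rho>: "\<And>K K'. subgroup K G \<Longrightarrow> subgroup K' G \<Longrightarrow> K \<subseteq> K' \<Longrightarrow>
       (\<rho> K', \<rho> K) \<in> omega_square \<and> (\<rho> K' = \<rho> K \<longrightarrow> K \<inter> carrier G = K' \<inter> carrier G)"
      unfolding G.ranked_def by blast
    \<comment> \<open>\<open>K R\<close> is the image of the residual words of \<open>R\<close>: the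
      elements killed by all markings that satisfy \<open>R\<close>. It grows with \<open>R\<close>,
      so its rank serves as the ordinal of \<open>R\<close>.\<close>
    define J where "J R = {i\<in>I k. \<forall>v\<in>R. eval_word (fst i) (snd i) v = \<one>\<^bsub>fst i\<^esub>}" for R
    define K where "K R = {g\<in>carrier G. \<forall>i\<in>J R. g i = \<one>\<^bsub>fst i\<^esub>}" for R
    have subK: "subgroup (K R) G" for R
    proof -
      have gh: "group_hom G (fst i) (\<lambda>x. x i)" if "i \<in> J R" for i
        using that proj gi G(1) by (auto simp: J_def group_hom_def group_hom_axioms_def)
      show ?thesis
      proof (rule G.subgroupI)
        show "K R \<noteq> {}"
          using group_hom.hom_one[OF gh] by (auto simp: K_def intro!: exI[of _ "\<one>\<^bsub>G\<^esub>"])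
        show "inv\<^bsub>G\<^esub> a \<in> K R" if "a \<in> K R" for a
          using that group_hom.hom_inv[OF gh, of _ a] gi
          by (auto simp: K_def J_def monoid.inv_one group.is_monoid)
        show "a \<otimes>\<^bsub>G\<^esub> b \<in> K R" if "a \<in> K R" "b \<in> K R" for a b
          using that group_hom.hom_mult[OF gh, of _ a b] gi
          by (auto simp: K_def J_def group.is_monoid)
      qed (auto simp: K_def)
    qed
    have res: "res_words ?C k R = {w\<in>words k. eval_word G S w \<in> K R}" for R
      using ev lenS G.eval_word_closed[OF G(2)]
      by (auto simp: res_words_def K_def J_def I_def)
    have mono: "K R \<subseteq> K R'" if "R \<subseteq> R'" for R R' using that unfolding K_def J_def by blast
    show ?thesis
    proof (intro exI[of _ "\<lambda>R. \<rho> (K R)"] allI impI)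
      fix R R' :: "word set" assume R: "R \<subseteq> R'"
      have KG: "K Q \<inter> carrier G = K Q" for Q unfolding K_def by blast
      have *: "(\<rho> (K R'), \<rho> (K R)) \<in> omega_square \<and> (\<rho> (K R') = \<rho> (K R) \<longrightarrow> K R = K R')"
        using \<rho>[OF subK subK mono[OF R]] unfolding KG .
      show "(\<rho> (K R'), \<rho> (K R)) \<in> omega_square \<and>
        (\<rho> (K R') = \<rho> (K R) \<longrightarrow> res_words ?C k R' = res_words ?C k R)"
      proof (intro conjI impI)
        show "(\<rho> (K R'), \<rho> (K R)) \<in> omega_square" using * by (rule conjunct1)
        assume "\<rho> (K R') = \<rho> (K R)"
        with * have "K R = K R'" by (rule mp[OF conjunct2])
        then show "res_words ?C k R' = res_words ?C k R" by (simp only: res)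
      qed
    qed
  qed
  then obtain \<rho> :: "nat \<Rightarrow> word set \<Rightarrow> nat \<times> nat" where \<rho>: "\<And>k R R'. R \<subseteq> R' \<Longrightarrow> R' \<subseteq> words k \<Longrightarrow>
    (\<rho> k R', \<rho> k R) \<in> omega_square \<and> (\<rho> k R' = \<rho> k R \<longrightarrow> res_words ?C k R' = res_words ?C k R)"
    by metis
  show ?thesis
    by (rule Res_le_Lim_desc[where \<rho> = \<rho>, OF \<theta> \<C> Well_order_omega_square f]) (use \<rho> in auto)
qed

section \<open>Lower bounds\<close>

lemma res_words_reduce:
  assumes \<C>: "\<And>H. H \<in> \<C> \<Longrightarrow> group H" and w: "w \<in> words k"
  shows "reduce w \<in> res_words \<C> k R \<longleftrightarrow> w \<in> res_words \<C> k R"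
proof -
  have "eval_word H T (reduce w) = eval_word H T w" if "marked_group H T" "length T = k" for H T
    using group.eval_word_reduce[OF marked_groupD(1,2)[OF that(1)]] w that(2) by simp
  moreover have "reduce w \<in> words k" using reduce_free_words[OF w] free_words_subset by blast
  ultimately show ?thesis using w unfolding res_words_def mem_Collect_eq by metis
qed

text \<open>By \<open>local\<close> each entry of the name of the constructed group depends on
  finitely many terms of the sequence. By \<open>test\<close> the word for \<open>\<alpha> n\<close>
  survives in the residual quotient exactly if the sequence is constant from \<open>n\<close> on, so
  the first surviving test word reveals the limit.\<close>

theorem Lim_desc_le_Res:
  fixes \<C> :: "'h monoid set" and k :: "'o \<Rightarrow> nat" and N :: "(nat \<Rightarrow> 'o) \<Rightarrow> word set" and \<tau> :: "'o \<Rightarrow> 'o \<Rightarrow> word"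
  assumes \<theta>: "word_enumeration \<theta>" and \<C>: "\<And>H. H \<in> \<C> \<Longrightarrow> group H"
    and r: "Well_order r"
    and grp: "\<And>\<alpha>. (\<And>n. (\<alpha> (Suc n), \<alpha> n) \<in> r) \<Longrightarrow>
      \<exists>(G :: nat monoid) S. marked_group G S \<and> length S = k (\<alpha> 0) \<and> word_kernel G S = N \<alpha>"
    and local: "\<And>\<alpha> \<beta> n. (\<And>n. (\<alpha> (Suc n), \<alpha> n) \<in> r) \<Longrightarrow> (\<And>n. (\<beta> (Suc n), \<beta> n) \<in> r) \<Longrightarrow>
      (\<And>i. i \<le> n \<Longrightarrow> \<beta> i = \<alpha> i) \<Longrightarrow> \<theta> (k (\<alpha> 0)) n \<in> N \<alpha> \<Longrightarrow> \<theta> (k (\<alpha> 0)) n \<in> N \<beta>"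
    and test: "\<And>\<alpha> n. (\<And>n. (\<alpha> (Suc n), \<alpha> n) \<in> r) \<Longrightarrow> \<tau> (\<alpha> 0) (\<alpha> n) \<in> words (k (\<alpha> 0)) \<and>
      (\<tau> (\<alpha> 0) (\<alpha> n) \<notin> res_words \<C> (k (\<alpha> 0)) (N \<alpha>) \<longleftrightarrow> (\<forall>m\<ge>n. \<alpha> m = \<alpha> n))"
  shows "Lim_desc r f \<le>\<^sub>W Res \<theta> \<C>"
proof -
  let ?Q = "Lim_desc r f" and ?P = "Res \<theta> \<C>"
  define \<alpha> where "\<alpha> u n = f (u n)" for u and n :: nat
  define D where "D = {u. \<forall>n. (\<alpha> u (Suc n), \<alpha> u n) \<in> r}"
  define K where "K u = char_name \<theta> (k (\<alpha> u 0)) (N (\<alpha> u))" for u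
  define idx where "idx a b = (SOME n. \<theta> (k a) n = reduce (\<tau> a b))" for a b
  \<comment> \<open>Entry 0 of a name is the number of generators, hence the shift of the index by
    one; the entry 0 means that the test word is non-trivial.\<close>
  define found where "found u q n \<longleftrightarrow> q (Suc (idx (\<alpha> u 0) (\<alpha> u n))) = 0" for u q :: "nat \<Rightarrow> nat" and n
  define H :: "(nat \<Rightarrow> nat) \<Rightarrow> (nat \<Rightarrow> nat) \<Rightarrow> nat \<Rightarrow> nat" where
    "H u q = (\<lambda>_. u (LEAST n. found u q n))" for u q
  have dom: "u \<in> pdom ?Q \<longleftrightarrow> u \<in> D" for u
    by (simp add: pdom_Lim_desc[OF r] D_def \<alpha>_def)
  have Dset: "{p. \<exists>x\<in>pdom ?Q. inrep ?Q p = Some x} = D"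
    by (auto simp: dom baire_repr_def)
  have Res: "pdom ?P = marked_groups" "inrep ?P = marked_repr \<theta>" "outrep ?P = marked_repr \<theta>"
    "is_problem ?P"
    using Res_problem[OF \<theta>, of \<C>] \<C> by blast+
  have grp': "\<exists>(G :: nat monoid) S. marked_group G S \<and> K u = char_name \<theta> (length S) (word_kernel G S) \<and>
      length S = k (\<alpha> u 0) \<and> word_kernel G S = N (\<alpha> u)" if "u \<in> D" for u
    using grp[of "\<alpha> u"] that unfolding D_def K_def by fastforce
  have found_iff: "found u q n \<longleftrightarrow> (\<forall>m\<ge>n. \<alpha> u m = \<alpha> u n)"
    if u: "u \<in> D" and z: "marked_repr \<theta> (K u) = Some z" and w: "w \<in> app ?P z" "marked_repr \<theta> q = Some w"
    for u z w q n
  proof -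
    obtain G :: "nat monoid" and S where G: "marked_group G S" "K u = char_name \<theta> (length S) (word_kernel G S)"
      "length S = k (\<alpha> u 0)" "word_kernel G S = N (\<alpha> u)" using grp'[OF u] by blast
    have "names \<theta> (K u) (marked_class_of G S)" using names_marked_class_of[OF \<theta> G(1)] G(2) by simp
    then have "z = marked_class_of G S" using z marked_repr_eq_Some_iff[OF \<theta>] names_unique[OF \<theta>] by blast
    then have "w = res_quotient \<C> G S" using w(1) Res_spec[OF \<theta> G(1) \<C>] by simp
    then have "names \<theta> q (res_quotient \<C> G S)" using w(2) marked_repr_eq_Some_iff[OF \<theta>] by blast
    then have q: "q = char_name \<theta> (k (\<alpha> u 0)) (res_words \<C> (k (\<alpha> u 0)) (N (\<alpha> u)))"
      using res_quotient_spec[OF \<theta> G(1) \<C>] G by simp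
    have desc: "\<And>n. (\<alpha> u (Suc n), \<alpha> u n) \<in> r" using u by (simp add: D_def)
    let ?t = "\<tau> (\<alpha> u 0) (\<alpha> u n)"
    have t: "?t \<in> words (k (\<alpha> u 0))" using test[of "\<alpha> u" n] desc by blast
    have "reduce ?t \<in> range (\<theta> (k (\<alpha> u 0)))"
      using reduce_free_words[OF t] range_enumeration[OF \<theta>] by blast
    then have "\<exists>i. \<theta> (k (\<alpha> u 0)) i = reduce ?t" by (metis rangeE)
    then have "\<theta> (k (\<alpha> u 0)) (idx (\<alpha> u 0) (\<alpha> u n)) = reduce ?t"
      unfolding idx_def by (rule someI_ex)
    then have "found u q n \<longleftrightarrow> ?t \<notin> res_words \<C> (k (\<alpha> u 0)) (N (\<alpha> u))"
      using res_words_reduce[OF \<C> t] by (simp add: found_def q)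
    then show ?thesis using test[of "\<alpha> u" n] desc by blast
  qed
  have exists: "\<exists>n. \<forall>m\<ge>n. \<alpha> u m = \<alpha> u n" if "u \<in> D" for u
  proof -
    have desc: "\<And>n. (\<alpha> u (Suc n), \<alpha> u n) \<in> r" using that by (simp add: D_def)
    obtain M where "\<And>n. M \<le> n \<Longrightarrow> \<alpha> u n = \<alpha> u M" by (rule desc_stabilizes[where a = "\<alpha> u", OF r desc]) blast
    then show ?thesis by blast
  qed
  show ?thesis
  proof (rule weihrauch_leI[where K = K and H = H], unfold Dset)
    show "is_problem ?Q" "is_problem ?P" using Res(4) is_problem_Lim_desc by auto
  next
    fix u x assume u: "inrep ?Q u = Some x" "x \<in> pdom ?Q"
    then have "u \<in> D" by (simp add: dom baire_repr_def)
    then obtain G :: "nat monoid" and S where G: "marked_group G S"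
      "K u = char_name \<theta> (length S) (word_kernel G S)" using grp' by blast
    then have "names \<theta> (K u) (marked_class_of G S)" using names_marked_class_of[OF \<theta> G(1)] by simp
    then show "\<exists>z\<in>pdom ?P. inrep ?P (K u) = Some z"
      unfolding Res(1,2) marked_repr_eq_Some_iff[OF \<theta>]
      using marked_class_of_in_marked_groups[OF G(1)] by blast
  next
    fix u x z q w
    assume u: "inrep ?Q u = Some x" "x \<in> pdom ?Q" and z: "inrep ?P (K u) = Some z"
      and w: "w \<in> app ?P z" "outrep ?P q = Some w"
    have x: "x = u" "u \<in> D" using u by (auto simp: dom baire_repr_def)
    note f_iff = found_iff[OF x(2) z[unfolded Res(2)] w(1) w(2)[unfolded Res(3)]]
    define n where "n = (LEAST n. found u q n)"
    obtain n0 where "\<forall>m\<ge>n0. \<alpha> u m = \<alpha> u n0" using exists[OF x(2)] by blast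
    then have "found u q n0" using f_iff by blast
    then have "found u q n" unfolding n_def by (rule LeastI)
    then have stable: "\<forall>m\<ge>n. \<alpha> u m = \<alpha> u n" using f_iff by blast
    have desc: "\<And>n. (\<alpha> u (Suc n), \<alpha> u n) \<in> r" using x by (simp add: D_def)
    obtain M where M: "\<And>n. M \<le> n \<Longrightarrow> \<alpha> u n = \<alpha> u M" "wo_rel.minim r (range (\<alpha> u)) = \<alpha> u M"
      by (rule desc_stabilizes[where a = "\<alpha> u", OF r desc]) blast
    have "\<alpha> u n = \<alpha> u M" using stable[rule_format, of "max n M"] M(1)[of "max n M"] by (metis max.cobounded1 max.cobounded2)
    then have "f (u n) = wo_rel.minim r (range (\<lambda>n. f (u n)))"
      using M(2) unfolding \<alpha>_def[abs_def] by metis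
    then have "u n \<in> app ?Q x" using desc x(1) by (simp add: app_Lim_desc \<alpha>_def)
    then show "\<exists>y\<in>app ?Q x. outrep ?Q (H u q) = Some y"
      by (intro bexI[of _ "u n"]) (simp_all add: nat_repr_def H_def n_def)
  next
    fix u j assume u: "u \<in> D"
    show "\<exists>m. \<forall>u'\<in>D. (\<forall>i<m. u' i = u i) \<longrightarrow> K u' j = K u j"
    proof (intro exI ballI impI)
      fix u' assume u': "u' \<in> D" and "\<forall>i<Suc j. u' i = u i"
      then have eq: "\<alpha> u' i = \<alpha> u i" if "i \<le> j" for i using that by (simp add: \<alpha>_def)
      show "K u' j = K u j"
      proof (cases j)
        case 0
        then show ?thesis using eq by (simp add: K_def)
      next
        case (Suc n)
        have e: "\<And>i. i \<le> n \<Longrightarrow> \<alpha> u' i = \<alpha> u i" "\<And>i. i \<le> n \<Longrightarrow> \<alpha> u i = \<alpha> u' i" using eq Suc by simp_all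
        have d: "\<And>n. (\<alpha> u (Suc n), \<alpha> u n) \<in> r" "\<And>n. (\<alpha> u' (Suc n), \<alpha> u' n) \<in> r"
          using u u' by (auto simp: D_def)
        \<comment> \<open>\<open>local\<close> carries membership in one direction only; exchanging
          the two sequences gives the other.\<close>
        have "\<theta> (k (\<alpha> u 0)) n \<in> N (\<alpha> u') \<longleftrightarrow> \<theta> (k (\<alpha> u 0)) n \<in> N (\<alpha> u)"
          using local[of "\<alpha> u" "\<alpha> u'" n, OF d e(1)] local[of "\<alpha> u'" "\<alpha> u" n, OF d(2,1) e(2)] e(1)[of 0]
          by auto
        then show ?thesis using Suc e(1)[of 0] by (simp add: K_def)
      qed
    qed
  next
    fix u q z w j
    assume u: "u \<in> D" and z: "inrep ?P (K u) = Some z" and w: "w \<in> app ?P z" "outrep ?P q = Some w"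
    note f_iff = found_iff[OF u z[unfolded Res(2)] w(1) w(2)[unfolded Res(3)]]
    define n where "n = (LEAST n. found u q n)"
    obtain n0 where "\<forall>m\<ge>n0. \<alpha> u m = \<alpha> u n0" using exists[OF u] by blast
    then have "found u q n0" using f_iff by blast
    then have n: "found u q n" unfolding n_def by (rule LeastI)
    \<comment> \<open>A bound for all positions of \<open>u\<close> and \<open>q\<close> that the
      search reads before it succeeds.\<close>
    define m where "m = Suc n + (\<Sum>i\<le>n. Suc (Suc (idx (\<alpha> u 0) (\<alpha> u i))))"
    have m: "Suc (idx (\<alpha> u 0) (\<alpha> u i)) < m" if "i \<le> n" for i
      using member_le_sum[of i "{..n}" "\<lambda>i. Suc (Suc (idx (\<alpha> u 0) (\<alpha> u i)))"] that
      by (simp add: m_def)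
    show "\<exists>m. \<forall>u'\<in>D. \<forall>q'. (\<exists>z w. inrep ?P (K u') = Some z \<and> w \<in> app ?P z \<and> outrep ?P q' = Some w) \<longrightarrow>
        (\<forall>i<m. u' i = u i \<and> q' i = q i) \<longrightarrow> H u' q' j = H u q j"
    proof (intro exI ballI allI impI)
      fix u' q' assume eq: "\<forall>i<m. u' i = u i \<and> q' i = q i"
      have \<alpha>: "\<alpha> u' i = \<alpha> u i" "u' i = u i" if "i \<le> n" for i using eq that by (auto simp: \<alpha>_def m_def)
      have f_eq: "found u' q' i \<longleftrightarrow> found u q i" if "i \<le> n" for i
        using \<alpha>(1)[OF that] \<alpha>(1)[of 0] m[OF that] eq by (simp add: found_def)
      have "(LEAST n. found u' q' n) = n"
      proof (rule Least_equality)
        show "found u' q' n" using f_eq n by simp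
        fix i assume "found u' q' i"
        then show "n \<le> i" using f_eq[of i] Least_le[of "found u q" i]
          by (cases "i \<le> n") (auto simp: n_def)
      qed
      then show "H u' q' j = H u q j" using \<alpha>(2)[of n] by (simp add: H_def n_def)
    qed
  qed
qed

section \<open>Groups given by actions\<close>

text \<open>The letters act on representatives and are inverse to each other only modulo
  \<open>E\<close>; on the classes they become permutations, whose group is then copied to the
  natural numbers. Quotients of the acted-on set enter only through \<open>E\<close>.\<close>

theorem marked_group_of_action:
  fixes act :: "nat \<times> bool \<Rightarrow> 'd \<Rightarrow> 'd"
  assumes E: "equiv D E"
    and closed: "\<And>a x. fst a < k \<Longrightarrow> x \<in> D \<Longrightarrow> act a x \<in> D"
    and resp: "\<And>a x y. fst a < k \<Longrightarrow> (x, y) \<in> E \<Longrightarrow> (act a x, act a y) \<in> E"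
    and inv: "\<And>i b x. i < k \<Longrightarrow> x \<in> D \<Longrightarrow> (act (i, \<not> b) (act (i, b) x), x) \<in> E"
  shows "\<exists>(G :: nat monoid) S. marked_group G S \<and> length S = k \<and>
    word_kernel G S = {w \<in> words k. \<forall>x\<in>D. (foldr act w x, x) \<in> E}"
proof -
  define cl where "cl x = E `` {x}" for x
  define Q where "Q = cl ` D"
  have cl: "cl x = cl y \<longleftrightarrow> (x, y) \<in> E" if "x \<in> D" "y \<in> D" for x y
    unfolding cl_def using eq_equiv_class_iff[OF E that] .
  define lift where "lift g = (\<lambda>c\<in>Q. cl (g (SOME x. x \<in> D \<and> cl x = c)))" for g
  define ok where "ok g \<longleftrightarrow> (\<forall>x\<in>D. g x \<in> D) \<and> (\<forall>x y. (x, y) \<in> E \<longrightarrow> (g x, g y) \<in> E)" for g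
  have lift: "lift g (cl x) = cl (g x)" if g: "ok g" and x: "x \<in> D" for g x
  proof -
    define y where "y = (SOME y. y \<in> D \<and> cl y = cl x)"
    have y: "y \<in> D \<and> cl y = cl x" unfolding y_def by (rule someI[of _ x]) (simp add: x)
    then have "(y, x) \<in> E" using cl x by blast
    then have "(g y, g x) \<in> E" "g y \<in> D" "g x \<in> D" using g x y by (auto simp: ok_def)
    then have "cl (g y) = cl (g x)" using cl by blast
    then show ?thesis using x by (simp add: lift_def Q_def y_def)
  qed
  have lift_ext: "lift g \<in> extensional Q" for g by (simp add: lift_def)
  have lift_Q: "lift g c \<in> Q" if "ok g" "c \<in> Q" for g c
    using that lift by (auto simp: Q_def ok_def)
  have lift_comp: "compose Q (lift f) (lift g) = lift (f \<circ> g)" if "ok f" "ok g" for f g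
  proof (rule extensionalityI[of _ Q])
    fix c assume c: "c \<in> Q"
    then obtain x where x: "x \<in> D" "c = cl x" by (auto simp: Q_def)
    moreover have "g x \<in> D" "ok (f \<circ> g)" using that x by (auto simp: ok_def)
    ultimately show "compose Q (lift f) (lift g) c = lift (f \<circ> g) c"
      using c by (simp add: compose_def lift that)
  qed (use lift_ext in \<open>auto simp: compose_def\<close>)
  have lift_id: "lift g = (\<lambda>c\<in>Q. c)" if "ok g" "\<And>x. x \<in> D \<Longrightarrow> (g x, x) \<in> E" for g
  proof (rule extensionalityI[of _ Q])
    fix c assume c: "c \<in> Q"
    then obtain x where x: "x \<in> D" "c = cl x" by (auto simp: Q_def)
    then have "cl (g x) = cl x" using that cl[of "g x" x] by (auto simp: ok_def)
    then show "lift g c = (\<lambda>c\<in>Q. c) c" using x c lift[OF that(1)] by simp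
  qed (use lift_ext in auto)
  have ok_act: "ok (act a)" if "fst a < k" for a using that closed resp by (auto simp: ok_def)
  have ok_comp: "ok (f \<circ> g)" if "ok f" "ok g" for f g using that by (auto simp: ok_def)
  define B where "B = BijGroup Q"
  interpret B: group B unfolding B_def by (rule group_BijGroup)
  have cancel: "compose Q (lift (act (i, \<not> b))) (lift (act (i, b))) = (\<lambda>c\<in>Q. c)" if i: "i < k" for i b
    using lift_comp[OF ok_act ok_act] lift_id[OF ok_comp[OF ok_act ok_act]] inv i by simp
  have bij: "lift (act a) \<in> carrier B" if a: "fst a < k" for a
  proof -
    obtain i b where ib: "a = (i, b)" by force
    have "compose Q (lift (act (i, \<not> b))) (lift (act (i, b))) c = c" if "c \<in> Q" for c
      using cancel[of i b] a that by (simp add: ib)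
    moreover have "compose Q (lift (act (i, b))) (lift (act (i, \<not> b))) c = c" if "c \<in> Q" for c
      using cancel[of i "\<not> b"] a that by (simp add: ib)
    ultimately have "bij_betw (lift (act a)) Q Q"
      using lift_Q ok_act a by (intro bij_betw_byWitness[where f' = "lift (act (i, \<not> b))"])
        (auto simp: ib compose_def)
    then show ?thesis using lift_ext by (simp add: B_def BijGroup_def Bij_def)
  qed
  have multB: "f \<otimes>\<^bsub>B\<^esub> g = compose Q f g" if "f \<in> carrier B" "g \<in> carrier B" for f g
    using that by (simp add: B_def BijGroup_def)
  have oneB: "\<one>\<^bsub>B\<^esub> = (\<lambda>c\<in>Q. c)" by (simp add: B_def BijGroup_def)
  define S where "S = map (\<lambda>i. lift (act (i, True))) [0..<k]"
  have lenS: "length S = k" by (simp add: S_def)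
  have SB: "set S \<subseteq> carrier B" using bij by (auto simp: S_def)
  have letter: "(if b then S ! i else inv\<^bsub>B\<^esub> (S ! i)) = lift (act (i, b))" if i: "i < k" for i b
  proof (cases b)
    case False
    have "lift (act (i, False)) \<otimes>\<^bsub>B\<^esub> lift (act (i, True)) = \<one>\<^bsub>B\<^esub>"
      using cancel[OF i, of True] bij i by (simp add: multB oneB)
    then have "inv\<^bsub>B\<^esub> (lift (act (i, True))) = lift (act (i, False))"
      using bij i by (intro B.inv_equality) auto
    then show ?thesis using False i by (simp add: S_def)
  qed (use i in \<open>simp add: S_def\<close>)
  have ok_foldr: "ok (foldr act w)" if "w \<in> words k" for w
    using that
  proof (induction w)
    case (Cons a w)
    then show ?case using ok_comp[OF ok_act] by (simp add: comp_def)
  qed (simp add: ok_def)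
  have ev: "eval_word B S w = lift (foldr act w)" if "w \<in> words k" for w
    using that
  proof (induction w)
    case Nil
    have "(x, x) \<in> E" if "x \<in> D" for x using that E by (auto simp: equiv_def refl_on_def)
    then show ?case using lift_id[of "\<lambda>x. x"] by (simp add: oneB ok_def id_def)
  next
    case (Cons a w)
    have "eval_word B S w \<in> carrier B"
      by (rule B.eval_word_closed[OF SB]) (use Cons lenS in simp)
    then have c: "lift (foldr act w) \<in> carrier B" using Cons by simp
    have "eval_word B S (a # w) = lift (act a) \<otimes>\<^bsub>B\<^esub> lift (foldr act w)"
      using Cons letter[of "fst a" "snd a"] by (simp add: eval_word_Cons)
    also have "\<dots> = lift (act a \<circ> foldr act w)"
      using multB[OF bij c] lift_comp[OF ok_act ok_foldr] Cons by simp
    finally show ?case by (simp add: comp_def)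
  qed
  have "eval_word B S w = \<one>\<^bsub>B\<^esub> \<longleftrightarrow> (\<forall>x\<in>D. (foldr act w x, x) \<in> E)" if w: "w \<in> words k" for w
  proof
    assume "eval_word B S w = \<one>\<^bsub>B\<^esub>"
    then have "cl (foldr act w x) = cl x" if "x \<in> D" for x
      using ev[OF w] lift[OF ok_foldr[OF w] that] that by (simp add: oneB Q_def)
    then show "\<forall>x\<in>D. (foldr act w x, x) \<in> E" using cl ok_foldr[OF w] by (auto simp: ok_def)
  next
    assume "\<forall>x\<in>D. (foldr act w x, x) \<in> E"
    then show "eval_word B S w = \<one>\<^bsub>B\<^esub>" using ev[OF w] lift_id[OF ok_foldr[OF w]] by (simp add: oneB)
  qed
  then have "word_kernel B S = {w \<in> words k. \<forall>x\<in>D. (foldr act w x, x) \<in> E}"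
    by (auto simp: word_kernel_def lenS)
  moreover obtain G' :: "nat monoid" and S' where "marked_group G' S'" "length S' = length S"
    "word_kernel G' S' = word_kernel B S" by (rule nat_copy[OF B.is_group SB])
  ultimately show ?thesis using lenS by auto
qed

section \<open>Free products of cyclic groups\<close>

text \<open>A syllable \<open>(y, e)\<close> stands for the \<open>e\<close>-th power of the generator \<open>y\<close>, whose order is
  \<open>q y\<close>. Infinite order is encoded as \<open>q y = 0\<close>, since \<open>e mod 0 = e\<close>.\<close>

type_synonym syllables = "(nat \<times> int) list"

text \<open>A normal form is split into a power of \<open>y\<close> and a rest that does not begin
  with \<open>y\<close>. The exponent 0 covers the absence of such a syllable, so adding to the
  exponent needs no case distinction.\<close>

definition head_exp :: "nat \<Rightarrow> syllables \<Rightarrow> int" where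
  "head_exp y l = (case l of [] \<Rightarrow> 0 | (y', e) # l' \<Rightarrow> if y' = y then e else 0)"

definition tail_after :: "nat \<Rightarrow> syllables \<Rightarrow> syllables" where
  "tail_after y l = (case l of [] \<Rightarrow> [] | (y', e) # l' \<Rightarrow> if y' = y then l' else l)"

definition put :: "(nat \<Rightarrow> int) \<Rightarrow> nat \<Rightarrow> int \<Rightarrow> syllables \<Rightarrow> syllables" where
  "put q y e l = (if e mod q y = 0 then l else (y, e mod q y) # l)"

definition add_exp :: "(nat \<Rightarrow> int) \<Rightarrow> nat \<Rightarrow> int \<Rightarrow> syllables \<Rightarrow> syllables" where
  "add_exp q y s l = put q y (head_exp y l + s) (tail_after y l)"

definition syl_step :: "(nat \<Rightarrow> int) \<Rightarrow> nat \<times> bool \<Rightarrow> syllables \<Rightarrow> syllables" where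
  "syl_step q a = add_exp q (fst a) (if snd a then 1 else - 1)"

definition syl_valid :: "(nat \<Rightarrow> int) \<Rightarrow> nat \<Rightarrow> syllables \<Rightarrow> bool" where
  "syl_valid q k l \<longleftrightarrow> successively (\<lambda>a b. fst a \<noteq> fst b) l \<and>
     (\<forall>a\<in>set l. fst a < k \<and> snd a \<noteq> 0 \<and> snd a mod q (fst a) = snd a)"

lemma syl_valid_tail_after: "syl_valid q k l \<Longrightarrow> syl_valid q k (tail_after y l)"
  by (cases l) (force simp: syl_valid_def tail_after_def successively_Cons)+

lemma head_exp_tail_after: "syl_valid q k l \<Longrightarrow> head_exp y (tail_after y l) = 0"
  by (cases l; cases "tl l") (auto simp: syl_valid_def tail_after_def head_exp_def successively_Cons)

lemma tail_after_tail_after: "syl_valid q k l \<Longrightarrow> tail_after y (tail_after y l) = tail_after y l"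
  by (cases l; cases "tl l") (auto simp: syl_valid_def tail_after_def successively_Cons)

lemma put_cong: "e mod q y = e' mod q y \<Longrightarrow> put q y e l = put q y e' l"
  by (simp add: put_def)

lemma put_head_exp:
  assumes "syl_valid q k l" shows "put q y (head_exp y l) (tail_after y l) = l"
  using assms by (auto simp: put_def syl_valid_def head_exp_def tail_after_def split: list.splits)

lemma syl_valid_put:
  assumes "syl_valid q k l" "y < k" "tail_after y l = l"
  shows "syl_valid q k (put q y e l)"
  using assms
  by (cases l) (auto simp: put_def syl_valid_def tail_after_def successively_Cons split: if_splits)

lemma head_exp_put: "head_exp y l = 0 \<Longrightarrow> head_exp y (put q y e l) = e mod q y"
  by (auto simp: put_def head_exp_def)

lemma tail_after_put: "tail_after y l = l \<Longrightarrow> tail_after y (put q y e l) = l"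
  by (auto simp: put_def tail_after_def)

lemma syl_valid_add_exp: "syl_valid q k l \<Longrightarrow> y < k \<Longrightarrow> syl_valid q k (add_exp q y s l)"
  unfolding add_exp_def by (intro syl_valid_put syl_valid_tail_after tail_after_tail_after)

lemma add_exp_add_exp:
  assumes "syl_valid q k l" shows "add_exp q y s (add_exp q y t l) = add_exp q y (t + s) l"
  unfolding add_exp_def head_exp_put[OF head_exp_tail_after[OF assms]]
    tail_after_put[OF tail_after_tail_after[OF assms]]
  by (rule put_cong) (simp add: mod_add_left_eq add.assoc)

lemma add_exp_trivial:
  assumes "syl_valid q k l" "q y dvd s" shows "add_exp q y s l = l"
proof -
  have "add_exp q y s l = put q y (head_exp y l) (tail_after y l)"
    unfolding add_exp_def using assms(2) by (intro put_cong) (metis dvd_imp_mod_0 mod_add_right_eq add.right_neutral)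
  then show ?thesis using put_head_exp[OF assms(1)] by simp
qed

lemma syl_step_replicate:
  assumes "syl_valid q k l" "y < k"
  shows "foldr (syl_step q) (replicate n (y, True)) l = add_exp q y (int n) l"
proof (induction n)
  case 0
  then show ?case using add_exp_trivial[OF assms(1), of y 0] by simp
next
  case (Suc n)
  have "foldr (syl_step q) (replicate (Suc n) (y, True)) l = add_exp q y 1 (add_exp q y (int n) l)"
    using Suc by (simp add: syl_step_def)
  then show ?case using add_exp_add_exp[OF assms(1)] by (simp add: add.commute)
qed

text \<open>Only the orbit of the empty normal form is followed, which makes membership a
  computation along the word; that the kernel of the whole action is obtained is shown by
  \<open>free_product_marked_group\<close>.\<close>

definition free_product_kernel :: "(nat \<Rightarrow> int) \<Rightarrow> nat \<Rightarrow> word set" where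
  "free_product_kernel q k = {w \<in> words k. foldr (syl_step q) w [] = []}"

text \<open>Reading a normal form as a product in \<open>X\<close> turns the action of a letter into
  left multiplication, as the torsion relations absorb the reduction of exponents. Returning to the
  empty normal form means value one.\<close>

lemma free_product_universal:
  assumes X: "group X" "set T \<subseteq> carrier X" "length T = k"
    and tors: "\<And>y. y < k \<Longrightarrow> (T ! y) [^]\<^bsub>X\<^esub> (q y) = \<one>\<^bsub>X\<^esub>"
    and w: "w \<in> free_product_kernel q k"
  shows "eval_word X T w = \<one>\<^bsub>X\<^esub>"
proof -
  interpret group X by fact
  define nf where "nf l = foldr (\<lambda>(y, e) x. (T ! y) [^]\<^bsub>X\<^esub> (e :: int) \<otimes>\<^bsub>X\<^esub> x) l \<one>\<^bsub>X\<^esub>" for l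
  have T: "T ! y \<in> carrier X" if "y < k" for y using that X by (auto simp: subset_iff)
  have nf_simps: "nf [] = \<one>\<^bsub>X\<^esub>" "nf ((y, e) # l) = (T ! y) [^]\<^bsub>X\<^esub> e \<otimes>\<^bsub>X\<^esub> nf l" for y e l
    by (simp_all add: nf_def)
  have pow_mod: "(T ! y) [^]\<^bsub>X\<^esub> (e mod q y) = (T ! y) [^]\<^bsub>X\<^esub> e" if y: "y < k" for y and e :: int
  proof -
    have "(T ! y) [^]\<^bsub>X\<^esub> e = (T ! y) [^]\<^bsub>X\<^esub> (q y * (e div q y) + e mod q y)" by simp
    also have "\<dots> = ((T ! y) [^]\<^bsub>X\<^esub> (q y)) [^]\<^bsub>X\<^esub> (e div q y) \<otimes>\<^bsub>X\<^esub> (T ! y) [^]\<^bsub>X\<^esub> (e mod q y)"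
      using T[OF y] by (simp only: int_pow_mult int_pow_pow)
    finally show ?thesis using T[OF y] tors[OF y] by simp
  qed
  have nf_closed: "nf l \<in> carrier X" if "\<forall>a\<in>set l. fst a < k" for l
    using that by (induction l) (auto simp: nf_simps T)
  have nf_put: "nf (put q y e l) = (T ! y) [^]\<^bsub>X\<^esub> e \<otimes>\<^bsub>X\<^esub> nf l"
    if "y < k" "\<forall>a\<in>set l. fst a < k" for y e l
  proof (cases "e mod q y = 0")
    case True
    then have "(T ! y) [^]\<^bsub>X\<^esub> e = \<one>\<^bsub>X\<^esub>" using pow_mod[OF that(1), of e] by simp
    then show ?thesis using True nf_closed[OF that(2)] by (simp add: put_def)
  qed (use pow_mod[OF that(1), of e] in \<open>simp add: put_def nf_simps\<close>)
  have nf_split: "(T ! y) [^]\<^bsub>X\<^esub> head_exp y l \<otimes>\<^bsub>X\<^esub> nf (tail_after y l) = nf l"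
    if "\<forall>a\<in>set l. fst a < k" for y l
    using that nf_closed by (cases l) (auto simp: head_exp_def tail_after_def nf_simps T)
  have tail: "\<forall>a\<in>set (tail_after y l). fst a < k" if "\<forall>a\<in>set l. fst a < k" for y l
  proof -
    have "set (tail_after y l) \<subseteq> set l" by (cases l) (auto simp: tail_after_def)
    then show ?thesis using that by blast
  qed
  have nf_add: "nf (add_exp q y s l) = (T ! y) [^]\<^bsub>X\<^esub> s \<otimes>\<^bsub>X\<^esub> nf l"
    if y: "y < k" and l: "\<forall>a\<in>set l. fst a < k" for y s l
    unfolding add_exp_def nf_put[OF y tail[OF l]] nf_split[OF l, of y, symmetric]
    using T[OF y] nf_closed[OF tail[OF l]] by (simp add: add.commute[of "head_exp y l"] int_pow_mult m_assoc)
  have "(\<forall>a\<in>set (foldr (syl_step q) v []). fst a < k) \<and> eval_word X T v = nf (foldr (syl_step q) v [])"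
    if "v \<in> words k" for v
    using that
  proof (induction v)
    case (Cons a v)
    let ?l = "foldr (syl_step q) v []"
    have l: "\<forall>a\<in>set ?l. fst a < k" and e: "eval_word X T v = nf ?l" using Cons by auto
    have "\<forall>b\<in>set (syl_step q a ?l). fst b < k"
      using tail[OF l] Cons.prems by (auto simp: syl_step_def add_exp_def put_def)
    moreover have "nf (syl_step q a ?l) = eval_word X T (a # v)"
      using Cons.prems nf_add[OF _ l] T by (auto simp: syl_step_def eval_word_Cons e int_pow_neg)
    ultimately show ?case by simp
  qed (simp add: nf_simps)
  then show ?thesis using w by (simp add: free_product_kernel_def nf_simps)
qed

text \<open>A word that fixes the empty normal form fixes all of them: apply the universal property
  to the group generated by the action itself.\<close>

theorem free_product_marked_group:
  "\<exists>(G :: nat monoid) S. marked_group G S \<and> length S = k \<and> word_kernel G S = free_product_kernel q k"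
proof -
  let ?D = "Collect (syl_valid q k)"
  have "\<exists>(G :: nat monoid) S. marked_group G S \<and> length S = k \<and>
    word_kernel G S = {w \<in> words k. \<forall>x\<in>?D. (foldr (syl_step q) w x, x) \<in> Id_on ?D}"
  proof (rule marked_group_of_action)
    show "equiv ?D (Id_on ?D)" by (auto simp: equiv_def refl_on_def sym_def trans_def)
    show closed: "syl_step q a x \<in> ?D" if "fst a < k" "x \<in> ?D" for a x
      using that by (simp add: syl_step_def syl_valid_add_exp)
    show "(syl_step q a x, syl_step q a y) \<in> Id_on ?D" if "fst a < k" "(x, y) \<in> Id_on ?D" for a x y
      using that closed unfolding Id_on_iff by blast
    show "(syl_step q (i, \<not> b) (syl_step q (i, b) x), x) \<in> Id_on ?D" if "i < k" "x \<in> ?D" for i b x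
      using that add_exp_add_exp[of q k x i] add_exp_trivial[of q k x i 0]
      by (auto simp: syl_step_def Id_on_iff syl_valid_add_exp)
  qed
  then obtain G :: "nat monoid" and S where G: "marked_group G S" "length S = k"
    and ker: "word_kernel G S = {w \<in> words k. \<forall>x\<in>?D. (foldr (syl_step q) w x, x) \<in> Id_on ?D}" by blast
  interpret G: group G using G by (simp add: marked_group_def)
  have fix_ker: "w \<in> word_kernel G S" if "w \<in> words k" "\<And>x. x \<in> ?D \<Longrightarrow> foldr (syl_step q) w x = x" for w
    unfolding ker using that by (auto simp: Id_on_iff)
  have SG: "set S \<subseteq> carrier G" by (rule marked_groupD(2)[OF G(1)])
  have tors: "(S ! y) [^]\<^bsub>G\<^esub> (q y) = \<one>\<^bsub>G\<^esub>" if y: "y < k" for y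
  proof -
    have Sy: "S ! y \<in> carrier G" using SG y G(2) by (auto simp: subset_iff)
    have "S ! y \<otimes>\<^bsub>G\<^esub> (S ! y) [^]\<^bsub>G\<^esub> n = (S ! y) [^]\<^bsub>G\<^esub> n \<otimes>\<^bsub>G\<^esub> S ! y" for n :: nat
      by (metis G.nat_pow_Suc G.nat_pow_Suc2 Sy)
    then have pow: "eval_word G S (replicate n (y, True)) = (S ! y) [^]\<^bsub>G\<^esub> n" for n
      by (induction n) (auto simp: eval_word_Cons)
    have rw: "replicate n (y, True) \<in> words k" for n using y by (induction n) auto
    have "foldr (syl_step q) (replicate (nat \<bar>q y\<bar>) (y, True)) x = x" if "x \<in> ?D" for x
      using that syl_step_replicate[of q k x y] y add_exp_trivial[of q k x y "\<bar>q y\<bar>"] by simp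
    then have "replicate (nat \<bar>q y\<bar>) (y, True) \<in> word_kernel G S" using fix_ker rw by blast
    then have "(S ! y) [^]\<^bsub>G\<^esub> \<bar>q y\<bar> = \<one>\<^bsub>G\<^esub>"
      using pow[of "nat \<bar>q y\<bar>"] int_pow_int[of G "S ! y" "nat \<bar>q y\<bar>"] by (simp add: word_kernel_def)
    then show ?thesis using Sy by (cases "q y \<ge> 0") (auto simp: G.int_pow_neg)
  qed
  have "word_kernel G S = free_product_kernel q k"
  proof (intro equalityI subsetI)
    fix w assume "w \<in> word_kernel G S"
    moreover have "[] \<in> ?D" by (simp add: syl_valid_def)
    ultimately show "w \<in> free_product_kernel q k" unfolding ker free_product_kernel_def by fastforce
  next
    fix w assume w: "w \<in> free_product_kernel q k"
    have "eval_word G S w = \<one>\<^bsub>G\<^esub>"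
      by (rule free_product_universal[OF G.is_group SG G(2) tors w])
    then show "w \<in> word_kernel G S" using w G(2) by (simp add: word_kernel_def free_product_kernel_def)
  qed
  then show ?thesis using G by blast
qed

lemma mod_nonzero_if_small:
  fixes e :: int assumes "e \<noteq> 0" "\<bar>e\<bar> < m \<or> m = 0" shows "e mod m \<noteq> 0"
  using assms zdvd_not_zless[of "\<bar>e\<bar>" m] by (auto simp: mod_eq_0_iff_dvd)

text \<open>Both computations of the normal form run in parallel. Where the orders differ,
  corresponding exponents are residues of one integer \<open>x\<close>, bounded by the number of
  steps and so smaller than any finite order; it vanishes in both groups or in neither.\<close>

lemma free_product_kernel_local:
  fixes q q' :: "nat \<Rightarrow> int"
  assumes w: "w \<in> free_product_kernel q k"
    and qq: "\<And>y. y < k \<Longrightarrow> q y = q' y \<or>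
      ((q y = 0 \<or> int (length w) < q y) \<and> (q' y = 0 \<or> int (length w) < q' y))"
  shows "w \<in> free_product_kernel q' k"
proof -
  define ex where "ex y n e e' \<longleftrightarrow> (q y = q' y \<and> e = e') \<or>
    (q y \<noteq> q' y \<and> (\<exists>x. \<bar>x\<bar> \<le> n \<and> e = x mod q y \<and> e' = x mod q' y))" for y n and e e' :: int
  define rel where "rel n = list_all2 (\<lambda>(y, e) (y', e'). y = y' \<and> ex y n e e')" for n
  have rel_mono: "rel m l l'" if "rel n l l'" "n \<le> m" for n m l l'
    using that(1) unfolding rel_def
    by (rule list_all2_mono) (use that(2) in \<open>fastforce simp: ex_def\<close>)
  have zero: "ex y n 0 0" if "0 \<le> n" for y n
    using that by (cases "q y = q' y") (auto simp: ex_def intro!: exI[of _ 0])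
  have head: "ex y n (head_exp y l) (head_exp y l')" if "rel n l l'" "0 \<le> n" for y n l l'
    using that by (cases l; cases l') (auto simp: rel_def head_exp_def zero)
  have tail: "rel n (tail_after y l) (tail_after y l')" if "rel n l l'" for y n l l'
    using that by (cases l; cases l') (auto simp: rel_def tail_after_def)
  have step: "rel (n + 1) (add_exp q y s l) (add_exp q' y s l')"
    if r: "rel n l l'" and n: "0 \<le> n" "n + 1 \<le> int (length w)" and s: "\<bar>s\<bar> = 1" and y: "y < k" for n y s l l'
  proof -
    let ?h = "head_exp y l" and ?h' = "head_exp y l'"
    have t: "rel (n + 1) (tail_after y l) (tail_after y l')" using rel_mono[OF tail[OF r]] by simp
    show ?thesis
    proof (cases "q y = q' y")
      case True
      then have "?h = ?h'" using head[OF r n(1), of y] by (auto simp: ex_def)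
      then show ?thesis using t True by (auto simp: add_exp_def put_def rel_def ex_def)
    next
      case False
      then obtain x where x: "\<bar>x\<bar> \<le> n" "?h = x mod q y" "?h' = x mod q' y"
        using head[OF r n(1), of y] by (auto simp: ex_def)
      have m: "(?h + s) mod q y = (x + s) mod q y" "(?h' + s) mod q' y = (x + s) mod q' y"
        unfolding x by (simp_all add: mod_add_left_eq)
      have small: "\<bar>x + s\<bar> \<le> n + 1" using x(1) s by linarith
      show ?thesis
      proof (cases "x + s = 0")
        case True
        then show ?thesis using t by (simp add: add_exp_def put_def m)
      next
        case nz: False
        have "(x + s) mod q y \<noteq> 0" "(x + s) mod q' y \<noteq> 0"
          using qq[OF y] False small n(2) by (intro mod_nonzero_if_small nz; linarith)+
        moreover have "ex y (n + 1) ((x + s) mod q y) ((x + s) mod q' y)"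
          using False small by (auto simp: ex_def)
        ultimately show ?thesis using t by (simp add: add_exp_def put_def m rel_def)
      qed
    qed
  qed
  have "rel (int (length v)) (foldr (syl_step q) v []) (foldr (syl_step q') v [])"
    if "v \<in> words k" "length v \<le> length w" for v
    using that
  proof (induction v)
    case (Cons a v)
    then show ?case
      using step[of "int (length v)" _ _ "if snd a then 1 else - 1" "fst a"]
      by (simp add: syl_step_def add.commute)
  qed (simp add: rel_def)
  from this[of w] show ?thesis using w by (simp add: free_product_kernel_def rel_def)
qed

section \<open>Finite groups: the lower bound\<close>

theorem Lim_desc_le_Res_finite:
  fixes \<C> :: "'h monoid set"
  assumes \<theta>: "word_enumeration \<theta>" and \<C>: "\<And>H. H \<in> \<C> \<Longrightarrow> group H \<and> finite (carrier H)"
    and fin: "finite_up_to_iso \<C>" and H0: "H0 \<in> \<C>" "carrier H0 \<noteq> {\<one>\<^bsub>H0\<^esub>}"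
  shows "Lim_desc natLeq f \<le>\<^sub>W Res \<theta> \<C>"
proof -
  obtain \<D> where \<D>: "\<D> \<subseteq> \<C>" "finite \<D>" "\<And>G. G \<in> \<C> \<Longrightarrow> \<exists>H\<in>\<D>. G \<cong> H"
    using fin by (auto simp: finite_up_to_iso_def)
  \<comment> \<open>A common multiple of the orders of all groups in the class.\<close>
  define m where "m = (\<Prod>H\<in>\<D>. card (carrier H))"
  have grp: "group H" if "H \<in> \<C>" for H using \<C> that by blast
  have "0 < card (carrier H)" if "H \<in> \<C>" for H
    using \<C>[OF that] monoid.one_closed[OF group.is_monoid, of H] by (auto simp: card_gt_0_iff)
  then have m_pos: "0 < m" unfolding m_def using \<D>(1) by (intro prod_pos) auto
  have order_dvd: "order H dvd m" if H: "H \<in> \<C>" for H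
  proof -
    obtain K where K: "K \<in> \<D>" "H \<cong> K" using \<D>(3) H by blast
    then have "order H = card (carrier K)" by (simp add: iso_same_card order_def)
    then show ?thesis unfolding m_def using dvd_prodI[OF \<D>(2) K(1), of "\<lambda>H. card (carrier H)"] by simp
  qed
  interpret H0: group H0 using grp[OF H0(1)] .
  obtain hs where hs: "set hs = carrier H0" using \<C>[OF H0(1)] finite_list by blast
  obtain h where h: "h \<in> carrier H0" "h \<noteq> \<one>\<^bsub>H0\<^esub>" using H0(2) H0.one_closed by blast
  obtain j where j: "j < length hs" "hs ! j = h" using h(1) hs by (metis in_set_conv_nth)
  \<comment> \<open>The extra generators have infinite order and can be mapped onto all of
    \<open>H0\<close>, which makes a map into \<open>H0\<close> surjective whatever the first
    \<open>b\<close> generators do.\<close>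
  define k where "k b = b + length hs" for b
  \<comment> \<open>Congruent to 1 modulo \<open>m\<close>, hence prime to the order of every
    element of a group in the class, and longer than the first words up to index
    \<open>n\<close>.\<close>
  define Q where "Q b n = int (1 + m * (\<Sum>i\<le>n. length (\<theta> (k b) i)))" for b n
  \<comment> \<open>Generator \<open>y\<close> receives its finite order at the first stage where
    the sequence is at most \<open>y\<close>; the generators below the limit keep infinite
    order.\<close>
  define q where "q \<alpha> y = (if y < \<alpha> 0 \<and> (\<exists>n. \<alpha> n \<le> y) then Q (\<alpha> 0) (LEAST n. \<alpha> n \<le> y) else 0)"
    for \<alpha> :: "nat \<Rightarrow> nat" and y
  \<comment> \<open>Generator \<open>c - 1\<close> dies exactly if the sequence falls below
    \<open>c\<close>. At \<open>c = 0\<close> no drop is possible, and the generator that can be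
    sent to \<open>h\<close> serves as a word that always survives.\<close>
  define \<tau> where "\<tau> b c = (if c = 0 then [(b + j, True)] else [(c - 1, True)])" for b c :: nat
  have Q_large: "int (length (\<theta> (k b) i)) < Q b n" if "i \<le> n" for b i n
  proof -
    have "length (\<theta> (k b) i) \<le> (\<Sum>i\<le>n. length (\<theta> (k b) i))"
      using that by (intro member_le_sum) auto
    also have "\<dots> \<le> m * (\<Sum>i\<le>n. length (\<theta> (k b) i))" using m_pos by simp
    finally show ?thesis unfolding Q_def by linarith
  qed
  show ?thesis
  proof (rule Lim_desc_le_Res[where k = k and N = "\<lambda>\<alpha>. free_product_kernel (q \<alpha>) (k (\<alpha> 0))" and \<tau> = \<tau>])
    show "word_enumeration \<theta>" by fact
    show "group H" if "H \<in> \<C>" for H using grp that .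
    show "Well_order natLeq" by (rule natLeq_Well_order)
    show "\<exists>(G :: nat monoid) S. marked_group G S \<and> length S = k (\<alpha> 0) \<and>
      word_kernel G S = free_product_kernel (q \<alpha>) (k (\<alpha> 0))" for \<alpha>
      by (rule free_product_marked_group)
  next
    fix \<alpha> \<beta> :: "nat \<Rightarrow> nat" and n
    assume eq: "\<And>i. i \<le> n \<Longrightarrow> \<beta> i = \<alpha> i"
      and w: "\<theta> (k (\<alpha> 0)) n \<in> free_product_kernel (q \<alpha>) (k (\<alpha> 0))"
    let ?w = "\<theta> (k (\<alpha> 0)) n"
    have 0: "\<beta> 0 = \<alpha> 0" using eq by simp
    \<comment> \<open>Orders fixed by stage \<open>n\<close> depend only on the common prefix of the
      sequences; all other orders are infinite or exceed the length of the word.\<close>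
    have late: "q \<gamma> y = 0 \<or> int (length ?w) < q \<gamma> y" if "\<gamma> 0 = \<alpha> 0" "\<not> (\<exists>i\<le>n. \<gamma> i \<le> y)" for \<gamma> y
    proof (cases "\<exists>i. \<gamma> i \<le> y")
      case True
      then have "\<gamma> (LEAST i. \<gamma> i \<le> y) \<le> y" by (rule LeastI_ex)
      then have "n \<le> (LEAST i. \<gamma> i \<le> y)" using that(2) by (meson nle_le)
      then show ?thesis using Q_large that(1) by (auto simp: q_def)
    qed (simp add: q_def)
    have early: "q \<beta> y = q \<alpha> y" if "\<exists>i\<le>n. \<alpha> i \<le> y" for y
    proof -
      from that obtain i where i: "i \<le> n" "\<alpha> i \<le> y" by (elim exE conjE)
      define l where "l = (LEAST i. \<alpha> i \<le> y)"
      have l1: "\<alpha> l \<le> y" unfolding l_def using i(2) by (rule LeastI)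
      have l_le: "l \<le> i'" if "\<alpha> i' \<le> y" for i' unfolding l_def using that by (rule Least_le)
      have l2: "l \<le> n" using l_le[OF i(2)] i(1) by simp
      have "(LEAST i. \<beta> i \<le> y) = l"
      proof (rule Least_equality)
        show "\<beta> l \<le> y" using l1 eq[OF l2] by simp
        fix i' assume i': "\<beta> i' \<le> y"
        show "l \<le> i'"
        proof (cases "i' \<le> n")
          case True
          then show ?thesis using l_le i' eq[OF True] by simp
        qed (use l2 in simp)
      qed
      moreover have "\<exists>i. \<beta> i \<le> y" "\<exists>i. \<alpha> i \<le> y" using l1 eq[OF l2] by metis+
      ultimately show ?thesis by (simp add: q_def l_def 0)
    qed
    have "\<theta> (k (\<alpha> 0)) n \<in> free_product_kernel (q \<beta>) (k (\<alpha> 0))"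
    proof (rule free_product_kernel_local[OF w])
      fix y
      show "q \<alpha> y = q \<beta> y \<or> (q \<alpha> y = 0 \<or> int (length ?w) < q \<alpha> y) \<and> (q \<beta> y = 0 \<or> int (length ?w) < q \<beta> y)"
        using early[of y] late[of \<alpha> y] late[of \<beta> y] 0 eq by (cases "\<exists>i\<le>n. \<alpha> i \<le> y") auto
    qed
    then show "\<theta> (k (\<alpha> 0)) n \<in> free_product_kernel (q \<beta>) (k (\<beta> 0))" by (simp add: 0)
  next
    fix \<alpha> :: "nat \<Rightarrow> nat" and n
    assume desc: "\<And>n. (\<alpha> (Suc n), \<alpha> n) \<in> natLeq"
    have dec: "\<alpha> b \<le> \<alpha> a" if "a \<le> b" for a b
      using that by (rule lift_Suc_antimono_le[of \<alpha>, rotated]) (use desc in \<open>simp add: natLeq_def\<close>)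
    let ?N = "free_product_kernel (q \<alpha>) (k (\<alpha> 0))" and ?t = "\<tau> (\<alpha> 0) (\<alpha> n)"
    have tw: "?t \<in> words (k (\<alpha> 0))" using dec[of 0 n] j(1) by (auto simp: \<tau>_def k_def)
    have "?t \<notin> res_words \<C> (k (\<alpha> 0)) ?N" if stable: "\<forall>m\<ge>n. \<alpha> m = \<alpha> n"
    proof
      assume t: "?t \<in> res_words \<C> (k (\<alpha> 0)) ?N"
      have least: "\<alpha> n \<le> \<alpha> i" for i
        using dec[of i "max i n"] stable[rule_format, of "max i n"] by simp
      define T where "T = map (\<lambda>y. if y < \<alpha> n then h else \<one>\<^bsub>H0\<^esub>) [0..<\<alpha> 0] @ hs"
      have T: "length T = k (\<alpha> 0)" "set T = carrier H0" using h hs by (auto simp: T_def k_def)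
      have "generate H0 (set T) = carrier H0"
        unfolding T(2) using H0.generate_incl[of "carrier H0"] by (auto intro: generate.incl)
      then have mT: "marked_group H0 T" using T(2) by (simp add: marked_group_def H0.is_group)
      have tors: "(T ! y) [^]\<^bsub>H0\<^esub> (q \<alpha> y) = \<one>\<^bsub>H0\<^esub>" if "y < k (\<alpha> 0)" for y
      proof (cases "q \<alpha> y = 0")
        case False
        then obtain i where i: "y < \<alpha> 0" "\<alpha> i \<le> y" by (auto simp: q_def split: if_splits)
        then have "T ! y = \<one>\<^bsub>H0\<^esub>" using least[of i] by (simp add: T_def nth_append)
        then show ?thesis by simp
      qed simp
      have "\<forall>v\<in>?N. eval_word H0 T v = \<one>\<^bsub>H0\<^esub>"
        using free_product_universal[OF H0.is_group _ T(1) tors] T(2) by blast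
      then have "eval_word H0 T ?t = \<one>\<^bsub>H0\<^esub>"
        using t mT T(1) H0(1) by (auto simp: res_words_def)
      moreover have "eval_word H0 T ?t = h"
      proof -
        have "eval_word H0 T [(i, True)] = T ! i" if "i < k (\<alpha> 0)" for i
          using H0.eval_word_single[of T i True] T that by simp
        then show ?thesis using j dec[of 0 n] by (auto simp: \<tau>_def k_def T_def nth_append)
      qed
      ultimately show False using h(2) by simp
    qed
    moreover have "?t \<in> res_words \<C> (k (\<alpha> 0)) ?N" if m': "m' \<ge> n" "\<alpha> m' \<noteq> \<alpha> n" for m'
    proof -
      have less: "\<alpha> m' < \<alpha> n" using dec[OF m'(1)] m'(2) by simp
      define y where "y = \<alpha> n - 1"
      have y: "\<alpha> m' \<le> y" "y < \<alpha> 0" "?t = [(y, True)]" "y < k (\<alpha> 0)"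
        using less dec[of 0 n] by (auto simp: y_def \<tau>_def k_def)
      define x where "x = (\<Sum>i\<le>(LEAST n. \<alpha> n \<le> y). length (\<theta> (k (\<alpha> 0)) i))"
      have qy: "q \<alpha> y = int (1 + m * x)" using y by (auto simp: q_def Q_def x_def)
      have rw: "replicate i (y, True) \<in> words (k (\<alpha> 0))" for i using y(4) by (induction i) auto
      have valid: "syl_valid (q \<alpha>) (k (\<alpha> 0)) []" by (simp add: syl_valid_def)
      have "foldr (syl_step (q \<alpha>)) (replicate (1 + m * x) (y, True)) [] = []"
        using syl_step_replicate[OF valid y(4), of "1 + m * x"]
          add_exp_trivial[OF valid, of y "int (1 + m * x)"] qy by simp
      then have inN: "replicate (1 + m * x) (y, True) \<in> ?N"
        unfolding free_product_kernel_def mem_Collect_eq by (rule conjI[OF rw])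
      have "eval_word H T [(y, True)] = \<one>\<^bsub>H\<^esub>"
        if H: "H \<in> \<C>" "length T = k (\<alpha> 0)" "marked_group H T" "\<forall>v\<in>?N. eval_word H T v = \<one>\<^bsub>H\<^esub>" for H T
      proof -
        interpret H: group H using grp H(1) .
        have Ty: "T ! y \<in> carrier H" using marked_groupD(2)[OF H(3)] y(4) H(2) by (auto simp: subset_iff)
        have pow: "eval_word H T (replicate i (y, True)) = (T ! y) [^]\<^bsub>H\<^esub> i" for i
        proof (induction i)
          case (Suc i)
          then show ?case using H.nat_pow_Suc2[OF Ty, of i] by (simp add: eval_word_Cons del: H.nat_pow_Suc)
        qed simp
        have "H.ord (T ! y) dvd 1 + m * x" using H(4) inN pow H.pow_eq_id[OF Ty] by metis
        moreover have "H.ord (T ! y) dvd m * x"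
          using H.ord_dvd_group_order[OF Ty] order_dvd[OF H(1)] by (meson dvd_mult2 dvd_trans)
        ultimately have "H.ord (T ! y) dvd 1" using dvd_add_left_iff by blast
        then have "T ! y = \<one>\<^bsub>H\<^esub>" using H.ord_eq_1[OF Ty] by simp
        then show ?thesis by (simp add: eval_word_Cons)
      qed
      then show ?thesis using y(3) tw by (auto simp: res_words_def)
    qed
    ultimately show "?t \<in> words (k (\<alpha> 0)) \<and> (?t \<notin> res_words \<C> (k (\<alpha> 0)) ?N \<longleftrightarrow> (\<forall>m\<ge>n. \<alpha> m = \<alpha> n))"
      using tw by blast
  qed
qed

section \<open>Perturbed wreath products\<close>

text \<open>Letter \<open>0\<close> is the shift, the letters \<open>1, \<dots>, 125\<close> encode the triples \<open>(a, b, c)\<close> of points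
  in base 5 (as the identity unless the points are distinct), and letter \<open>126 + i\<close> is the \<open>i\<close>-th
  affine map.\<close>

definition cyc :: "nat \<Rightarrow> nat \<Rightarrow> nat \<Rightarrow> nat \<Rightarrow> nat" where
  "cyc a b c s = (if s = a then b else if s = b then c else if s = c then a else s)"

definition cyc_perm :: "nat \<Rightarrow> bool \<Rightarrow> nat \<Rightarrow> nat" where
  "cyc_perm j b = (let a = j mod 5; a' = j div 5 mod 5; a'' = j div 25 mod 5 in
     if a \<noteq> a' \<and> a \<noteq> a'' \<and> a' \<noteq> a'' then if b then cyc a a' a'' else cyc a'' a' a else id)"

definition cyc_index :: "nat \<Rightarrow> nat \<Rightarrow> nat \<Rightarrow> nat" where
  "cyc_index a b c = 1 + a + 5 * b + 25 * c"

lemma cyc_perm_inverse: "cyc_perm j (\<not> b) (cyc_perm j b s) = s"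
  by (auto simp: cyc_perm_def cyc_def Let_def)

lemma cyc_perm_outside: "5 \<le> s \<Longrightarrow> cyc_perm j b s = s"
proof -
  assume "5 \<le> s"
  then have "s \<noteq> x mod 5" for x :: nat using mod_less_divisor[of 5 x] by linarith
  then show ?thesis by (simp add: cyc_perm_def cyc_def Let_def)
qed

lemma cyc_perm_index:
  assumes "a < 5" "b < 5" "c < 5" "a \<noteq> b" "a \<noteq> c" "b \<noteq> c"
  shows "cyc_perm (cyc_index a b c - 1) True = cyc a b c"
    "cyc_perm (cyc_index a b c - 1) False = cyc c b a"
proof -
  have e: "cyc_index a b c - 1 = a + 5 * (b + 5 * c)" by (simp add: cyc_index_def)
  have "(cyc_index a b c - 1) mod 5 = a" unfolding e mod_mult_self2 using assms by simp
  moreover have "(cyc_index a b c - 1) div 5 = b + 5 * c"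
    unfolding e by (subst div_mult_self2) (use assms in simp_all)
  moreover have "(cyc_index a b c - 1) div 25 = (cyc_index a b c - 1) div 5 div 5"
    by (simp flip: div_mult2_eq)
  ultimately show "cyc_perm (cyc_index a b c - 1) True = cyc a b c"
    "cyc_perm (cyc_index a b c - 1) False = cyc c b a"
    using assms by (simp_all add: cyc_perm_def Let_def)
qed

lemma cyc_index_bounds: "a < 5 \<Longrightarrow> b < 5 \<Longrightarrow> c < 5 \<Longrightarrow> 0 < cyc_index a b c \<and> cyc_index a b c \<le> 125"
  by (simp add: cyc_index_def)

type_synonym point = "int \<times> nat"

text \<open>Second coordinates from 5 on are fixed by all 3-cycles and meet no translation, so a
  point such as \<open>(0, 5)\<close> exhibits the linear part of a word.\<close>

definition pos :: "nat \<times> bool \<Rightarrow> point \<Rightarrow> point" where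
  "pos a p = (if fst a = 0 then (if snd a then fst p + 1 else fst p - 1, snd p)
     else if fst a \<le> 125 \<and> fst p = 0 then (0, cyc_perm (fst a - 1) (snd a) (snd p)) else p)"

definition bump :: "int \<Rightarrow> point \<Rightarrow> 'm \<Rightarrow> 'm::ab_group_add" where
  "bump c p x = (if p = (c, 0) then x else if p = (c, 1) then - x else 0)"

definition shift_of :: "nat \<times> bool \<Rightarrow> int" where
  "shift_of a = (if fst a = 0 then if snd a then 1 else - 1 else 0)"

lemma pos_inverse: "pos (i, \<not> b) (pos (i, b) p) = p"
  by (auto simp: pos_def cyc_perm_inverse prod_eq_iff) (metis cyc_perm_inverse)+

lemma fst_foldr_pos: "fst (foldr pos w p) = fst p + (\<Sum>a\<leftarrow>w. shift_of a)"
  by (induction w) (auto simp: pos_def shift_of_def)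

lemma abs_sum_shift_of: "\<bar>\<Sum>a\<leftarrow>w. shift_of a\<bar> \<le> int (length w)"
  by (induction w) (auto simp: shift_of_def)

lemma snd_foldr_pos_outside: "5 \<le> snd p \<Longrightarrow> snd (foldr pos w p) = snd p"
  by (induction w) (auto simp: pos_def cyc_perm_outside)

text \<open>Each letter shifts by at most one, so level 0, the only one where 3-cycles act, is out
  of reach.\<close>

lemma foldr_pos_positive:
  "int (length w) < fst p \<Longrightarrow> foldr pos w p = (fst p + (\<Sum>a\<leftarrow>w. shift_of a), snd p)"
proof (induction w)
  case (Cons a w)
  have "foldr pos w p = (fst p + (\<Sum>a\<leftarrow>w. shift_of a), snd p)" using Cons by simp
  then have "foldr pos (a # w) p = pos a (fst p + (\<Sum>a\<leftarrow>w. shift_of a), snd p)" by simp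
  moreover have "fst p + (\<Sum>a\<leftarrow>w. shift_of a) > 0" using abs_sum_shift_of[of w] Cons.prems by simp
  then have "pos a (fst p + (\<Sum>a\<leftarrow>w. shift_of a), snd p) = (fst p + (\<Sum>a\<leftarrow>a # w. shift_of a), snd p)"
    by (auto simp: pos_def shift_of_def[of a])
  ultimately show ?case by (rule trans)
qed simp

text \<open>\<open>\<phi> i\<close> and \<open>m i\<close> are the linear part and the translation
  of letter \<open>126 + i\<close>; the invariant subgroups \<open>K a\<close> are used as
  congruences, without forming quotients.\<close>

locale perturbation =
  fixes \<phi> \<phi>' :: "nat \<Rightarrow> 'm \<Rightarrow> 'm::ab_group_add" and m :: "nat \<Rightarrow> 'm" and K :: "'o \<Rightarrow> 'm set"
  assumes \<phi>_add: "\<phi> i (x + y) = \<phi> i x + \<phi> i y"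
    and \<phi>_inverse: "\<phi> i (\<phi>' i x) = x" "\<phi>' i (\<phi> i x) = x"
    and K_zero: "0 \<in> K a" and K_diff: "x \<in> K a \<Longrightarrow> y \<in> K a \<Longrightarrow> x - y \<in> K a"
    and K_\<phi>: "x \<in> K a \<Longrightarrow> \<phi> i x \<in> K a" and K_\<phi>': "x \<in> K a \<Longrightarrow> \<phi>' i x \<in> K a"
begin

lemma \<phi>'_add: "\<phi>' i (x + y) = \<phi>' i x + \<phi>' i y"
  by (metis \<phi>_add \<phi>_inverse)

lemma \<phi>_zero [simp]: "\<phi> i 0 = 0" "\<phi>' i 0 = 0"
  using \<phi>_add[of i 0 0] \<phi>'_add[of i 0 0] by simp_all

lemma \<phi>_minus: "\<phi> i (- x) = - \<phi> i x" "\<phi>' i (- x) = - \<phi>' i x"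
  using \<phi>_add[of i x "- x"] \<phi>'_add[of i x "- x"] by (simp_all add: eq_neg_iff_add_eq_0 add.commute)

lemma \<phi>_diff: "\<phi> i (x - y) = \<phi> i x - \<phi> i y" "\<phi>' i (x - y) = \<phi>' i x - \<phi>' i y"
  using \<phi>_add[of i x "- y"] \<phi>'_add[of i x "- y"] by (simp_all add: \<phi>_minus)

lemma K_minus: "x \<in> K a \<Longrightarrow> - x \<in> K a"
  using K_diff[OF K_zero, of x a] by simp

lemma K_add: "x \<in> K a \<Longrightarrow> y \<in> K a \<Longrightarrow> x + y \<in> K a"
  using K_diff[of x a "- y"] K_minus by simp

text \<open>The parameter \<sigma> says how the translation is felt: \<open>id\<close> in the affine
  group, \<open>bump c p\<close> above a point, and 0 for the linear part alone.\<close>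

definition aff :: "('m \<Rightarrow> 'm) \<Rightarrow> nat \<times> bool \<Rightarrow> 'm \<Rightarrow> 'm" where
  "aff \<sigma> a \<mu> = (if fst a \<le> 125 then \<mu>
     else if snd a then \<phi> (fst a - 126) \<mu> + \<sigma> (m (fst a - 126))
     else \<phi>' (fst a - 126) (\<mu> - \<sigma> (m (fst a - 126))))"

abbreviation lin :: "nat \<times> bool \<Rightarrow> 'm \<Rightarrow> 'm" where
  "lin \<equiv> aff (\<lambda>_. 0)"

lemma aff_inverse: "aff \<sigma> (i, \<not> b) (aff \<sigma> (i, b) \<mu>) = \<mu>"
  by (auto simp: aff_def \<phi>_inverse)

lemma lin_add: "lin a (x + y) = lin a x + lin a y"
  by (simp add: aff_def \<phi>_add \<phi>'_add)

lemma aff_eq: "aff \<sigma> a \<mu> = lin a \<mu> + aff \<sigma> a 0"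
  by (auto simp: aff_def \<phi>_diff \<phi>_minus)

lemma aff_diff: "aff \<sigma> a \<mu> - aff \<sigma> a \<nu> = lin a (\<mu> - \<nu>)"
  by (auto simp: aff_def \<phi>_diff)

lemma K_lin: "x \<in> K b \<Longrightarrow> lin a x \<in> K b"
  by (simp add: aff_def K_\<phi> K_\<phi>')

lemma foldr_aff_eq: "foldr (aff \<sigma>) w \<mu> = foldr lin w \<mu> + foldr (aff \<sigma>) w 0"
proof (induction w)
  case (Cons a w)
  have "foldr (aff \<sigma>) (a # w) \<mu> = lin a (foldr (aff \<sigma>) w \<mu>) + aff \<sigma> a 0"
    using aff_eq[of \<sigma> a "foldr (aff \<sigma>) w \<mu>"] by simp
  also have "\<dots> = lin a (foldr lin w \<mu>) + (lin a (foldr (aff \<sigma>) w 0) + aff \<sigma> a 0)"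
    by (subst Cons) (simp add: lin_add)
  also have "lin a (foldr (aff \<sigma>) w 0) + aff \<sigma> a 0 = foldr (aff \<sigma>) (a # w) 0"
    using aff_eq[of \<sigma> a "foldr (aff \<sigma>) w 0"] by simp
  finally show ?case by simp
qed simp

text \<open>The action on the component whose centre is \<open>c\<close>: the affine letters translate only above the
  points \<open>(c, 0)\<close> and \<open>(c, 1)\<close>, with opposite signs, whereas the 3-cycles move only the points
  \<open>(0, _)\<close>. Words that are short compared with \<open>c\<close> do not see the 3-cycles act on the centre.\<close>

primrec aw :: "int \<Rightarrow> word \<Rightarrow> point \<Rightarrow> 'm \<Rightarrow> 'm" where
  "aw c [] p \<mu> = \<mu>"
| "aw c (a # w) p \<mu> = aff (bump c (foldr pos w p)) a (aw c w p \<mu>)"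

definition holds :: "int \<Rightarrow> 'm set \<Rightarrow> word \<Rightarrow> bool" where
  "holds c L w \<longleftrightarrow> (\<forall>p \<mu>. foldr pos w p = p \<and> aw c w p \<mu> - \<mu> \<in> L)"

lemma aw_append: "aw c (v @ w) p \<mu> = aw c v (foldr pos w p) (aw c w p \<mu>)"
  by (induction v) auto

lemma aw_outside: "5 \<le> snd p \<Longrightarrow> aw c w p \<mu> = foldr lin w \<mu>"
proof (induction w)
  case (Cons a w)
  have "bump c (foldr pos w p) = (\<lambda>_. 0 :: 'm)"
    using snd_foldr_pos_outside[OF Cons.prems, of w] Cons.prems by (auto simp: bump_def fun_eq_iff)
  then show ?case using Cons by simp
qed simp

lemma aw_far: "int (length w) < \<bar>fst p - c\<bar> \<Longrightarrow> aw c w p \<mu> = foldr lin w \<mu>"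
proof (induction w)
  case (Cons a w)
  have "fst (foldr pos w p) \<noteq> c"
    using fst_foldr_pos[of w p] abs_sum_shift_of[of w] Cons.prems by auto
  then have "bump c (foldr pos w p) = (\<lambda>_. 0 :: 'm)" by (auto simp: bump_def fun_eq_iff)
  then show ?case using Cons by simp
qed simp

lemma aw_shift:
  "int (length w) < z \<Longrightarrow> int (length w) < z + (c' - c) \<Longrightarrow> aw c w (z, s) \<mu> = aw c' w (z + (c' - c), s) \<mu>"
proof (induction w)
  case (Cons a w)
  have "foldr pos w (z, s) = (z + (\<Sum>a\<leftarrow>w. shift_of a), s)"
    "foldr pos w (z + (c' - c), s) = (z + (c' - c) + (\<Sum>a\<leftarrow>w. shift_of a), s)"
    using Cons.prems by (simp_all add: foldr_pos_positive)
  then have "bump c (foldr pos w (z, s)) = (bump c' (foldr pos w (z + (c' - c), s)) :: 'm \<Rightarrow> 'm)"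
    by (auto simp: bump_def fun_eq_iff)
  then show ?case using Cons by simp
qed simp

text \<open>Near a remote centre a short word never reaches level 0 and feels only its position
  relative to the centre; far from the centre it feels only its linear part. Both are independent of
  where the centre is.\<close>

lemma holds_local:
  assumes "holds c L w" "L \<subseteq> L'" "2 * int (length w) < c" "2 * int (length w) < c'"
  shows "holds c' L' w"
  unfolding holds_def
proof (intro allI conjI)
  fix p :: point and \<mu>
  show "foldr pos w p = p" using assms(1) unfolding holds_def by blast
  show "aw c' w p \<mu> - \<mu> \<in> L'"
  proof (cases "int (length w) < \<bar>fst p - c'\<bar>")
    case True
    then have "aw c' w p \<mu> = aw c w (0, 5) \<mu>" by (simp add: aw_far aw_outside)
    moreover have "aw c w (0, 5) \<mu> - \<mu> \<in> L" using assms(1) unfolding holds_def by blast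
    ultimately show ?thesis using assms(2) by auto
  next
    case False
    then have "aw c' w (fst p, snd p) \<mu> = aw c w (fst p + (c - c'), snd p) \<mu>"
      using assms(3,4) by (intro aw_shift) auto
    moreover have "aw c w (fst p + (c - c'), snd p) \<mu> - \<mu> \<in> L"
      using assms(1) unfolding holds_def by blast
    ultimately show ?thesis using assms(2) by auto
  qed
qed

definition actn :: "(nat \<Rightarrow> int) \<Rightarrow> nat \<times> bool \<Rightarrow> nat \<times> point \<times> 'm \<Rightarrow> nat \<times> point \<times> 'm" where
  "actn N a x = (fst x, pos a (fst (snd x)), aff (bump (N (fst x)) (fst (snd x))) a (snd (snd x)))"

lemma foldr_actn: "foldr (actn N) w (n, p, \<mu>) = (n, foldr pos w p, aw (N n) w p \<mu>)"
  by (induction w) (auto simp: actn_def)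

lemma bump_pos: "126 \<le> i \<Longrightarrow> pos (i, b) p = p"
  by (simp add: pos_def)

theorem perturbed_marked_group:
  fixes N :: "nat \<Rightarrow> int"
  shows "\<exists>(G :: nat monoid) S. marked_group G S \<and> length S = k \<and>
    word_kernel G S = {w \<in> words k. \<forall>n. holds (N n) (K (\<alpha> n)) w}"
proof -
  define E where "E = {((n, p :: point, \<mu>), (n', p', \<nu>)). n = n' \<and> p = p' \<and> \<mu> - \<nu> \<in> K (\<alpha> n)}"
  have "\<exists>(G :: nat monoid) S. marked_group G S \<and> length S = k \<and>
    word_kernel G S = {w \<in> words k. \<forall>x\<in>UNIV. (foldr (actn N) w x, x) \<in> E}"
  proof (rule marked_group_of_action)
    have "refl E" by (auto simp: E_def refl_on_def K_zero)
    moreover have "sym E"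
    proof (rule symI)
      fix x y assume "(x, y) \<in> E"
      then show "(y, x) \<in> E" using K_minus by (fastforce simp: E_def)
    qed
    moreover have "trans E"
    proof (rule transI)
      fix x y z assume "(x, y) \<in> E" "(y, z) \<in> E"
      then show "(x, z) \<in> E" using K_add by (fastforce simp: E_def)
    qed
    ultimately show "equiv UNIV E" by (simp add: equiv_def)
    show "(actn N a x, actn N a y) \<in> E" if "(x, y) \<in> E" for a x y
      using that by (auto simp: E_def actn_def aff_diff K_lin)
    show "(actn N (i, \<not> b) (actn N (i, b) x), x) \<in> E" for i b x
    proof -
      have "aff (bump (N (fst x)) (pos (i, b) (fst (snd x)))) (i, \<not> b)
        (aff (bump (N (fst x)) (fst (snd x))) (i, b) (snd (snd x))) = snd (snd x)"
      proof (cases "126 \<le> i")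
        case True
        then show ?thesis by (simp add: bump_pos aff_inverse)
      qed (simp add: aff_def)
      then show ?thesis by (auto simp: E_def actn_def pos_inverse K_zero split: prod.splits)
    qed
  qed auto
  moreover have "(\<forall>x\<in>UNIV. (foldr (actn N) w x, x) \<in> E) \<longleftrightarrow> (\<forall>n. holds (N n) (K (\<alpha> n)) w)" for w
    by (auto simp: E_def foldr_actn holds_def)
  ultimately show ?thesis by simp
qed

text \<open>The quotient that detects surviving test words: shift and 3-cycles become trivial, the
  other letters act affinely modulo \<open>K a\<close>.\<close>

lemma affine_marked_group:
  "\<exists>(G :: nat monoid) S. marked_group G S \<and> length S = k \<and>
    word_kernel G S = {w \<in> words k. \<forall>\<mu>. foldr (aff id) w \<mu> - \<mu> \<in> K a}"
proof -
  define E where "E = {(\<mu>, \<nu>). \<mu> - \<nu> \<in> K a}"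
  have "\<exists>(G :: nat monoid) S. marked_group G S \<and> length S = k \<and>
    word_kernel G S = {w \<in> words k. \<forall>x\<in>UNIV. (foldr (aff id) w x, x) \<in> E}"
  proof (rule marked_group_of_action)
    have "refl E" by (auto simp: E_def refl_on_def K_zero)
    moreover have "sym E"
    proof (rule symI)
      fix x y assume "(x, y) \<in> E"
      then show "(y, x) \<in> E" using K_minus by (fastforce simp: E_def)
    qed
    moreover have "trans E"
    proof (rule transI)
      fix x y z assume "(x, y) \<in> E" "(y, z) \<in> E"
      then show "(x, z) \<in> E" using K_add by (fastforce simp: E_def)
    qed
    ultimately show "equiv UNIV E" by (simp add: equiv_def)
    show "(aff id b x, aff id b y) \<in> E" if "(x, y) \<in> E" for b x y
      using that by (simp add: E_def aff_diff K_lin)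
    show "(aff id (i, \<not> b) (aff id (i, b) x), x) \<in> E" for i b x
      by (simp add: E_def aff_inverse K_zero)
  qed auto
  then show ?thesis by (simp add: E_def)
qed

text \<open>Every translation performed by an affine letter is felt along exactly one of the tracks
  starting at \<open>(z, 0)\<close>, so summing over the levels recovers the translation part in the
  affine group.\<close>

lemma foldr_aff_eq_sum:
  assumes "2 * int L < c" "length w \<le> L"
  shows "foldr (aff id) w 0 = (\<Sum>z\<in>{c - int L..c + int L}. aw c w (z, 0) 0)"
  using assms(2)
proof (induction w)
  case (Cons a w)
  let ?Z = "{c - int L..c + int L}" and ?t = "\<Sum>a\<leftarrow>w. shift_of a"
  have lin_zero: "lin a 0 = 0" by (simp add: aff_def)
  have lin_sum: "lin a (\<Sum>z\<in>A. g z) = (\<Sum>z\<in>A. lin a (g z))" if "finite A" for A and g :: "int \<Rightarrow> 'm"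
    using that by induction (simp_all add: lin_add lin_zero)
  have p: "foldr pos w (z, 0) = (z + ?t, 0)" if "z \<in> ?Z" for z
    using that assms(1) Cons.prems by (subst foldr_pos_positive) auto
  \<comment> \<open>The track from \<open>(z, 0)\<close> stands at the centre just for
    \<open>z = c - ?t\<close>, and with remote centre it stays in the row of sign plus.\<close>
  have b: "aff (bump c (z + ?t, 0)) a 0 = (if z = c - ?t then aff id a 0 else 0)" for z
    by (auto simp: bump_def aff_def)
  have t: "c - ?t \<in> ?Z" using abs_sum_shift_of[of w] Cons.prems by auto
  have "(\<Sum>z\<in>?Z. aw c (a # w) (z, 0) 0) =
    (\<Sum>z\<in>?Z. lin a (aw c w (z, 0) 0) + (if z = c - ?t then aff id a 0 else 0))"
  proof (rule sum.cong)
    fix z assume "z \<in> ?Z"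
    then show "aw c (a # w) (z, 0) 0 = lin a (aw c w (z, 0) 0) + (if z = c - ?t then aff id a 0 else 0)"
      using aff_eq[of "bump c (z + ?t, 0)" a "aw c w (z, 0) 0"] by (simp add: p b)
  qed simp
  also have "\<dots> = lin a (\<Sum>z\<in>?Z. aw c w (z, 0) 0) + aff id a 0"
    using t by (simp add: sum.distrib lin_sum)
  also have "(\<Sum>z\<in>?Z. aw c w (z, 0) 0) = foldr (aff id) w 0"
    by (rule Cons.IH[symmetric]) (use Cons.prems in simp)
  also have "lin a (foldr (aff id) w 0) + aff id a 0 = aff id a (foldr (aff id) w 0)"
    by (rule aff_eq[symmetric])
  also have "\<dots> = foldr (aff id) (a # w) 0" by simp
  finally show ?case by (rule sym)
qed simp

lemma K_sum: "finite A \<Longrightarrow> (\<And>z. z \<in> A \<Longrightarrow> g z \<in> K a) \<Longrightarrow> (\<Sum>z\<in>A. g z) \<in> K a"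
  by (induction rule: finite_induct) (auto simp: K_zero K_add)

text \<open>One component with a remote centre suffices: the translation part is a sum of elements
  of \<open>K a\<close>, and the linear part is read off at a point with second coordinate
  5.\<close>

lemma holds_imp_affine:
  assumes h: "holds c (K a) w" and c: "2 * int (length w) < c"
  shows "foldr (aff id) w \<mu> - \<mu> \<in> K a"
proof -
  have "aw c w (z, 0) 0 \<in> K a" for z using h unfolding holds_def by (metis diff_zero)
  then have "foldr (aff id) w 0 \<in> K a" unfolding foldr_aff_eq_sum[OF c order_refl] by (intro K_sum) auto
  moreover have "foldr lin w \<mu> - \<mu> \<in> K a"
    using h aw_outside[of "(0, 5)" c w \<mu>] unfolding holds_def by (metis order_refl snd_conv)
  moreover have "foldr (aff id) w \<mu> - \<mu> = (foldr lin w \<mu> - \<mu>) + foldr (aff id) w 0"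
    by (subst foldr_aff_eq) simp
  ultimately show ?thesis using K_add by metis
qed

end

section \<open>Three-cycles and level-wise translations\<close>

definition three_cycle_relations :: "'h monoid \<Rightarrow> (nat \<Rightarrow> nat \<Rightarrow> nat \<Rightarrow> 'h) \<Rightarrow> bool" where
  "three_cycle_relations H g \<longleftrightarrow> (\<forall>a b c. g a b c \<in> carrier H) \<and>
     (\<forall>a b c d e. distinct [a, b, c, d, e] \<longrightarrow> {a, b, c, d, e} \<subseteq> {..<5} \<longrightarrow>
       g a b c = g a b d \<otimes>\<^bsub>H\<^esub> g a c e \<otimes>\<^bsub>H\<^esub> inv\<^bsub>H\<^esub> (g a b d) \<otimes>\<^bsub>H\<^esub> inv\<^bsub>H\<^esub> (g a c e))"

lemma bump_minus: "bump c p (- x) = - bump c p (x :: 'm :: ab_group_add)"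
  by (simp add: bump_def)

lemma bump_cases: "bump c p \<in> {id, uminus, \<lambda>_. 0 :: 'm :: ab_group_add}"
proof -
  have "bump c p = (if p = (c, 0) then id else if p = (c, 1) then uminus else (\<lambda>_. 0 :: 'm))"
    by (simp add: bump_def fun_eq_iff)
  then show ?thesis by simp
qed

lemma foldr_pos_inv_word: "foldr pos (inv_word w) (foldr pos w p) = p"
  by (induction w arbitrary: p) (auto simp: pos_inverse)

lemma inv_word_replicate: "inv_word (replicate n (i, b)) = replicate n (i, \<not> b)"
  by (simp add: inv_word_def)

text \<open>The inverse of the 3-cycle with index \<open>j\<close>, carried from level 0 to level
  \<open>z\<close> by the shift.\<close>

definition cyc_at :: "nat \<Rightarrow> nat \<Rightarrow> word" where
  "cyc_at z j = replicate z (0, True) @ [(j, False)] @ replicate z (0, False)"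

lemma foldr_pos_shift: "foldr pos (replicate n (0, b)) p = (fst p + (if b then int n else - int n), snd p)"
  by (induction n) (auto simp: pos_def)

lemma foldr_pos_cyc_at:
  assumes "0 < j" "j \<le> 125"
  shows "foldr pos (cyc_at z j) p = (fst p, if fst p = int z then cyc_perm (j - 1) False (snd p) else snd p)"
  using assms unfolding cyc_at_def foldr_append foldr_pos_shift by (auto simp: pos_def)

lemma cyc_at_letters: "j \<le> 125 \<Longrightarrow> a \<in> set (cyc_at z j) \<Longrightarrow> fst a \<le> 125"
  "j \<le> 125 \<Longrightarrow> a \<in> set (inv_word (cyc_at z j)) \<Longrightarrow> fst a \<le> 125"
  by (auto simp: cyc_at_def inv_word_replicate)

lemma cyc_at_words: "0 < k \<Longrightarrow> j < k \<Longrightarrow> cyc_at z j \<in> words k"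
  by (auto simp: cyc_at_def words_def)

text \<open>The two conjugates of \<open>w\<close> cancel except at level \<open>z\<close>, where the translation by the
  distribution \<open>\<delta>\<^sub>0 - \<delta>\<^sub>1\<close> on the five points is the difference of its images
  \<open>\<delta>\<^sub>0 - \<delta>\<^sub>2\<close> and \<open>\<delta>\<^sub>1 - \<delta>\<^sub>2\<close> under the two 3-cycles.\<close>

definition level_word :: "word \<Rightarrow> nat \<Rightarrow> word" where
  "level_word w z =
     (let u = cyc_at z (cyc_index 1 2 3); v = cyc_at z (cyc_index 0 1 2)
      in (inv_word u @ w @ u) @ (inv_word v @ inv_word w @ v))"

definition levels_word :: "word \<Rightarrow> nat \<Rightarrow> word" where
  "levels_word w B = concat (map (level_word w) [0..<B])"

lemma bump_level:
  fixes x :: "'m :: ab_group_add"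
  shows "bump c (foldr pos (cyc_at z (cyc_index 1 2 3)) p) x - bump c (foldr pos (cyc_at z (cyc_index 0 1 2)) p) x
    = (if fst p = int z then bump c p x else 0)"
proof -
  have h: "foldr pos (cyc_at z (cyc_index 1 2 3)) p = (fst p, if fst p = int z then cyc 3 2 1 (snd p) else snd p)"
    using cyc_index_bounds[of 1 2 3] cyc_perm_index(2)[of 1 2 3]
    by (subst foldr_pos_cyc_at) simp_all
  have g: "foldr pos (cyc_at z (cyc_index 0 1 2)) p = (fst p, if fst p = int z then cyc 2 1 0 (snd p) else snd p)"
    using cyc_index_bounds[of 0 1 2] cyc_perm_index(2)[of 0 1 2]
    by (subst foldr_pos_cyc_at) simp_all
  obtain y s where p: "p = (y, s)" by force
  consider "s = 0" | "s = 1" | "s = 2" | "s = 3" | "3 < s" by linarith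
  then have "bump y (y, cyc 3 2 1 s) x - bump y (y, cyc 2 1 0 s) x = bump y (y, s) x"
    by cases (simp_all add: bump_def cyc_def)
  moreover have "bump c (y, s') x = (if y = c then bump y (y, s') x else 0)" for s'
    by (simp add: bump_def)
  ultimately show ?thesis unfolding h g unfolding p by (cases "y = c"; cases "y = int z") simp_all
qed

text \<open>The identity (a b c) = [(a b d), (a c e)] in the alternating group on five points, which
  makes that group perfect, with the left-hand side moved over.\<close>

lemma three_cycle_commutator:
  assumes d: "distinct [a, b, c, d, e]" and l: "{a, b, c, d, e} \<subseteq> {..<5}"
  shows "foldr pos [(cyc_index a b c, False), (cyc_index a b d, True), (cyc_index a c e, True),
    (cyc_index a b d, False), (cyc_index a c e, False)] p = p"
proof -
  have i: "0 < cyc_index a b c" "cyc_index a b c \<le> 125" "0 < cyc_index a b d" "cyc_index a b d \<le> 125"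
    "0 < cyc_index a c e" "cyc_index a c e \<le> 125"
    using l cyc_index_bounds[of a b c] cyc_index_bounds[of a b d] cyc_index_bounds[of a c e] by auto
  have perm: "cyc_perm (cyc_index a b c - 1) False = cyc c b a"
    "cyc_perm (cyc_index a b d - 1) True = cyc a b d" "cyc_perm (cyc_index a b d - 1) False = cyc d b a"
    "cyc_perm (cyc_index a c e - 1) True = cyc a c e" "cyc_perm (cyc_index a c e - 1) False = cyc e c a"
    using cyc_perm_index[of a b c] cyc_perm_index[of a b d] cyc_perm_index[of a c e] d l by auto
  have "cyc c b a (cyc a b d (cyc a c e (cyc d b a (cyc e c a s)))) = s" for s
    using d by (auto simp: cyc_def)
  then show ?thesis
    using i perm by (cases p) (auto simp: pos_def)
qed

context perturbation
begin

text \<open>A word in affine letters that translates by \<open>x\<close> in each of the forms found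
  above a point: with sign plus, with sign minus, or not at all.\<close>

definition pure :: "word \<Rightarrow> 'm \<Rightarrow> bool" where
  "pure w x \<longleftrightarrow> (\<forall>a\<in>set w. 126 \<le> fst a) \<and>
     (\<forall>\<sigma>\<in>{id, uminus, \<lambda>_. 0}. \<forall>\<mu>. foldr (aff \<sigma>) w \<mu> = \<mu> + \<sigma> x)"

lemma pureD: "pure w x \<Longrightarrow> \<sigma> \<in> {id, uminus, \<lambda>_. 0} \<Longrightarrow> foldr (aff \<sigma>) w \<mu> = \<mu> + \<sigma> x"
  unfolding pure_def by blast

lemma foldr_aff_inv_word: "foldr (aff \<sigma>) (inv_word w) (foldr (aff \<sigma>) w \<mu>) = \<mu>"
  by (induction w arbitrary: \<mu>) (auto simp: aff_inverse)

lemma pure_inv_word: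
  assumes "pure w x" shows "pure (inv_word w) (- x)"
proof -
  have "foldr (aff \<sigma>) (inv_word w) \<mu> = \<mu> + \<sigma> (- x)" if \<sigma>: "\<sigma> \<in> {id, uminus, \<lambda>_. 0}" for \<sigma> \<mu>
  proof -
    have "foldr (aff \<sigma>) w (\<mu> + \<sigma> (- x)) = \<mu> + \<sigma> (- x) + \<sigma> x"
      using assms \<sigma> unfolding pure_def by blast
    also have "\<dots> = \<mu>" using \<sigma> by auto
    finally show ?thesis using foldr_aff_inv_word[of \<sigma> w "\<mu> + \<sigma> (- x)"] by simp
  qed
  moreover have "\<forall>a\<in>set (inv_word w). 126 \<le> fst a"
    using assms by (auto simp: pure_def inv_word_def)
  ultimately show ?thesis by (simp add: pure_def)
qed

lemma pure_append:
  assumes "pure v x" "pure w y" shows "pure (v @ w) (x + y)"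
proof -
  have "foldr (aff \<sigma>) (v @ w) \<mu> = \<mu> + \<sigma> (x + y)" if \<sigma>: "\<sigma> \<in> {id, uminus, \<lambda>_. 0}" for \<sigma> \<mu>
  proof -
    have "foldr (aff \<sigma>) (v @ w) \<mu> = \<mu> + \<sigma> y + \<sigma> x"
      using pureD[OF assms(1) \<sigma>] pureD[OF assms(2) \<sigma>] by simp
    also have "\<dots> = \<mu> + \<sigma> (x + y)" using \<sigma> by auto
    finally show ?thesis .
  qed
  moreover have "\<forall>a\<in>set (v @ w). 126 \<le> fst a" using assms by (auto simp: pure_def)
  ultimately show ?thesis unfolding pure_def by blast
qed

lemma pure_conjugate:
  assumes "pure w x" shows "pure ((126 + i, True) # w @ [(126 + i, False)]) (\<phi> i x)"
  using assms by (auto simp: pure_def aff_def \<phi>_add \<phi>_minus \<phi>_diff \<phi>_inverse)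

lemma pure_single:
  assumes "\<And>x. \<phi> i x = x" shows "pure [(126 + i, True)] (m i)"
  by (auto simp: pure_def aff_def assms)

lemma pos_pure:
  assumes "pure w x" shows "foldr pos w p = p"
proof -
  have "foldr pos w p = p" if "\<forall>a\<in>set w. 126 \<le> fst a" for w
    using that by (induction w) (auto simp: pos_def)
  then show ?thesis using assms by (simp add: pure_def)
qed

lemma aw_pure:
  assumes "pure w x" shows "aw c w p \<mu> = \<mu> + bump c p x"
proof -
  have "foldr pos v p = p \<and> aw c v p \<mu> = foldr (aff (bump c p)) v \<mu>" if "\<forall>a\<in>set v. 126 \<le> fst a" for v
    using that by (induction v) (auto simp: pos_def)
  then show ?thesis using pureD[OF assms bump_cases] assms unfolding pure_def by metis
qed

lemma aw_low: "\<forall>a\<in>set w. fst a \<le> 125 \<Longrightarrow> aw c w p \<mu> = \<mu>"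
  by (induction w) (auto simp: aff_def)

lemma conjugate_pure:
  assumes "pure w x" "j \<le> 125"
  shows "foldr pos (inv_word (cyc_at z j) @ w @ cyc_at z j) p = p"
    and "aw c (inv_word (cyc_at z j) @ w @ cyc_at z j) p \<mu> = \<mu> + bump c (foldr pos (cyc_at z j) p) x"
  using assms cyc_at_letters
  by (simp_all add: pos_pure foldr_pos_inv_word aw_append aw_low aw_pure)

lemma level_word_acts:
  assumes "pure w x"
  shows "foldr pos (level_word w z) p = p"
    and "aw c (level_word w z) p \<mu> = \<mu> + (if fst p = int z then bump c p x else 0)"
proof -
  have i: "cyc_index 1 2 3 \<le> 125" "cyc_index 0 1 2 \<le> 125" by (simp_all add: cyc_index_def)
  note 1 = conjugate_pure[OF assms i(1), where z = z] and 2 = conjugate_pure[OF pure_inv_word[OF assms] i(2), where z = z]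
  show "foldr pos (level_word w z) p = p"
    unfolding level_word_def Let_def foldr_append[of pos "inv_word _ @ _ @ _"] comp_apply 1 2 ..
  show "aw c (level_word w z) p \<mu> = \<mu> + (if fst p = int z then bump c p x else 0)"
    unfolding level_word_def Let_def aw_append[of c "inv_word _ @ w @ _"] 1 2 bump_minus
    using bump_level[of c z p x] by (simp add: algebra_simps)
qed

lemma levels_word_acts:
  assumes "pure w x"
  shows "foldr pos (levels_word w B) p = p"
    and "aw c (levels_word w B) p \<mu> = \<mu> + (if 0 \<le> fst p \<and> fst p < int B then bump c p x else 0)"
proof (induction B arbitrary: \<mu>)
  case 0
  case 1 show ?case by (simp add: levels_word_def)
  case 2 show ?case by (auto simp: levels_word_def)
next
  case (Suc B)
  have s: "levels_word w (Suc B) = levels_word w B @ level_word w B" by (simp add: levels_word_def)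
  case 1 show ?case using Suc by (simp add: s level_word_acts[OF assms])
  case 2 show ?case using Suc by (auto simp: s aw_append level_word_acts[OF assms])
qed

text \<open>\<open>levels_word w B\<close> reproduces \<open>w\<close> on the components with centre
  below \<open>B\<close> and is trivial on the others, where \<open>w\<close> is trivial too because
  \<open>x\<close> lies in the submodule. Hence the two words agree in the group.\<close>

lemma relation_of_pure:
  assumes w: "pure w x" and small: "\<And>n. N n < int B \<or> x \<in> K (\<alpha> n)" and nonneg: "\<And>n. 0 \<le> N n"
  shows "holds (N n) (K (\<alpha> n)) (inv_word w @ levels_word w B)"
  unfolding holds_def
proof (intro allI conjI)
  fix p \<mu>
  show "foldr pos (inv_word w @ levels_word w B) p = p"
    using levels_word_acts(1)[OF w] pos_pure[OF pure_inv_word[OF w]] by simp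
  have "aw (N n) (inv_word w @ levels_word w B) p \<mu> - \<mu> =
    (if 0 \<le> fst p \<and> fst p < int B then bump (N n) p x else 0) - bump (N n) p x"
    unfolding aw_append levels_word_acts[OF w] aw_pure[OF pure_inv_word[OF w]] by (simp add: bump_minus)
  also have "\<dots> \<in> K (\<alpha> n)"
    using small[of n] nonneg[of n] by (auto simp: bump_def K_zero K_minus)
  finally show "aw (N n) (inv_word w @ levels_word w B) p \<mu> - \<mu> \<in> K (\<alpha> n)" .
qed

lemma level_word_words:
  assumes "w \<in> words k" "126 \<le> k" shows "levels_word w B \<in> words k"
proof -
  have "cyc_at z (cyc_index 1 2 3) \<in> words k" "cyc_at z (cyc_index 0 1 2) \<in> words k" for z
    using assms(2) by (auto intro!: cyc_at_words simp: cyc_index_def)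
  then have "level_word w z \<in> words k" for z using assms(1) by (simp add: level_word_def Let_def)
  then show ?thesis by (induction B) (simp_all add: levels_word_def)
qed

text \<open>By \<open>perfect\<close> the 3-cycles die in every quotient in \<C>; there each level
  word collapses to the product of \<open>w\<close> and its inverse, and \<open>w\<close> equals a
  product of level words.\<close>

theorem pure_in_res_words:
  assumes \<C>: "\<And>H. H \<in> \<C> \<Longrightarrow> group H"
    and perfect: "\<And>H g. H \<in> \<C> \<Longrightarrow> three_cycle_relations H g \<Longrightarrow> g 1 2 3 = \<one>\<^bsub>H\<^esub> \<and> g 0 1 2 = \<one>\<^bsub>H\<^esub>"
    and k: "126 \<le> k" and w: "w \<in> words k" "pure w x"
    and small: "\<And>n. N n < int B \<or> x \<in> K (\<alpha> n)" and nonneg: "\<And>n. 0 \<le> N n"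
  shows "w \<in> res_words \<C> k {w \<in> words k. \<forall>n. holds (N n) (K (\<alpha> n)) w}"
proof -
  have "eval_word H T w = \<one>\<^bsub>H\<^esub>" if H: "H \<in> \<C>" "length T = k" "marked_group H T"
    and ker: "\<And>v. v \<in> words k \<Longrightarrow> (\<And>n. holds (N n) (K (\<alpha> n)) v) \<Longrightarrow> eval_word H T v = \<one>\<^bsub>H\<^esub>" for H T
  proof -
    interpret H: group H using \<C>[OF H(1)] .
    have T: "set T \<subseteq> carrier H" by (rule marked_groupD(2)[OF H(3)])
    have Ti: "T ! i \<in> carrier H" if "i < k" for i using T that H(2) by (auto simp: subset_iff)
    \<comment> \<open>The default value one keeps \<open>g\<close> inside the carrier for arguments
      outside the five points.\<close>
    define g where "g a b c = (if a < 5 \<and> b < 5 \<and> c < 5 then T ! cyc_index a b c else \<one>\<^bsub>H\<^esub>)" for a b c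
    have gc: "g a b c \<in> carrier H" for a b c
      using Ti cyc_index_bounds[of a b c] k by (auto simp: g_def)
    have "three_cycle_relations H g"
      unfolding three_cycle_relations_def
    proof (intro conjI allI impI)
      fix a b c d e :: nat assume d: "distinct [a, b, c, d, e]" and l: "{a, b, c, d, e} \<subseteq> {..<5}"
      let ?r = "[(cyc_index a b c, False), (cyc_index a b d, True), (cyc_index a c e, True),
        (cyc_index a b d, False), (cyc_index a c e, False)]"
      have i: "cyc_index a b c \<le> 125" "cyc_index a b d \<le> 125" "cyc_index a c e \<le> 125"
        using l cyc_index_bounds[of a b c] cyc_index_bounds[of a b d] cyc_index_bounds[of a c e] by auto
      have "holds (N n) (K (\<alpha> n)) ?r" for n
        unfolding holds_def
      proof (intro allI conjI)
        show "foldr pos ?r p = p" for p by (rule three_cycle_commutator[OF d l])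
        show "aw (N n) ?r p \<mu> - \<mu> \<in> K (\<alpha> n)" for p \<mu>
          using aw_low[of ?r "N n" p \<mu>] i K_zero by simp
      qed
      then have "eval_word H T ?r = \<one>\<^bsub>H\<^esub>" using ker[of ?r] i k by simp
      then have r: "inv\<^bsub>H\<^esub> (g a b c) \<otimes>\<^bsub>H\<^esub> (g a b d \<otimes>\<^bsub>H\<^esub> g a c e \<otimes>\<^bsub>H\<^esub> inv\<^bsub>H\<^esub> (g a b d) \<otimes>\<^bsub>H\<^esub> inv\<^bsub>H\<^esub> (g a c e)) = \<one>\<^bsub>H\<^esub>"
        using l gc[of a b c] gc[of a b d] gc[of a c e] by (simp add: eval_word_Cons g_def H.m_assoc)
      then show "g a b c = g a b d \<otimes>\<^bsub>H\<^esub> g a c e \<otimes>\<^bsub>H\<^esub> inv\<^bsub>H\<^esub> (g a b d) \<otimes>\<^bsub>H\<^esub> inv\<^bsub>H\<^esub> (g a c e)"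
        using gc by (metis H.inv_closed H.inv_equality H.inv_inv H.m_closed H.inv_comm)
    qed (rule gc)
    then have "g 1 2 3 = \<one>\<^bsub>H\<^esub> \<and> g 0 1 2 = \<one>\<^bsub>H\<^esub>" by (rule perfect[OF H(1)])
    then have g1: "T ! cyc_index 1 2 3 = \<one>\<^bsub>H\<^esub>" "T ! cyc_index 0 1 2 = \<one>\<^bsub>H\<^esub>"
      by (simp_all add: g_def)
    have cw: "cyc_at z (cyc_index 1 2 3) \<in> words k" "cyc_at z (cyc_index 0 1 2) \<in> words k" for z
      using k by (auto intro!: cyc_at_words simp: cyc_index_def)
    have cyc_at_1: "eval_word H T (cyc_at z j) = \<one>\<^bsub>H\<^esub>" if "j < k" "T ! j = \<one>\<^bsub>H\<^esub>" for z j
    proof -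
      have rw: "replicate z (0, b) \<in> words k" for b using k by (induction z) auto
      have inv: "eval_word H T (replicate z (0, False)) = inv\<^bsub>H\<^esub> (eval_word H T (replicate z (0, True)))"
        using H.eval_word_inv[OF T, of "replicate z (0, True)"] rw H(2) by (simp add: inv_word_replicate)
      have c: "eval_word H T (replicate z (0, True)) \<in> carrier H" using rw H(2) T by simp
      show ?thesis
        unfolding cyc_at_def using rw H(2) that T c
        by (simp add: H.eval_word_append eval_word_Cons inv)
    qed
    have lv: "eval_word H T (level_word w z) = \<one>\<^bsub>H\<^esub>" for z
    proof -
      have "cyc_index 1 2 3 < k" "cyc_index 0 1 2 < k" using k by (auto simp: cyc_index_def)
      note 1 = cyc_at_1[OF this(1) g1(1), of z] cyc_at_1[OF this(2) g1(2), of z]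
      have wc: "eval_word H T w \<in> carrier H" using T w(1) H(2) by simp
      show ?thesis
        using w(1) cw[of z] H(2) T wc 1
        by (simp add: level_word_def Let_def H.eval_word_append H.eval_word_inv)
    qed
    have lw: "level_word w z \<in> words k" for z using w(1) cw by (simp add: level_word_def Let_def)
    have "eval_word H T (levels_word w B) = \<one>\<^bsub>H\<^esub>"
    proof (induction B)
      case (Suc B)
      have "levels_word w (Suc B) = levels_word w B @ level_word w B" by (simp add: levels_word_def)
      then show ?case using Suc lv lw level_word_words[OF w(1) k] T H(2) by (simp add: H.eval_word_append)
    qed (simp add: levels_word_def)
    moreover have "eval_word H T (inv_word w @ levels_word w B) = \<one>\<^bsub>H\<^esub>"
    proof (rule ker)
      show "inv_word w @ levels_word w B \<in> words k" using w(1) level_word_words[OF w(1) k] by simp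
      show "holds (N n) (K (\<alpha> n)) (inv_word w @ levels_word w B)" for n
        by (rule relation_of_pure[OF w(2) small nonneg])
    qed
    ultimately have "inv\<^bsub>H\<^esub> (eval_word H T w) = \<one>\<^bsub>H\<^esub>"
      using w(1) level_word_words[OF w(1) k] T H(2) by (simp add: H.eval_word_append H.eval_word_inv)
    then show ?thesis using H.inv_eq_1_iff T w(1) H(2) by simp
  qed
  then show ?thesis using w(1) by (auto simp: res_words_def)
qed

text \<open>The affine group modulo \<open>K a\<close> is a quotient: a relation \<open>v\<close>
  holds in particular in a component with index \<open>a\<close> and centre beyond twice the length
  of \<open>v\<close>, so \<open>holds_imp_affine\<close> applies. There \<open>w\<close> is
  translation by \<open>x\<close>, which is non-zero modulo \<open>K a\<close>.\<close>

lemma pure_not_in_res_words: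
  assumes aff_\<C>: "\<And>(G :: nat monoid) S. marked_group G S \<Longrightarrow> length S = k \<Longrightarrow>
      word_kernel G S = {w \<in> words k. \<forall>\<mu>. foldr (aff id) w \<mu> - \<mu> \<in> K a} \<Longrightarrow> G \<in> \<C>"
    and w: "pure w x" "x \<notin> K a"
    and limit: "\<And>c :: nat. \<exists>n. int c < N n \<and> \<alpha> n = a"
  shows "w \<notin> res_words \<C> k {w \<in> words k. \<forall>n. holds (N n) (K (\<alpha> n)) w}"
proof
  assume mem: "w \<in> res_words \<C> k {w \<in> words k. \<forall>n. holds (N n) (K (\<alpha> n)) w}"
  obtain G :: "nat monoid" and S where G: "marked_group G S" "length S = k"
    "word_kernel G S = {w \<in> words k. \<forall>\<mu>. foldr (aff id) w \<mu> - \<mu> \<in> K a}"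
    using affine_marked_group by blast
  have "eval_word G S v = \<one>\<^bsub>G\<^esub>" if v: "v \<in> words k" "\<forall>n. holds (N n) (K (\<alpha> n)) v" for v
  proof -
    obtain n where n: "int (2 * length v) < N n" "\<alpha> n = a" using limit by blast
    have "holds (N n) (K a) v" using v(2) n(2) by auto
    then have "v \<in> word_kernel G S" unfolding G(3) using holds_imp_affine n(1) v(1) by auto
    then show ?thesis by (simp add: word_kernel_def)
  qed
  then have "eval_word G S w = \<one>\<^bsub>G\<^esub>" using mem aff_\<C>[OF G] G by (auto simp: res_words_def)
  moreover have "w \<in> words k" using mem by (simp add: res_words_def)
  ultimately have "w \<in> word_kernel G S" using G(2) by (simp add: word_kernel_def)
  then have "foldr (aff id) w 0 - 0 \<in> K a" unfolding G(3) by blast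
  moreover have "foldr (aff id) w 0 = x" using w(1) by (simp add: pure_def)
  ultimately show False using w(2) by simp
qed

theorem Lim_desc_le_Res_perturbation:
  fixes \<C> :: "nat monoid set" and k :: "'o \<Rightarrow> nat"
  assumes \<theta>: "word_enumeration \<theta>" and r: "Well_order r" and \<C>: "\<And>H. H \<in> \<C> \<Longrightarrow> group H"
    and perfect: "\<And>H g. H \<in> \<C> \<Longrightarrow> three_cycle_relations H g \<Longrightarrow> g 1 2 3 = \<one>\<^bsub>H\<^esub> \<and> g 0 1 2 = \<one>\<^bsub>H\<^esub>"
    and aff_\<C>: "\<And>k a (G :: nat monoid) S. marked_group G S \<Longrightarrow> length S = k \<Longrightarrow>
      word_kernel G S = {w \<in> words k. \<forall>\<mu>. foldr (aff id) w \<mu> - \<mu> \<in> K a} \<Longrightarrow> G \<in> \<C>"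
    and k: "\<And>a. 126 \<le> k a"
    and mono: "\<And>a b. (b, a) \<in> r \<Longrightarrow> K a \<subseteq> K b"
    and test: "\<And>a0 a. (a, a0) \<in> r \<Longrightarrow> \<exists>w x. w \<in> words (k a0) \<and> pure w x \<and> x \<notin> K a \<and>
      (\<forall>b. (b, a) \<in> r \<and> b \<noteq> a \<longrightarrow> x \<in> K b)"
  shows "Lim_desc r f \<le>\<^sub>W Res \<theta> \<C>"
proof -
  define total where "total k n = (\<Sum>i\<le>n. length (\<theta> k i))" for k n
  \<comment> \<open>The sum puts the centre beyond twice the length of each of the first words up to
    index \<open>n\<close>, as locality requires; the summand \<open>n\<close> makes the centres
    strictly increasing and unbounded.\<close>
  define N where "N k n = 2 * int (n + total k n) + 1" for k n
  define P where "P \<alpha> = {w \<in> words (k (\<alpha> 0)). \<forall>n. holds (N (k (\<alpha> 0)) n) (K (\<alpha> n)) w}" for \<alpha>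
  have N_length: "2 * int (length (\<theta> k i)) < N k n" if "i \<le> n" for k i n
  proof -
    have "length (\<theta> k i) \<le> total k n" unfolding total_def using that by (intro member_le_sum) auto
    then show ?thesis by (simp add: N_def)
  qed
  have N_ge: "2 * int n < N k n" "0 \<le> N k n" for k n by (simp_all add: N_def)
  have N_mono: "N k i < N k n" if "i < n" for k i n
  proof -
    have "total k i \<le> total k n" unfolding total_def using that by (intro sum_mono2) auto
    then show ?thesis using that by (simp add: N_def)
  qed
  define ok where "ok a0 a w x \<longleftrightarrow> w \<in> words (k a0) \<and> pure w x \<and> x \<notin> K a \<and>
    (\<forall>b. (b, a) \<in> r \<and> b \<noteq> a \<longrightarrow> x \<in> K b)" for a0 a w x
  define \<tau> where "\<tau> a0 a = (SOME w. \<exists>x. ok a0 a w x)" for a0 a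
  define \<xi> where "\<xi> a0 a = (SOME x. ok a0 a (\<tau> a0 a) x)" for a0 a
  have \<tau>: "ok a0 a (\<tau> a0 a) (\<xi> a0 a)" if a: "(a, a0) \<in> r" for a0 a
  proof -
    have "\<exists>w x. ok a0 a w x" using test[OF a] unfolding ok_def .
    then have "\<exists>x. ok a0 a (\<tau> a0 a) x" unfolding \<tau>_def by (rule someI_ex)
    then show ?thesis unfolding \<xi>_def by (rule someI_ex)
  qed
  show ?thesis
  proof (rule Lim_desc_le_Res[where k = k and N = P and \<tau> = \<tau>])
    show "word_enumeration \<theta>" "Well_order r" by fact+
    show "group H" if "H \<in> \<C>" for H using \<C> that .
    show "\<exists>(G :: nat monoid) S. marked_group G S \<and> length S = k (\<alpha> 0) \<and> word_kernel G S = P \<alpha>" for \<alpha>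
      unfolding P_def by (rule perturbed_marked_group)
  next
    fix \<alpha> \<beta> :: "nat \<Rightarrow> 'o" and n
    assume desc: "\<And>n. (\<beta> (Suc n), \<beta> n) \<in> r" and eq: "\<And>i. i \<le> n \<Longrightarrow> \<beta> i = \<alpha> i"
      and w: "\<theta> (k (\<alpha> 0)) n \<in> P \<alpha>"
    let ?w = "\<theta> (k (\<alpha> 0)) n" and ?N = "N (k (\<alpha> 0))"
    obtain M where le: "\<And>m n. m \<le> n \<Longrightarrow> (\<beta> n, \<beta> m) \<in> r"
      by (rule desc_stabilizes[where a = \<beta>, OF r desc]) blast
    have "holds (?N j) (K (\<beta> j)) ?w" for j
    proof (cases "j \<le> n")
      case True
      then show ?thesis using w eq by (simp add: P_def)
    next
      case False
      then have j: "n \<le> j" by simp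
      \<comment> \<open>Component \<open>n\<close> is common to both sequences and its centre is
        remote for the word; it decides all later components, whose submodules are at least as
        large.\<close>
      have h: "holds (?N n) (K (\<beta> n)) ?w" using w eq by (simp add: P_def)
      show ?thesis by (rule holds_local[OF h mono[OF le[OF j]] N_length[OF order_refl] N_length[OF j]])
    qed
    then show "\<theta> (k (\<alpha> 0)) n \<in> P \<beta>" using w eq by (simp add: P_def)
  next
    fix \<alpha> :: "nat \<Rightarrow> 'o" and n
    assume desc: "\<And>n. (\<alpha> (Suc n), \<alpha> n) \<in> r"
    let ?t = "\<tau> (\<alpha> 0) (\<alpha> n)" and ?x = "\<xi> (\<alpha> 0) (\<alpha> n)" and ?k = "k (\<alpha> 0)"
    obtain M where M: "\<And>n. M \<le> n \<Longrightarrow> \<alpha> n = \<alpha> M" and le: "\<And>m n. m \<le> n \<Longrightarrow> (\<alpha> n, \<alpha> m) \<in> r"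
      by (rule desc_stabilizes[where a = \<alpha>, OF r desc]) blast
    have t: "?t \<in> words ?k" "pure ?t ?x" "?x \<notin> K (\<alpha> n)"
      "\<And>b. (b, \<alpha> n) \<in> r \<Longrightarrow> b \<noteq> \<alpha> n \<Longrightarrow> ?x \<in> K b"
      using \<tau>[OF le[of 0 n]] unfolding ok_def by auto
    have "?t \<notin> res_words \<C> ?k (P \<alpha>)" if stable: "\<forall>m\<ge>n. \<alpha> m = \<alpha> n"
      unfolding P_def
    proof (rule pure_not_in_res_words[OF aff_\<C> t(2,3)])
      show "\<exists>i. int c < N ?k i \<and> \<alpha> i = \<alpha> n" for c :: nat
      proof (intro exI conjI)
        show "int c < N ?k (max c n)" using N_ge(1)[of "max c n" ?k] by linarith
        show "\<alpha> (max c n) = \<alpha> n" by (rule stable[rule_format]) simp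
      qed
    qed
    moreover have "?t \<in> res_words \<C> ?k (P \<alpha>)" if m': "n \<le> m'" "\<alpha> m' \<noteq> \<alpha> n" for m'
    proof -
      have x: "?x \<in> K (\<alpha> i)" if "m' \<le> i" for i
        using t(4)[OF le[OF m'(1)] m'(2)] mono[OF le[OF that]] by blast
      show ?thesis
        unfolding P_def
      proof (rule pure_in_res_words[OF \<C> perfect k t(1,2)])
        \<comment> \<open>With the centre of component \<open>m'\<close> as bound, earlier
          components have smaller centres, and from \<open>m'\<close> on the test element lies in
          the submodules.\<close>
        show "N ?k i < int (nat (N ?k m')) \<or> ?x \<in> K (\<alpha> i)" for i
          using x[of i] N_mono[of i m' ?k] N_ge(2)[of ?k m'] by (cases "m' \<le> i") auto
        show "0 \<le> N ?k i" for i by (rule N_ge(2))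
      qed
    qed
    ultimately show "?t \<in> words ?k \<and> (?t \<notin> res_words \<C> ?k (P \<alpha>) \<longleftrightarrow> (\<forall>m\<ge>n. \<alpha> m = \<alpha> n))"
      using t(1) by blast
  qed
qed

end

section \<open>Three-cycles in nilpotent and metabelian groups\<close>

lemma exists_two_more_points:
  assumes "distinct [a, b, c]" "{a, b, c} \<subseteq> {..<5 :: nat}"
  shows "\<exists>d e. distinct [a, b, c, d, e] \<and> {a, b, c, d, e} \<subseteq> {..<5}"
proof -
  have "card {a, b, c} = 3" using assms(1) by simp
  then have "card ({..<5} - {a, b, c}) = 2" using assms(2) by (subst card_Diff_subset) auto
  then obtain d e where "{..<5} - {a, b, c} = {d, e}" "d \<noteq> e" by (auto simp: card_2_iff)
  then have "d \<in> {..<5} - {a, b, c}" "e \<in> {..<5} - {a, b, c}" "d \<noteq> e" by auto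
  then show ?thesis using assms by (intro exI[of _ d] exI[of _ e]) auto
qed

text \<open>One step of an induction: since each 3-cycle is a commutator of two others, all of them
  descend together from one term of a commutator series to the next.\<close>

lemma three_cycles_in:
  assumes rel: "three_cycle_relations H g"
    and sub: "\<And>a b c. distinct [a, b, c] \<Longrightarrow> {a, b, c} \<subseteq> {..<5} \<Longrightarrow> g a b c \<in> A"
    and comm: "\<And>x y. x \<in> A \<Longrightarrow> y \<in> A \<Longrightarrow> x \<otimes>\<^bsub>H\<^esub> y \<otimes>\<^bsub>H\<^esub> inv\<^bsub>H\<^esub> x \<otimes>\<^bsub>H\<^esub> inv\<^bsub>H\<^esub> y \<in> B"
    and d: "distinct [a, b, c]" "{a, b, c} \<subseteq> {..<5}"
  shows "g a b c \<in> B"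
proof -
  obtain x y where xy: "distinct [a, b, c, x, y]" "{a, b, c, x, y} \<subseteq> {..<5}"
    using exists_two_more_points[OF d] by blast
  have "g a b x \<in> A" "g a c y \<in> A" using xy by (auto intro!: sub)
  moreover have "g a b c = g a b x \<otimes>\<^bsub>H\<^esub> g a c y \<otimes>\<^bsub>H\<^esub> inv\<^bsub>H\<^esub> (g a b x) \<otimes>\<^bsub>H\<^esub> inv\<^bsub>H\<^esub> (g a c y)"
    using rel xy unfolding three_cycle_relations_def by blast
  ultimately show ?thesis using comm by metis
qed

lemma three_cycles_nilpotent:
  assumes H: "H \<in> nilpotent_groups p" and rel: "three_cycle_relations H g"
  shows "g 1 2 3 = \<one>\<^bsub>H\<^esub> \<and> g 0 1 2 = \<one>\<^bsub>H\<^esub>"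
proof -
  interpret plain_group H using H by (simp add: plain_group_def nilpotent_groups_def fin_gen_group_def)
  have "g a b c \<in> lower_central H n" if "distinct [a, b, c]" "{a, b, c} \<subseteq> {..<5}" for a b c n
    using that
  proof (induction n arbitrary: a b c)
    case 0
    then show ?case using rel by (simp add: three_cycle_relations_def)
  next
    case (Suc n)
    show ?case
    proof (rule three_cycles_in[OF rel Suc.IH _ Suc.prems])
      fix x y assume "x \<in> lower_central H n" "y \<in> lower_central H n"
      then show "x \<otimes>\<^bsub>H\<^esub> y \<otimes>\<^bsub>H\<^esub> inv\<^bsub>H\<^esub> x \<otimes>\<^bsub>H\<^esub> inv\<^bsub>H\<^esub> y \<in> lower_central H (Suc n)"
        using commutator_in_lower_central[of x n y] lower_central_subset by (auto simp: commutator_def)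
    qed
  qed
  from this[of 1 2 3 p] this[of 0 1 2 p] show ?thesis using H by (simp add: nilpotent_groups_def)
qed

lemma three_cycles_metabelian:
  assumes H: "H \<in> metabelian_groups" and rel: "three_cycle_relations H g"
  shows "g 1 2 3 = \<one>\<^bsub>H\<^esub> \<and> g 0 1 2 = \<one>\<^bsub>H\<^esub>"
proof -
  have comm: "x \<otimes>\<^bsub>H\<^esub> y \<otimes>\<^bsub>H\<^esub> inv\<^bsub>H\<^esub> x \<otimes>\<^bsub>H\<^esub> inv\<^bsub>H\<^esub> y \<in> derived H A" if "x \<in> A" "y \<in> A" for x y A
    unfolding derived_def by (rule generate.incl) (use that in blast)
  have 1: "g a b c \<in> derived H (carrier H)" if "distinct [a, b, c]" "{a, b, c} \<subseteq> {..<5}" for a b c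
    by (rule three_cycles_in[OF rel _ comm that]) (use rel in \<open>auto simp: three_cycle_relations_def\<close>)
  have 2: "g a b c \<in> derived H (derived H (carrier H))" if "distinct [a, b, c]" "{a, b, c} \<subseteq> {..<5}" for a b c
    by (rule three_cycles_in[OF rel 1 comm that])
  from 2[of 1 2 3] 2[of 0 1 2] show ?thesis using H by (simp add: metabelian_groups_def)
qed

lemma marked_group_fin_gen: "marked_group G S \<Longrightarrow> fin_gen_group G"
  unfolding marked_group_def fin_gen_group_def by blast

lemma inv_word_inv_word [simp]: "inv_word (inv_word w) = w"
  by (induction w) auto

section \<open>Affine groups in the two classes\<close>

context perturbation
begin

definition translation :: "word \<Rightarrow> bool" where
  "translation w \<longleftrightarrow> (\<forall>\<mu>. foldr (aff id) w \<mu> = \<mu> + foldr (aff id) w 0)"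

lemma translationD: "translation w \<Longrightarrow> \<exists>c. \<forall>\<mu>. foldr (aff id) w \<mu> = \<mu> + c"
  unfolding translation_def by blast

lemma translationI':
  assumes "\<And>\<mu>. foldr (aff id) w \<mu> = \<mu> + c" shows "translation w"
  unfolding translation_def by (simp add: assms)

lemma translationI: "(\<And>\<mu>. foldr lin w \<mu> = \<mu>) \<Longrightarrow> translation w"
  by (rule translationI'[of _ "foldr (aff id) w 0"]) (subst foldr_aff_eq, simp)

lemma translation_append:
  assumes "translation v" "translation w" shows "translation (v @ w)"
proof -
  obtain c d where "\<And>\<mu>. foldr (aff id) v \<mu> = \<mu> + c" "\<And>\<mu>. foldr (aff id) w \<mu> = \<mu> + d"
    using assms[THEN translationD] by blast
  then show ?thesis by (intro translationI'[of _ "d + c"]) (simp add: add.assoc)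
qed

lemma translation_inv_word_eq:
  assumes "translation w" shows "foldr (aff id) (inv_word w) \<mu> = \<mu> - foldr (aff id) w 0"
proof -
  obtain c where c: "\<And>\<mu>. foldr (aff id) w \<mu> = \<mu> + c" using translationD[OF assms] by blast
  show ?thesis using foldr_aff_inv_word[of id w "\<mu> - c"] by (simp add: c)
qed

lemma translation_inv_word: "translation w \<Longrightarrow> translation (inv_word w)"
  unfolding translation_def[of "inv_word w"] by (simp add: translation_inv_word_eq)

lemma translation_commutator:
  assumes "translation v" "translation w"
  shows "foldr (aff id) (v @ w @ inv_word v @ inv_word w) \<mu> = \<mu>"
proof -
  obtain c d where c: "\<And>x. foldr (aff id) v x = x + c" and d: "\<And>x. foldr (aff id) w x = x + d"
    using assms unfolding translation_def by blast
  show ?thesis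
    by (simp add: translation_inv_word_eq[OF assms(1)] translation_inv_word_eq[OF assms(2)] c d)
qed

lemma lin_inv_word: "foldr lin (inv_word w) (foldr lin w \<mu>) = \<mu>" "foldr lin w (foldr lin (inv_word w) \<mu>) = \<mu>"
  using foldr_aff_inv_word[of "\<lambda>_. 0" w] foldr_aff_inv_word[of "\<lambda>_. 0" "inv_word w"] by simp_all

text \<open>Linear parts of words commute when the operators do, so they cancel in a
  commutator.\<close>

lemma translation_if_commuting:
  assumes comm: "\<And>i j x. \<phi> i (\<phi> j x) = \<phi> j (\<phi> i x)"
  shows "translation (v @ w @ inv_word v @ inv_word w)"
proof (rule translationI)
  fix \<mu>
  have c1: "\<phi> i (\<phi>' j x) = \<phi>' j (\<phi> i x)" for i j x by (metis comm \<phi>_inverse)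
  have c2: "\<phi>' i (\<phi>' j x) = \<phi>' j (\<phi>' i x)" for i j x by (metis comm \<phi>_inverse)
  have l: "lin a (lin b x) = lin b (lin a x)" for a b x
    by (simp add: aff_def comm c1 c2)
  have "lin a (foldr lin w x) = foldr lin w (lin a x)" for a w x
    by (induction w) (simp_all add: l)
  then have "foldr lin v (foldr lin w x) = foldr lin w (foldr lin v x)" for x
    by (induction v) simp_all
  then show "foldr lin (v @ w @ inv_word v @ inv_word w) \<mu> = \<mu>"
    by (simp add: lin_inv_word)
qed

lemma pure_Nil: "pure [] 0"
  by (auto simp: pure_def)

definition affine_group :: "nat \<Rightarrow> 'o \<Rightarrow> nat monoid \<Rightarrow> nat list \<Rightarrow> bool" where
  "affine_group k a G S \<longleftrightarrow> marked_group G S \<and> length S = k \<and>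
     word_kernel G S = {w \<in> words k. \<forall>\<mu>. foldr (aff id) w \<mu> - \<mu> \<in> K a}"

lemma commutator_of_translations:
  assumes aG: "affine_group k a G S" and vw: "v \<in> words k" "w \<in> words k" "translation v" "translation w"
  shows "eval_word G S v \<otimes>\<^bsub>G\<^esub> eval_word G S w \<otimes>\<^bsub>G\<^esub> inv\<^bsub>G\<^esub> (eval_word G S v) \<otimes>\<^bsub>G\<^esub> inv\<^bsub>G\<^esub> (eval_word G S w) = \<one>\<^bsub>G\<^esub>"
proof -
  note mG = aG[unfolded affine_group_def, THEN conjunct1]
    and len = aG[unfolded affine_group_def, THEN conjunct2, THEN conjunct1]
    and ker = aG[unfolded affine_group_def, THEN conjunct2, THEN conjunct2]
  note G = marked_groupD[OF mG]
  interpret G: group G by (rule G(1))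
  have c: "v @ w @ inv_word v @ inv_word w \<in> words k" using vw by simp
  moreover have "\<forall>\<mu>. foldr (aff id) (v @ w @ inv_word v @ inv_word w) \<mu> - \<mu> \<in> K a"
    using translation_commutator[OF vw(3,4)] K_zero by (simp del: foldr_append)
  ultimately have "v @ w @ inv_word v @ inv_word w \<in> word_kernel G S" unfolding ker by blast
  then have "eval_word G S (v @ w @ inv_word v @ inv_word w) = \<one>\<^bsub>G\<^esub>" by (simp add: word_kernel_def)
  then show ?thesis using vw(1,2) len G(2)
    by (simp add: G.eval_word_append G.eval_word_inv G.m_assoc)
qed

text \<open>With trivial operators every word is a translation, so the group is abelian and
  nilpotent of every class from 1 on.\<close>

lemma affine_group_abelian:
  assumes aG: "affine_group k a G S" and triv: "\<And>i x. \<phi> i x = x" and p: "1 \<le> p"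
  shows "G \<in> nilpotent_groups p"
proof -
  note mG = aG[unfolded affine_group_def, THEN conjunct1]
    and len = aG[unfolded affine_group_def, THEN conjunct2, THEN conjunct1]
    and ker = aG[unfolded affine_group_def, THEN conjunct2, THEN conjunct2]
  note G = marked_groupD[OF mG]
  interpret G: plain_group G using G(1) by (simp add: plain_group_def)
  have "\<phi>' i x = x" for i x using triv \<phi>_inverse by metis
  then have "lin b x = x" for b x using triv by (simp add: aff_def)
  then have "foldr lin w x = x" for w x by (induction w) simp_all
  then have tr: "translation w" for w by (rule translationI)
  have comm: "G.commutator x y = \<one>\<^bsub>G\<^esub>" if "x \<in> carrier G" "y \<in> carrier G" for x y
    using that commutator_of_translations[OF aG] tr unfolding G(3) len by (auto simp: G.commutator_def)
  have "lower_central G (Suc n) = {\<one>\<^bsub>G\<^esub>}" for n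
  proof -
    have "{G.commutator x y |x y. x \<in> lower_central G n \<and> y \<in> carrier G} \<subseteq> {\<one>\<^bsub>G\<^esub>}"
      using comm G.lower_central_subset by blast
    then have "lower_central G (Suc n) \<subseteq> {\<one>\<^bsub>G\<^esub>}"
      unfolding G.lower_central_Suc by (rule G.generate_subgroup_incl[OF _ G.triv_subgroup])
    then show ?thesis using subgroup.one_closed[OF G.subgroup_lower_central] by blast
  qed
  then have "lower_central G p = {\<one>\<^bsub>G\<^esub>}" using p by (cases p) auto
  then show ?thesis using marked_group_fin_gen[OF mG] by (simp add: nilpotent_groups_def)
qed

text \<open>The translations form an abelian subgroup, and with commuting operators it contains
  every commutator.\<close>

lemma affine_group_metabelian:
  assumes aG: "affine_group k a G S" and comm: "\<And>i j x. \<phi> i (\<phi> j x) = \<phi> j (\<phi> i x)"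
  shows "G \<in> metabelian_groups"
proof -
  note mG = aG[unfolded affine_group_def, THEN conjunct1]
    and len = aG[unfolded affine_group_def, THEN conjunct2, THEN conjunct1]
    and ker = aG[unfolded affine_group_def, THEN conjunct2, THEN conjunct2]
  note G = marked_groupD[OF mG]
  interpret G: group G by (rule G(1))
  define A where "A = eval_word G S ` {w \<in> words k. translation w}"
  have A: "subgroup A G"
  proof (rule G.subgroupI)
    show "A \<subseteq> carrier G" using G(2) len by (auto simp: A_def)
    have "translation []" by (simp add: translation_def)
    then show "A \<noteq> {}" unfolding A_def using Nil_words by blast
    show "inv\<^bsub>G\<^esub> x \<in> A" if x: "x \<in> A" for x
    proof -
      obtain w where w: "w \<in> words k" "translation w" "x = eval_word G S w" using x unfolding A_def by blast
      then have "inv\<^bsub>G\<^esub> x = eval_word G S (inv_word w)" using G.eval_word_inv[OF G(2)] len by simp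
      then show ?thesis using w translation_inv_word by (auto simp: A_def)
    qed
    show "x \<otimes>\<^bsub>G\<^esub> y \<in> A" if xy: "x \<in> A" "y \<in> A" for x y
    proof -
      obtain v w where w: "v \<in> words k" "translation v" "x = eval_word G S v"
        "w \<in> words k" "translation w" "y = eval_word G S w" using xy unfolding A_def by blast
      then have "x \<otimes>\<^bsub>G\<^esub> y = eval_word G S (v @ w)" using G.eval_word_append[OF G(2)] len by simp
      then show ?thesis using w translation_append by (auto simp: A_def)
    qed
  qed
  have "derived G (carrier G) \<subseteq> A"
    unfolding derived_def
  proof (rule G.generate_subgroup_incl[OF _ A], clarify)
    fix x y assume "x \<in> carrier G" "y \<in> carrier G"
    then obtain v w where w: "v \<in> words k" "x = eval_word G S v" "w \<in> words k" "y = eval_word G S w"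
      unfolding G(3) len by blast
    then have "x \<otimes>\<^bsub>G\<^esub> y \<otimes>\<^bsub>G\<^esub> inv\<^bsub>G\<^esub> x \<otimes>\<^bsub>G\<^esub> inv\<^bsub>G\<^esub> y = eval_word G S (v @ w @ inv_word v @ inv_word w)"
      using len G(2) by (simp add: G.eval_word_append G.eval_word_inv G.m_assoc)
    then show "x \<otimes>\<^bsub>G\<^esub> y \<otimes>\<^bsub>G\<^esub> inv\<^bsub>G\<^esub> x \<otimes>\<^bsub>G\<^esub> inv\<^bsub>G\<^esub> y \<in> A"
      using w translation_if_commuting[OF comm] unfolding A_def by simp
  qed
  then have "derived G (derived G (carrier G)) \<subseteq> {\<one>\<^bsub>G\<^esub>}"
    unfolding derived_def[of G "derived G (carrier G)"]
  proof (intro G.generate_subgroup_incl[OF _ G.triv_subgroup], clarify)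
    fix x y assume sub: "derived G (carrier G) \<subseteq> A" and "x \<in> derived G (carrier G)" "y \<in> derived G (carrier G)"
    then have "x \<in> A" "y \<in> A" by auto
    then show "x \<otimes>\<^bsub>G\<^esub> y \<otimes>\<^bsub>G\<^esub> inv\<^bsub>G\<^esub> x \<otimes>\<^bsub>G\<^esub> inv\<^bsub>G\<^esub> y = \<one>\<^bsub>G\<^esub>"
      using commutator_of_translations[OF aG] unfolding A_def by blast
  qed
  moreover have "\<one>\<^bsub>G\<^esub> \<in> derived G (derived G (carrier G))"
    unfolding derived_def[of G "derived G (carrier G)"] by (rule generate.one)
  ultimately show ?thesis using marked_group_fin_gen[OF mG] by (auto simp: metabelian_groups_def)
qed

end

section \<open>Nilpotent groups: the lower bound\<close>

text \<open>In the quotient the coordinates below \<open>fst a\<close> stay free, the next one is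
  read modulo \<open>2 ^ Suc (snd a)\<close>, and the rest vanish: the index stands for \<omega> *
  \<open>fst a\<close> + \<open>snd a\<close>. The successor keeps the quotient non-trivial at the
  ordinal 0, which also needs a surviving test word.\<close>

definition truncated :: "nat \<times> nat \<Rightarrow> (nat \<Rightarrow> int) set" where
  "truncated a = {x. (\<forall>i<fst a. x i = 0) \<and> 2 ^ Suc (snd a) dvd x (fst a)}"

definition single_at :: "'i \<Rightarrow> int \<Rightarrow> 'i \<Rightarrow> int" where
  "single_at a c = (\<lambda>i. if i = a then c else 0)"

lemma single_at_apply [simp]: "single_at a c i = (if i = a then c else 0)"
  by (simp add: single_at_def)

lemma single_at_add: "single_at a b + single_at a c = single_at a (b + c)"
  by (rule ext) simp

lemma single_at_zero: "single_at a 0 = 0"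
  by (rule ext) simp

lemma truncated_group: "0 \<in> truncated a" "x \<in> truncated a \<Longrightarrow> y \<in> truncated a \<Longrightarrow> x - y \<in> truncated a"
  unfolding truncated_def mem_Collect_eq by (simp_all add: dvd_diff)

lemma perturbation_truncated: "perturbation (\<lambda>_ x. x) (\<lambda>_ x. x) truncated"
proof (rule perturbation.intro)
  show "x - y \<in> truncated a" if "x \<in> truncated a" "y \<in> truncated a" for x y a
    using that by (rule truncated_group(2))
  show "0 \<in> truncated a" for a by (rule truncated_group(1))
qed (rule refl | assumption)+

interpretation abelian: perturbation "\<lambda>_ x. x" "\<lambda>_ x. x" "\<lambda>i. single_at i 1" truncated
  by (rule perturbation_truncated)

lemma abelian_pure_single: "abelian.pure [(126 + i, True)] (single_at i 1)"
  by (rule abelian.pure_single) (rule refl)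

lemma abelian_pure_replicate: "abelian.pure (replicate n (126 + i, True)) (single_at i (int n))"
proof (induction n)
  case 0
  show ?case unfolding replicate_0 of_nat_0 single_at_zero by (rule abelian.pure_Nil)
next
  case (Suc n)
  have "abelian.pure ([(126 + i, True)] @ replicate n (126 + i, True)) (single_at i 1 + single_at i (int n))"
    by (rule abelian.pure_append[OF abelian_pure_single Suc])
  then show ?case unfolding single_at_add replicate_Suc append_Cons append_Nil of_nat_Suc .
qed

theorem Lim_desc_le_Res_nilpotent:
  assumes \<theta>: "word_enumeration \<theta>" and p: "1 \<le> p"
  shows "Lim_desc omega_square f \<le>\<^sub>W Res \<theta> (nilpotent_groups p)"
proof (rule abelian.Lim_desc_le_Res_perturbation[where k = "\<lambda>a. 127 + fst a", OF \<theta> Well_order_omega_square])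
  show "group H" if "H \<in> nilpotent_groups p" for H
    using that by (simp add: nilpotent_groups_def fin_gen_group_def)
  show "g 1 2 3 = \<one>\<^bsub>H\<^esub> \<and> g 0 1 2 = \<one>\<^bsub>H\<^esub>"
    if "H \<in> nilpotent_groups p" "three_cycle_relations H g" for H g
    using three_cycles_nilpotent[OF that] .
  show "G \<in> nilpotent_groups p"
    if "marked_group G S" "length S = k"
      "word_kernel G S = {w \<in> words k. \<forall>\<mu>. foldr (abelian.aff id) w \<mu> - \<mu> \<in> truncated a}" for k a G S
    using abelian.affine_group_abelian[of k a G S p] that p by (simp add: abelian.affine_group_def)
  show "truncated a \<subseteq> truncated b" if "(b, a) \<in> omega_square" for a b
  proof (cases "fst b < fst a")
    case False
    then have "fst b = fst a" "(2::int) ^ Suc (snd b) dvd 2 ^ Suc (snd a)"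
      using that by (auto simp: omega_square_iff intro!: le_imp_power_dvd)
    then show ?thesis unfolding truncated_def by (auto intro: dvd_trans)
  qed (auto simp: truncated_def)
  show "\<exists>w x. w \<in> words (127 + fst a0) \<and> abelian.pure w x \<and> x \<notin> truncated a \<and>
    (\<forall>b. (b, a) \<in> omega_square \<and> b \<noteq> a \<longrightarrow> x \<in> truncated b)" if a: "(a, a0) \<in> omega_square" for a0 a
  proof (intro exI conjI allI impI)
    \<comment> \<open>Half of the modulus in coordinate \<open>fst a\<close>: non-zero modulo
      \<open>truncated a\<close>, but killed as soon as the modulus shrinks or the coordinate is
      dropped.\<close>
    let ?w = "replicate (2 ^ snd a) (126 + fst a, True)"
    let ?x = "single_at (fst a) (int (2 ^ snd a))"
    have "fst a \<le> fst a0" using a by (auto simp: omega_square_iff)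
    then have "replicate n (126 + fst a, True) \<in> words (127 + fst a0)" for n by (induction n) auto
    then show "?w \<in> words (127 + fst a0)" .
    show "abelian.pure ?w ?x" by (rule abelian_pure_replicate)
    have "\<not> (2::int) ^ Suc (snd a) dvd 2 ^ snd a" using zdvd_not_zless[of "2 ^ snd a" "2 ^ Suc (snd a)"] by simp
    then show "?x \<notin> truncated a" by (simp add: truncated_def)
    fix b assume b: "(b, a) \<in> omega_square \<and> b \<noteq> a"
    then consider "fst b < fst a" | "fst b = fst a" "snd b < snd a"
      by (auto simp: omega_square_iff prod_eq_iff)
    then show "?x \<in> truncated b"
    proof cases
      case 2
      then have "(2::int) ^ Suc (snd b) dvd 2 ^ snd a" by (intro le_imp_power_dvd) simp
      then show ?thesis using 2 by (simp add: truncated_def)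
    qed (auto simp: truncated_def)
  qed
qed simp

section \<open>Metabelian groups\<close>

lemma Field_omega_omega: "Field omega_omega = {g. finite {i. g i \<noteq> 0}}"
proof -
  have "(g, g) \<in> omega_omega" if "finite {i. g i \<noteq> 0}" for g :: "nat \<Rightarrow> nat"
    using that by (simp add: omega_omega_def)
  then show ?thesis by (auto simp: Field_def omega_omega_def)
qed

definition height :: "(nat \<Rightarrow> nat) \<Rightarrow> nat" where
  "height g = (LEAST d. \<forall>i\<ge>d. g i = 0)"

lemma height:
  assumes "finite {i. g i \<noteq> 0}" "height g \<le> i" shows "g i = 0"
proof -
  obtain d where "{i. g i \<noteq> 0} \<subseteq> {..<d}" using assms(1) finite_nat_iff_bounded by blast
  then have "\<forall>i\<ge>d. g i = 0" by (auto simp: subset_iff)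
  then have "\<forall>i\<ge>height g. g i = 0" unfolding height_def by (rule LeastI)
  then show ?thesis using assms(2) by blast
qed

lemma height_le: "(\<And>i. d \<le> i \<Longrightarrow> g i = 0) \<Longrightarrow> height g \<le> d"
  unfolding height_def by (rule Least_le) blast

lemma height_mono:
  assumes "(g, h) \<in> omega_omega" shows "height g \<le> height h"
proof (rule height_le)
  fix i assume i: "height h \<le> i"
  have fin: "finite {i. h i \<noteq> 0}" using assms by (simp add: omega_omega_def)
  show "g i = 0"
  proof (cases "g = h")
    case False
    then obtain m where m: "g m < h m" "\<forall>i>m. g i = h i" using assms by (auto simp: omega_omega_def)
    then have "m < height h" using height[OF fin, of m] by (cases "height h \<le> m") auto
    then show ?thesis using m(2) i height[OF fin i] by simp
  qed (use height[OF fin i] in simp)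
qed

lemma Well_order_omega_omega: "Well_order omega_omega"
proof -
  let ?r = omega_omega
  \<comment> \<open>The coefficients from the highest down. A smaller height gives a shorter list,
    so comparing by length first and then lexicographically yields well-foundedness.\<close>
  define lst where "lst g = map g (rev [0..<height g])" for g :: "nat \<Rightarrow> nat"
  have "?r - Id \<subseteq> inv_image (lenlex less_than) lst"
  proof
    fix x assume x: "x \<in> ?r - Id"
    obtain g h where gh: "x = (g, h)" by force
    obtain m where m: "g m < h m" "\<forall>i>m. g i = h i" and fin: "finite {i. h i \<noteq> 0}" and r: "(g, h) \<in> ?r"
      using x by (auto simp: gh omega_omega_def)
    have len: "length (lst g) \<le> length (lst h)" using height_mono[OF r] by (simp add: lst_def)
    have "(lst g, lst h) \<in> lex less_than" if eq: "height g = height h"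
    proof -
      have "m < height h" using m(1) height[OF fin, of m] by (cases "height h \<le> m") auto
      then have "[0..<height h] = [0..<m] @ m # [Suc m..<height h]"
        using upt_add_eq_append[of 0 m "height h - m"] by (simp add: upt_conv_Cons)
      then have "lst g = map g (rev [Suc m..<height h]) @ g m # map g (rev [0..<m])"
        "lst h = map h (rev [Suc m..<height h]) @ h m # map h (rev [0..<m])"
        by (simp_all add: lst_def eq)
      moreover have "map g (rev [Suc m..<height h]) = map h (rev [Suc m..<height h])"
        using m(2) by simp
      ultimately show ?thesis using m(1) unfolding lex_conv by auto
    qed
    then show "x \<in> inv_image (lenlex less_than) lst"
      using len by (cases "height g = height h") (auto simp: gh lenlex_conv lst_def)
  qed
  then have "wf (?r - Id)" by (rule wf_subset[rotated]) (simp add: wf_lenlex)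
  moreover have "Refl ?r"
    unfolding refl_on_def Field_omega_omega by (auto simp: omega_omega_def)
  moreover have "trans ?r"
  proof (rule transI)
    fix g h k assume gh: "(g, h) \<in> ?r" and hk: "(h, k) \<in> ?r"
    show "(g, k) \<in> ?r"
    proof (cases "g = h \<or> h = k")
      case False
      then obtain m n where m: "g m < h m" "\<forall>i>m. g i = h i" and n: "h n < k n" "\<forall>i>n. h i = k i"
        using gh hk by (auto simp: omega_omega_def)
      have "g (max m n) < k (max m n)" "\<forall>i>max m n. g i = k i"
        using m n by (cases m n rule: linorder_cases; simp)+
      then show ?thesis using gh hk by (auto simp: omega_omega_def)
    qed (use gh hk in auto)
  qed
  moreover have "antisym ?r"
  proof (rule antisymI)
    fix g h assume gh: "(g, h) \<in> ?r" and hg: "(h, g) \<in> ?r"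
    show "g = h"
    proof (rule ccontr)
      assume "g \<noteq> h"
      then obtain m n where m: "g m < h m" "\<forall>i>m. g i = h i" and n: "h n < g n" "\<forall>i>n. h i = g i"
        using gh hg by (auto simp: omega_omega_def)
      then show False by (cases m n rule: linorder_cases) auto
    qed
  qed
  moreover have "total_on (Field ?r) ?r"
  proof (rule total_onI)
    fix g h assume g: "g \<in> Field ?r" and h: "h \<in> Field ?r" and "g \<noteq> h"
    let ?D = "{i. g i \<noteq> h i}"
    have fin: "finite {i. g i \<noteq> 0}" "finite {i. h i \<noteq> 0}" using g h by (auto simp: Field_omega_omega)
    have finD: "finite ?D" by (rule finite_subset[OF _ finite_UnI[OF fin]]) auto
    have "?D \<noteq> {}" using \<open>g \<noteq> h\<close> by (auto simp only: fun_eq_iff)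
    define M where "M = Max ?D"
    have "M \<in> ?D" unfolding M_def using finD \<open>?D \<noteq> {}\<close> by (rule Max_in)
    then have ne: "g M \<noteq> h M" by simp
    have eq: "g i = h i" if "M < i" for i
    proof (rule ccontr)
      assume "g i \<noteq> h i"
      then have "i \<le> M" unfolding M_def using finD by (intro Max_ge) auto
      then show False using that by simp
    qed
    consider "g M < h M" | "h M < g M" using ne by linarith
    then show "(g, h) \<in> ?r \<or> (h, g) \<in> ?r"
    proof cases
      case 1
      then have "\<exists>m. g m < h m \<and> (\<forall>i>m. g i = h i)" using eq by blast
      then show ?thesis using fin unfolding omega_omega_def by blast
    next
      case 2
      then have "\<exists>m. h m < g m \<and> (\<forall>i>m. h i = g i)" using eq[symmetric] by blast
      then show ?thesis using fin unfolding omega_omega_def by blast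
    qed
  qed
  moreover have "?r \<subseteq> Field ?r \<times> Field ?r" by (auto intro: FieldI1 FieldI2)
  ultimately show ?thesis
    by (simp add: well_order_on_def linear_order_on_def partial_order_on_def preorder_on_def)
qed

text \<open>Power series in the variables \<open>Y\<^sub>0, Y\<^sub>1, \<dots>\<close>: the exponents of the monomials are the
  ordinals below \<open>\<omega>\<^sup>\<omega>\<close>, and multiplication by \<open>1 + Y\<^sub>j\<close> is invertible.\<close>

type_synonym series = "(nat \<Rightarrow> nat) \<Rightarrow> int"

definition times_Y :: "nat \<Rightarrow> series \<Rightarrow> series" where
  "times_Y j x g = (if 0 < g j then x (g(j := g j - 1)) else 0)"

text \<open>Multiplication by the inverse of \<open>1 + Y_j\<close>. Each coefficient is a finite
  alternating sum, but polynomials would not be preserved; this is why power series are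
  used.\<close>

definition geometric :: "nat \<Rightarrow> series \<Rightarrow> series" where
  "geometric j x g = (\<Sum>i\<le>g j. (- 1) ^ i * x (g(j := g j - i)))"

text \<open>Operator 0 is the identity and belongs to the letter that translates by the monomial 1;
  operator \<open>Suc j\<close> is multiplication by \<open>1 + Y_j\<close>, with no translation of
  its own.\<close>

definition series_op :: "nat \<Rightarrow> series \<Rightarrow> series" where
  "series_op i x = (case i of 0 \<Rightarrow> x | Suc j \<Rightarrow> x + times_Y j x)"

definition series_op' :: "nat \<Rightarrow> series \<Rightarrow> series" where
  "series_op' i x = (case i of 0 \<Rightarrow> x | Suc j \<Rightarrow> geometric j x)"

definition tail_series :: "(nat \<Rightarrow> nat) \<Rightarrow> series set" where
  "tail_series a = {x. \<forall>g. (g, a) \<in> omega_omega \<longrightarrow> x g = 0}"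

lemma alternating_sum_shift:
  fixes F :: "nat \<Rightarrow> int"
  shows "(\<Sum>i\<le>Suc n. (- 1) ^ i * F (Suc n - i)) = F (Suc n) - (\<Sum>i\<le>n. (- 1) ^ i * F (n - i))"
  by (subst sum.atMost_Suc_shift) (simp add: sum_negf)

lemma series_op_geometric: "geometric j x + times_Y j (geometric j x) = x"
proof (rule ext)
  fix g
  show "(geometric j x + times_Y j (geometric j x)) g = x g"
  proof (cases "g j")
    case 0
    then have "g(j := 0) = g" by (auto simp: fun_eq_iff)
    then show ?thesis using 0 by (simp add: geometric_def times_Y_def)
  next
    case (Suc n)
    have "g(j := Suc n) = g" using Suc by (auto simp: fun_eq_iff)
    then show ?thesis
      using alternating_sum_shift[of "\<lambda>k. x (g(j := k))" n] Suc by (simp add: geometric_def times_Y_def)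
  qed
qed

lemma geometric_series_op: "geometric j (x + times_Y j x) = x"
proof (rule ext)
  fix g
  show "geometric j (x + times_Y j x) g = x g"
  proof (cases "g j")
    case 0
    then have "g(j := 0) = g" by (auto simp: fun_eq_iff)
    then show ?thesis using 0 by (simp add: geometric_def times_Y_def)
  next
    case (Suc n)
    define F where "F k = x (g(j := k))" for k
    define B where "B = (\<Sum>i\<le>n. (- 1) ^ i * F (n - i))"
    have g: "g(j := Suc n) = g" using Suc by (auto simp: fun_eq_iff)
    have summand: "(x + times_Y j x) (g(j := k)) = F k + (if 0 < k then F (k - 1) else 0)" for k
      by (simp add: times_Y_def F_def)
    have "geometric j (x + times_Y j x) g =
      (\<Sum>i\<le>Suc n. (- 1) ^ i * F (Suc n - i)) +
      (\<Sum>i\<le>Suc n. (- 1) ^ i * (if 0 < Suc n - i then F (Suc n - i - 1) else 0))"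
      unfolding geometric_def Suc summand by (simp only: sum.distrib[symmetric] distrib_left)
    also have "(\<Sum>i\<le>Suc n. (- 1) ^ i * (if 0 < Suc n - i then F (Suc n - i - 1) else 0)) = B"
      by (simp add: Suc_diff_le B_def)
    also have "(\<Sum>i\<le>Suc n. (- 1) ^ i * F (Suc n - i)) = F (Suc n) - B"
      unfolding B_def by (rule alternating_sum_shift)
    finally have e: "geometric j (x + times_Y j x) g = F (Suc n) - B + B" .
    show ?thesis unfolding e by (simp add: F_def g)
  qed
qed

lemma times_Y_commute: "times_Y i (times_Y j x) = times_Y j (times_Y i x)"
proof (cases "i = j")
  case False
  show ?thesis
  proof (rule ext)
    fix g :: "nat \<Rightarrow> nat"
    have "g(i := a, j := b) = g(j := b, i := a)" for a b using False by (rule fun_upd_twist)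
    then show "times_Y i (times_Y j x) g = times_Y j (times_Y i x) g"
      using False by (simp add: times_Y_def)
  qed
qed simp

lemma times_Y_add: "times_Y j (x + y) = times_Y j x + times_Y j y"
  by (rule ext) (simp add: times_Y_def)

text \<open>Both operators compute a coefficient at \<open>g\<close> from coefficients at exponents
  got by lowering one entry of \<open>g\<close>; hence \<open>tail_series\<close> is
  invariant.\<close>

lemma lower_exponent: "(g, a) \<in> omega_omega \<Longrightarrow> k \<le> g j \<Longrightarrow> (g(j := k), a) \<in> omega_omega"
proof -
  assume g: "(g, a) \<in> omega_omega" and k: "k \<le> g j"
  have fin: "finite {i. g i \<noteq> 0}" using g by (simp add: omega_omega_def)
  have "finite {i. (g(j := k)) i \<noteq> 0}"
    by (rule finite_subset[of _ "insert j {i. g i \<noteq> 0}"]) (use fin in auto)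
  moreover have "g(j := k) = g \<or> (\<exists>m. (g(j := k)) m < g m \<and> (\<forall>i>m. (g(j := k)) i = g i))"
    using k by (cases "k = g j") (auto intro!: exI[of _ j])
  ultimately have "(g(j := k), g) \<in> omega_omega" using fin unfolding omega_omega_def by blast
  then show ?thesis
    using g Well_order_omega_omega unfolding order_on_defs by (meson transD)
qed

lemma perturbation_series: "perturbation series_op series_op' tail_series"
proof (rule perturbation.intro)
  show "series_op i (x + y) = series_op i x + series_op i y" for i x y
    by (cases i) (simp_all add: series_op_def times_Y_add algebra_simps)
  show "series_op i (series_op' i x) = x" for i x
    by (cases i) (simp_all add: series_op_def series_op'_def series_op_geometric)
  show "series_op' i (series_op i x) = x" for i x
    by (cases i) (simp_all add: series_op_def series_op'_def geometric_series_op)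
  show "0 \<in> tail_series a" for a by (simp add: tail_series_def)
  show "x - y \<in> tail_series a" if "x \<in> tail_series a" "y \<in> tail_series a" for x y a
    using that by (simp add: tail_series_def)
  show "series_op i x \<in> tail_series a" if "x \<in> tail_series a" for x a i
    using that by (cases i) (simp_all add: series_op_def tail_series_def times_Y_def lower_exponent)
  show "series_op' i x \<in> tail_series a" if "x \<in> tail_series a" for x a i
    using that by (cases i) (simp_all add: series_op'_def tail_series_def geometric_def lower_exponent)
qed

definition series_shift :: "nat \<Rightarrow> series" where
  "series_shift i = (if i = 0 then single_at (\<lambda>_. 0) 1 else 0)"

interpretation series: perturbation series_op series_op' series_shift tail_series
  by (rule perturbation_series)

lemma series_op_single:
  "series_op (Suc j) (single_at g 1) - single_at g 1 = single_at (g(j := Suc (g j))) 1"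
proof (rule ext)
  fix h
  have "h = g(j := Suc (g j)) \<longleftrightarrow> 0 < h j \<and> h(j := h j - 1) = g"
    by (auto simp: fun_eq_iff)
  then show "(series_op (Suc j) (single_at g 1) - single_at g 1) h = single_at (g(j := Suc (g j))) 1 h"
    by (simp add: series_op_def times_Y_def)
qed

text \<open>Induction on the degree: the commutator of the letter for \<open>1 + Y_j\<close> with a
  word for the monomial with exponent \<open>h\<close> translates by the product of that monomial
  with \<open>Y_j\<close>. Thus finitely many letters reach all exponents in \<open>d\<close>
  variables.\<close>

lemma series_pure_monomial:
  assumes "\<And>i. d \<le> i \<Longrightarrow> g i = 0"
  shows "\<exists>w\<in>words (127 + d). series.pure w (single_at g 1)"
  using assms
proof (induction "\<Sum>i<d. g i" arbitrary: g)
  case 0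
  have "g i = 0" for i using 0 by (cases "i < d") auto
  then have "g = (\<lambda>_. 0)" by blast
  moreover have "series.pure [(126 + 0, True)] (series_shift 0)"
    by (rule series.pure_single) (simp add: series_op_def)
  ultimately have p: "series.pure [(126, True)] (single_at g 1)" by (simp add: series_shift_def)
  show ?case by (rule bexI[where x = "[(126, True)]" and P = "\<lambda>w. series.pure w (single_at g 1)", OF p]) simp
next
  case (Suc n)
  have "\<exists>j<d. 0 < g j"
  proof (rule ccontr)
    assume "\<not> (\<exists>j<d. 0 < g j)"
    then have "(\<Sum>i<d. g i) = 0" by simp
    then show False using Suc.hyps(2) by simp
  qed
  then obtain j where j: "j < d" "0 < g j" by blast
  define h where "h = g(j := g j - 1)"
  have gh: "g = h(j := Suc (h j))" using j(2) by (simp add: h_def)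
  have "(\<Sum>i<d. g i) = g j + (\<Sum>i\<in>{..<d} - {j}. g i)" using j(1) by (intro sum.remove) auto
  moreover have "(\<Sum>i<d. h i) = h j + (\<Sum>i\<in>{..<d} - {j}. h i)" using j(1) by (intro sum.remove) auto
  moreover have "(\<Sum>i\<in>{..<d} - {j}. h i) = (\<Sum>i\<in>{..<d} - {j}. g i)"
    by (rule sum.cong) (auto simp: h_def)
  ultimately have "n = (\<Sum>i<d. h i)" using Suc.hyps(2) j(2) by (simp add: h_def)
  moreover have "h i = 0" if "d \<le> i" for i using Suc.prems[OF that] j(1) that by (simp add: h_def)
  ultimately obtain w where w: "w \<in> words (127 + d)" "series.pure w (single_at h 1)"
    using Suc.hyps(1)[of h] by blast
  let ?v = "((126 + Suc j, True) # w @ [(126 + Suc j, False)]) @ inv_word w"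
  have "series.pure ?v (series_op (Suc j) (single_at h 1) + - single_at h 1)"
    by (rule series.pure_append[OF series.pure_conjugate[OF w(2)] series.pure_inv_word[OF w(2)]])
  then have "series.pure ?v (single_at g 1)"
    using series_op_single[of j h] gh by simp
  moreover have "?v \<in> words (127 + d)" using w(1) j(1) by simp
  ultimately show ?case by blast
qed

theorem Lim_desc_le_Res_metabelian:
  assumes \<theta>: "word_enumeration \<theta>"
  shows "Lim_desc omega_omega f \<le>\<^sub>W Res \<theta> metabelian_groups"
proof (rule series.Lim_desc_le_Res_perturbation[where k = "\<lambda>a. 127 + height a", OF \<theta> Well_order_omega_omega])
  show "group H" if "H \<in> metabelian_groups" for H
    using that by (simp add: metabelian_groups_def fin_gen_group_def)
  show "g 1 2 3 = \<one>\<^bsub>H\<^esub> \<and> g 0 1 2 = \<one>\<^bsub>H\<^esub>"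
    if "H \<in> metabelian_groups" "three_cycle_relations H g" for H g
    using three_cycles_metabelian[OF that] .
  show "G \<in> metabelian_groups"
    if "marked_group G S" "length S = k"
      "word_kernel G S = {w \<in> words k. \<forall>\<mu>. foldr (series.aff id) w \<mu> - \<mu> \<in> tail_series a}" for k a G S
  proof (rule series.affine_group_metabelian)
    show "series.affine_group k a G S" using that by (simp add: series.affine_group_def)
    show "series_op i (series_op j x) = series_op j (series_op i x)" for i j x
      by (cases i; cases j) (simp_all add: series_op_def times_Y_add times_Y_commute algebra_simps)
  qed
  have tr: "trans omega_omega" and anti: "antisym omega_omega"
    using Well_order_omega_omega by (simp_all add: order_on_defs)
  show "tail_series a \<subseteq> tail_series b" if "(b, a) \<in> omega_omega" for a b
    using transD[OF tr _ that] by (auto simp: tail_series_def)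
  show "\<exists>w x. w \<in> words (127 + height a0) \<and> series.pure w x \<and> x \<notin> tail_series a \<and>
    (\<forall>b. (b, a) \<in> omega_omega \<and> b \<noteq> a \<longrightarrow> x \<in> tail_series b)" if a: "(a, a0) \<in> omega_omega" for a0 a
  proof -
    have fin: "finite {i. a i \<noteq> 0}" using a by (simp add: omega_omega_def)
    \<comment> \<open>All terms of the sequence lie below \<open>a0\<close>, so the variables
      counted by its height suffice. The test element is the monomial with exponent
      \<open>a\<close>, whose only non-zero coefficient sits exactly at \<open>a\<close>.\<close>
    have "a i = 0" if "height a0 \<le> i" for i using height[OF fin] height_mono[OF a] that by simp
    then obtain w where w: "w \<in> words (127 + height a0)" "series.pure w (single_at a 1)"
      using series_pure_monomial[of "height a0" a] by blast
    have "(a, a) \<in> omega_omega" using fin by (simp add: omega_omega_def)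
    then have "single_at a 1 \<notin> tail_series a" by (auto simp: tail_series_def)
    moreover have "single_at a 1 \<in> tail_series b" if "(b, a) \<in> omega_omega \<and> b \<noteq> a" for b
      using that antisymD[OF anti] by (auto simp: tail_series_def)
    ultimately show ?thesis using w by blast
  qed
qed simp

theorem theorem6:
  fixes \<theta> :: "nat \<Rightarrow> nat \<Rightarrow> word"
  assumes "word_enumeration \<theta>"
  shows "(\<forall>f. range f = Field omega_omega \<longrightarrow>
            Lim_desc omega_omega f \<le>\<^sub>W Res \<theta> metabelian_groups) \<and>
         (\<forall>p\<ge>1. \<forall>f. range f = Field omega_square \<longrightarrow>
            Res \<theta> (nilpotent_groups p) \<equiv>\<^sub>W Lim_desc omega_square f) \<and>
         (\<forall>\<C> :: 'h monoid set.
            (\<forall>H\<in>\<C>. group H \<and> finite (carrier H)) \<and> finite_up_to_iso \<C> \<and>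
            (\<exists>H\<in>\<C>. carrier H \<noteq> {\<one>\<^bsub>H\<^esub>}) \<longrightarrow>
            (\<forall>f. range f = Field natLeq \<longrightarrow> Res \<theta> \<C> \<equiv>\<^sub>W Lim_desc natLeq f))"
proof (intro conjI allI impI)
  show "Lim_desc omega_omega f \<le>\<^sub>W Res \<theta> metabelian_groups" for f
    by (rule Lim_desc_le_Res_metabelian[OF assms])
  show "Res \<theta> (nilpotent_groups p) \<equiv>\<^sub>W Lim_desc omega_square f"
    if "1 \<le> p" "range f = Field omega_square" for p f
    unfolding weihrauch_equiv_def
    using Res_nilpotent_le_Lim_desc[OF assms that(2)] Lim_desc_le_Res_nilpotent[OF assms that(1)] by blast
  show "Res \<theta> \<C> \<equiv>\<^sub>W Lim_desc natLeq f"
    if \<C>: "(\<forall>H\<in>\<C>. group H \<and> finite (carrier H)) \<and> finite_up_to_iso \<C> \<and>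
      (\<exists>H\<in>\<C>. carrier H \<noteq> {\<one>\<^bsub>H\<^esub>})" and f: "range f = Field natLeq" for \<C> :: "'h monoid set" and f
  proof -
    obtain H where H: "H \<in> \<C>" "carrier H \<noteq> {\<one>\<^bsub>H\<^esub>}" using \<C> by blast
    show ?thesis
      unfolding weihrauch_equiv_def
      using Res_finite_le_Lim_desc[OF assms _ _ f, of \<C>] Lim_desc_le_Res_finite[OF assms _ _ H, of f] \<C> by blast
  qed
qed

end
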